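(* Let $n\geq 0$, let $X$ be a space, $y_0\in X$, $\{x_j\}_{j\in\mathbb{N}}$ a sequence in $X$, and let each based space $(A_j,a_j)$ be sequentially $n$-connected. Let $Y=\operatorname{\bf Adj}(X,x_j,A_j,a_j)$ and let $r:Y\to X$ be the canonical retraction. Then every sequence $\{f_m\}_{m\in\mathbb{N}}$ in $\Omega^n(Y,y_0)$ that converges to $y_0$ is sequentially homotopic to $\{r\circ f_m\}_{m\in\mathbb{N}}$. Moreover, if $X$ is sequentially $n$-connected at $y_0$, then $Y$ is sequentially $n$-connected at $y_0$.
   Context: All spaces Hausdorff. $\Omega^n(Y,y_0)$ is the set of maps $(I^n,\partial I^n)\to(Y,y_0)$. A family of maps $\{f_m\}$ into $Y$ converges to $y$ if for every neighborhood $U$ of $y$, $\operatorname{Im}(f_m)\subseteq U$ for all but finitely many $m$. Two sequences $\{f_m\},\{g_m\}$ of maps $Z\to Y$ converging to $y_0$ are sequentially homotopic if there are (free) homotopies $H_m:Z\times I\to Y$ from $f_m$ to $g_m$ such that $\{H_m\}$ converges to $y_0$. $\operatorname{\bf Adj}(X,x_j,A_j,a_j)$: $Y_k$ is the adjunction space from $X\sqcup A_1\sqcup\dots\sqcup A_k$ with $a_j\sim x_j$ ($j\le k$), $Y_{k+1}\to Y_k$ collapses $A_{k+1}$ to $x_{k+1}$, and the space is $\varprojlim_kY_k\subseteq\prod_kY_k$, with underlying set $(X\sqcup\coprod_j A_j)/(a_j\sim x_j)$; $r$ collapses each $A_j$ to $x_j$. $\mathbb{H}_0=\{0\}\cup\{1/m:m\in\mathbb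 N\}$ based at $0$; for $k\ge1$, $\mathbb{H}_k$ is the shrinking wedge of countably many $k$-spheres (one-point union at basepoints, where a set containing the wedge point is open iff it is open in each sphere and contains all but finitely many spheres). A space is sequentially $n$-connected at $x$ if the set of based homotopy classes $[(\mathbb{H}_k,b_0),(X,x)]$ is a singleton for all $0\le k\le n$; a based space $(A,a)$ is sequentially $n$-connected if $A$ is so at $a$. *)

theory Defs
  imports "HOL-Analysis.Analysis"
begin

definition cube :: "nat \<Rightarrow> (nat \<Rightarrow> real) topology" where
  "cube n = product_topology (\<lambda>_. top_of_set {0..1}) {..<n}"

definition cube_boundary :: "nat \<Rightarrow> (nat \<Rightarrow> real) set" where
  "cube_boundary n = {t \<in> topspace (cube n). \<exists>i<n. t i = 0 \<or> t i = 1}"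

definition Omega :: "nat \<Rightarrow> 'a topology \<Rightarrow> 'a \<Rightarrow> ((nat \<Rightarrow> real) \<Rightarrow> 'a) set" where
  "Omega n Y y0 = {f. continuous_map (cube n) Y f \<and> (\<forall>t\<in>cube_boundary n. f t = y0)}"

definition maps_converge :: "'z topology \<Rightarrow> 'a topology \<Rightarrow> (nat \<Rightarrow> 'z \<Rightarrow> 'a) \<Rightarrow> 'a \<Rightarrow> bool" where
  "maps_converge Z Y f y \<longleftrightarrow>
     (\<forall>U. openin Y U \<and> y \<in> U \<longrightarrow> eventually (\<lambda>m. f m ` topspace Z \<subseteq> U) sequentially)"

definition seq_homotopic ::
  "'z topology \<Rightarrow> 'a topology \<Rightarrow> 'a \<Rightarrow> (nat \<Rightarrow> 'z \<Rightarrow> 'a) \<Rightarrow> (nat \<Rightarrow> 'z \<Rightarrow> 'a) \<Rightarrow> bool" where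
  "seq_homotopic Z Y y0 f g \<longleftrightarrow>
     maps_converge Z Y f y0 \<and> maps_converge Z Y g y0 \<and>
     (\<exists>H :: nat \<Rightarrow> 'z \<times> real \<Rightarrow> 'a.
        (\<forall>m. continuous_map (prod_topology Z (top_of_set {0..1})) Y (H m) \<and>
             (\<forall>z\<in>topspace Z. H m (z, 0) = f m z \<and> H m (z, 1) = g m z)) \<and>
        maps_converge (prod_topology Z (top_of_set {0..1})) Y H y0)"

definition H0 :: "real topology" where
  "H0 = top_of_set (insert 0 {1 / real m | m. m \<ge> 1})"

definition sphere_top :: "nat \<Rightarrow> (nat \<Rightarrow> real) topology" where
  "sphere_top k = subtopology (product_topology (\<lambda>_. euclideanreal) {..k})
                     {p \<in> PiE {..k} (\<lambda>_. UNIV). (\<Sum>i\<le>k. (p i)\<^sup>2) = 1}"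

definition sphere_base :: "nat \<Rightarrow> nat \<Rightarrow> real" where
  "sphere_base k = (\<lambda>i. if i = 0 then 1 else if i \<le> k then 0 else undefined)"

definition wedge_incl :: "nat \<Rightarrow> nat \<Rightarrow> (nat \<Rightarrow> real) \<Rightarrow> (nat \<times> (nat \<Rightarrow> real)) option" where
  "wedge_incl k m p = (if p = sphere_base k then None else Some (m, p))"

definition wedge_points :: "nat \<Rightarrow> (nat \<times> (nat \<Rightarrow> real)) option set" where
  "wedge_points k = (\<Union>m. wedge_incl k m ` topspace (sphere_top k))"

definition shrinking_wedge :: "nat \<Rightarrow> (nat \<times> (nat \<Rightarrow> real)) option topology" where
  "shrinking_wedge k = topology (\<lambda>U. U \<subseteq> wedge_points k \<and>
      (\<forall>m. openin (sphere_top k) {p \<in> topspace (sphere_top k). wedge_incl k m p \<in> U}) \<and>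
      (None \<in> U \<longrightarrow> finite {m. \<not> (wedge_incl k m ` topspace (sphere_top k) \<subseteq> U)}))"

definition based_maps :: "'h topology \<Rightarrow> 'h \<Rightarrow> 'a topology \<Rightarrow> 'a \<Rightarrow> ('h \<Rightarrow> 'a) set" where
  "based_maps H b X x = {f. continuous_map H X f \<and> f b = x}"

definition based_homotopy_classes :: "'h topology \<Rightarrow> 'h \<Rightarrow> 'a topology \<Rightarrow> 'a \<Rightarrow> ('h \<Rightarrow> 'a) set set" where
  "based_homotopy_classes H b X x =
     {{g \<in> based_maps H b X x. homotopic_with (\<lambda>h. h b = x) H X f g} | f. f \<in> based_maps H b X x}"

definition seq_n_connected_at :: "'a topology \<Rightarrow> 'a \<Rightarrow> nat \<Rightarrow> bool" where
  "seq_n_connected_at X x n \<longleftrightarrow>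
     (\<exists>c. based_homotopy_classes H0 0 X x = {c}) \<and>
     (\<forall>k. 1 \<le> k \<and> k \<le> n \<longrightarrow> (\<exists>c. based_homotopy_classes (shrinking_wedge k) None X x = {c}))"

text \<open>Points of (X \<squnion> \<Squnion>_{j<k} A_j)/(a_j ~ x_j): Inl p for p in X, Inr (j,q) for q in A_j - {a_j}.
  k = None means all j (the full underlying set of the limit).\<close>
definition adj_points :: "'a topology \<Rightarrow> (nat \<Rightarrow> 'b topology) \<Rightarrow> (nat \<Rightarrow> 'b) \<Rightarrow> nat \<Rightarrow> ('a + nat \<times> 'b) set" where
  "adj_points X A a k = Inl ` topspace X \<union> {Inr (j, q) | j q. j < k \<and> q \<in> topspace (A j) \<and> q \<noteq> a j}"

definition adj_all_points :: "'a topology \<Rightarrow> (nat \<Rightarrow> 'b topology) \<Rightarrow> (nat \<Rightarrow> 'b) \<Rightarrow> ('a + nat \<times> 'b) set" where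
  "adj_all_points X A a = Inl ` topspace X \<union> {Inr (j, q) | j q. q \<in> topspace (A j) \<and> q \<noteq> a j}"

definition adj_glue :: "(nat \<Rightarrow> 'a) \<Rightarrow> (nat \<Rightarrow> 'b) \<Rightarrow> nat \<Rightarrow> 'b \<Rightarrow> 'a + nat \<times> 'b" where
  "adj_glue x a j q = (if q = a j then Inl (x j) else Inr (j, q))"

text \<open>Y_k: the adjunction (quotient) space of X \<squnion> A_0 \<squnion> ... \<squnion> A_(k-1) with a_j ~ x_j.\<close>
definition adj_stage :: "'a topology \<Rightarrow> (nat \<Rightarrow> 'a) \<Rightarrow> (nat \<Rightarrow> 'b topology) \<Rightarrow> (nat \<Rightarrow> 'b) \<Rightarrow> nat \<Rightarrow> ('a + nat \<times> 'b) topology" where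
  "adj_stage X x A a k = topology (\<lambda>U. U \<subseteq> adj_points X A a k \<and>
      openin X {p \<in> topspace X. Inl p \<in> U} \<and>
      (\<forall>j<k. openin (A j) {q \<in> topspace (A j). adj_glue x a j q \<in> U}))"

definition adj_proj :: "(nat \<Rightarrow> 'a) \<Rightarrow> nat \<Rightarrow> 'a + nat \<times> 'b \<Rightarrow> 'a + nat \<times> 'b" where
  "adj_proj x k y = (case y of Inl p \<Rightarrow> Inl p | Inr (j, q) \<Rightarrow> (if j < k then Inr (j, q) else Inl (x j)))"

text \<open>Adj(X,x_j,A_j,a_j): the underlying set identified with lim Y_k \<subseteq> \<Prod>_k Y_k via
  y \<mapsto> (adj_proj k y)_k, carrying the subspace topology of the product topology.\<close>
definition Adj :: "'a topology \<Rightarrow> (nat \<Rightarrow> 'a) \<Rightarrow> (nat \<Rightarrow> 'b topology) \<Rightarrow> (nat \<Rightarrow> 'b) \<Rightarrow> ('a + nat \<times> 'b) topology" where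
  "Adj X x A a = topology (\<lambda>U. U \<subseteq> adj_all_points X A a \<and>
      (\<exists>V. openin (product_topology (\<lambda>k. adj_stage X x A a k) UNIV) V \<and>
           U = {y \<in> adj_all_points X A a. (\<lambda>k. adj_proj x k y) \<in> V}))"

definition adj_retraction :: "(nat \<Rightarrow> 'a) \<Rightarrow> 'a + nat \<times> 'b \<Rightarrow> 'a" where
  "adj_retraction x y = (case y of Inl p \<Rightarrow> p | Inr (j, q) \<Rightarrow> x j)"

end

theory Submission
  imports Defs
begin

text \<open>The topology of \<open>Adj X x A a\<close> is the initial one for the retraction to \<open>X\<close> and the collapses to
  the \<open>A j\<close>.  Hence it suffices to deform the \<open>A j\<close>-coordinate \<open>g m\<close> of \<open>f m\<close> to the constant \<open>a j\<close>,
  for each \<open>j\<close> separately, by homotopies that are stationary where \<open>g m = a j\<close> and that converge to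
  \<open>a j\<close>.  To this end the open set where \<open>g m \<noteq> a j\<close> is cut into dyadic cells accumulating only at its
  frontier, and the homotopy is extended over \<open>cell \<times> [0, 1]\<close> by induction on the dimension \<open>k\<close> of the
  cell.  The boundaries of these products, for all \<open>m\<close> and all \<open>k\<close>-cells at once, form a sequence of
  based \<open>k\<close>-spheres converging to \<open>a j\<close>, which sequential connectedness fills by balls that again
  converge to \<open>a j\<close>; this gives continuity at the frontier.\<close>

section \<open>The topology of the adjunction space\<close>

text \<open>Applying the connectivity of \<open>A j\<close> to the coordinate maps as they stand is
  not enough: the nullhomotopy may also move points where the coordinate equals \<open>a j\<close>.
  Such points may lie in \<open>X\<close> or in another summand, so a coordinate moving there would
  leave the adjunction space; stationarity is what lets the homotopies for different
  \<open>j\<close> run side by side. But the set where the coordinate differs from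
  \<open>a j\<close> is an arbitrary open set, and fillings chosen cell by cell carry no control of
  their size. Sequential connectedness supplies that control only when one null sequence contains
  all the spheres to be filled. A \<open>k\<close>-cell times the interval is a
  \<open>(k+1)\<close>-dimensional ball, so cells of dimensions 0 to \<open>n\<close> call for
  spheres of dimensions 0 to \<open>n\<close>; the end at time 1 is constant at \<open>a j\<close>
  and provides their basepoints. For the second assertion a map of the wedge is a null sequence of
  maps of spheres, and a sphere of positive dimension is a quotient of a cube; stationarity returns
  here, since it lets the homotopy descend to the quotient and keeps the basepoint fixed.\<close>

lemma istopology_final:
  "istopology (\<lambda>U. U \<subseteq> P \<and> (\<forall>i\<in>I. openin (Z i) {z \<in> topspace (Z i). f i z \<in> U}))"
  unfolding istopology_def
proof (intro conjI allI impI)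
  fix S T
  assume S: "S \<subseteq> P \<and> (\<forall>i\<in>I. openin (Z i) {z \<in> topspace (Z i). f i z \<in> S})"
    and T: "T \<subseteq> P \<and> (\<forall>i\<in>I. openin (Z i) {z \<in> topspace (Z i). f i z \<in> T})"
  then show "S \<inter> T \<subseteq> P" by blast
  have "{z \<in> topspace (Z i). f i z \<in> S \<inter> T} =
      {z \<in> topspace (Z i). f i z \<in> S} \<inter> {z \<in> topspace (Z i). f i z \<in> T}" for i
    by blast
  then show "\<forall>i\<in>I. openin (Z i) {z \<in> topspace (Z i). f i z \<in> S \<inter> T}"
    using S T by (simp add: openin_Int)
next
  fix K
  assume K: "\<forall>U\<in>K. U \<subseteq> P \<and> (\<forall>i\<in>I. openin (Z i) {z \<in> topspace (Z i). f i z \<in> U})"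
  then show "\<Union>K \<subseteq> P" by blast
  show "\<forall>i\<in>I. openin (Z i) {z \<in> topspace (Z i). f i z \<in> \<Union>K}"
  proof
    fix i assume "i \<in> I"
    then have "openin (Z i) (\<Union>U\<in>K. {z \<in> topspace (Z i). f i z \<in> U})"
      using K by (intro openin_Union) auto
    moreover have "(\<Union>U\<in>K. {z \<in> topspace (Z i). f i z \<in> U}) = {z \<in> topspace (Z i). f i z \<in> \<Union>K}"
      by blast
    ultimately show "openin (Z i) {z \<in> topspace (Z i). f i z \<in> \<Union>K}" by simp
  qed
qed

lemma istopology_conj:
  assumes "istopology P" "istopology Q"
  shows "istopology (\<lambda>U. P U \<and> Q U)"
  using assms by (simp add: istopology_def)

lemma openin_adj_stage:
  "openin (adj_stage X x A a k) U \<longleftrightarrow> U \<subseteq> adj_points X A a k \<and>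
      openin X {p \<in> topspace X. Inl p \<in> U} \<and>
      (\<forall>j<k. openin (A j) {q \<in> topspace (A j). adj_glue x a j q \<in> U})"
proof -
  \<comment> \<open>The condition on \<open>X\<close> is written as a family over a one-point set,
    so that both conditions are instances of the final topology of a family.\<close>
  have "istopology (\<lambda>U. (U \<subseteq> adj_points X A a k \<and>
      (\<forall>i\<in>{()}. openin X {p \<in> topspace X. Inl p \<in> U})) \<and>
      (U \<subseteq> adj_points X A a k \<and> (\<forall>j\<in>{..<k}. openin (A j) {q \<in> topspace (A j). adj_glue x a j q \<in> U})))"
    by (intro istopology_conj istopology_final)
  then have "istopology (\<lambda>U. U \<subseteq> adj_points X A a k \<and>
      openin X {p \<in> topspace X. Inl p \<in> U} \<and>
      (\<forall>j<k. openin (A j) {q \<in> topspace (A j). adj_glue x a j q \<in> U}))"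
    by (rule back_subst[where P = istopology]) auto
  then show ?thesis
    unfolding adj_stage_def by (simp add: topology_inverse')
qed

lemma topspace_adj_stage:
  assumes "\<And>j. x j \<in> topspace X"
  shows "topspace (adj_stage X x A a k) = adj_points X A a k"
proof (rule antisym)
  show "topspace (adj_stage X x A a k) \<subseteq> adj_points X A a k"
    using openin_adj_stage openin_topspace by blast
  have "{p \<in> topspace X. Inl p \<in> adj_points X A a k} = topspace X"
    by (auto simp: adj_points_def)
  moreover have "{q \<in> topspace (A j). adj_glue x a j q \<in> adj_points X A a k} = topspace (A j)" if "j < k" for j
    using that assms by (auto simp: adj_points_def adj_glue_def)
  ultimately have "openin (adj_stage X x A a k) (adj_points X A a k)"
    by (simp add: openin_adj_stage)
  then show "adj_points X A a k \<subseteq> topspace (adj_stage X x A a k)"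
    by (rule openin_subset)
qed

lemma Adj_eq_pullback_stages:
  "Adj X x A a = pullback_topology (adj_all_points X A a) (\<lambda>y k. adj_proj x k y)
      (product_topology (\<lambda>k. adj_stage X x A a k) UNIV)"
  unfolding Adj_def pullback_topology_def
  by (rule arg_cong[where f = topology]) (auto simp: fun_eq_iff)

lemma maps_converge_compose:
  assumes "maps_converge Z Y f y" "continuous_map Y Y' g" "y \<in> topspace Y"
    and "\<And>m. f m ` topspace Z \<subseteq> topspace Y"
  shows "maps_converge Z Y' (\<lambda>m z. g (f m z)) (g y)"
  unfolding maps_converge_def
proof (intro allI impI)
  fix U assume U: "openin Y' U \<and> g y \<in> U"
  then have "openin Y {v \<in> topspace Y. g v \<in> U}" "y \<in> {v \<in> topspace Y. g v \<in> U}"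
    using assms openin_continuous_map_preimage by blast+
  then have "eventually (\<lambda>m. f m ` topspace Z \<subseteq> {v \<in> topspace Y. g v \<in> U}) sequentially"
    using assms(1) unfolding maps_converge_def by blast
  then show "eventually (\<lambda>m. (\<lambda>z. g (f m z)) ` topspace Z \<subseteq> U) sequentially"
    by (rule eventually_mono) auto
qed

section \<open>Collapses to the single summands and the initial topology\<close>

definition adj_coord :: "(nat \<Rightarrow> 'b) \<Rightarrow> nat \<Rightarrow> 'a + nat \<times> 'b \<Rightarrow> 'b" where
  "adj_coord a j y = (case y of Inl p \<Rightarrow> a j | Inr (i, q) \<Rightarrow> if i = j then q else a j)"

definition adj_embed :: "(nat \<Rightarrow> 'a) \<Rightarrow> (nat \<Rightarrow> 'b) \<Rightarrow> 'a + nat \<times> 'b \<Rightarrow> 'a \<times> (nat \<Rightarrow> 'b)" where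
  "adj_embed x a y = (adj_retraction x y, \<lambda>j. adj_coord a j y)"

context
  fixes X :: "'a topology" and x :: "nat \<Rightarrow> 'a" and A :: "nat \<Rightarrow> 'b topology" and a :: "nat \<Rightarrow> 'b"
  assumes t1: "\<And>j. t1_space (A j)"
    and xX: "\<And>j. x j \<in> topspace X"
    and aA: "\<And>j. a j \<in> topspace (A j)"
begin

lemma adj_retraction_in: "y \<in> adj_all_points X A a \<Longrightarrow> adj_retraction x y \<in> topspace X"
  by (auto simp: adj_all_points_def adj_retraction_def xX)

lemma adj_coord_in: "y \<in> adj_all_points X A a \<Longrightarrow> adj_coord a j y \<in> topspace (A j)"
  by (auto simp: adj_all_points_def adj_coord_def aA)

lemma adj_proj_in: "y \<in> adj_all_points X A a \<Longrightarrow> adj_proj x k y \<in> adj_points X A a k"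
  by (auto simp: adj_all_points_def adj_points_def adj_proj_def xX)

lemma topspace_Adj: "topspace (Adj X x A a) = adj_all_points X A a"
  by (auto simp: Adj_eq_pullback_stages topspace_pullback_topology topspace_adj_stage[OF xX] adj_proj_in)

lemma continuous_map_adj_proj: "continuous_map (Adj X x A a) (adj_stage X x A a k) (adj_proj x k)"
proof -
  have "continuous_map (Adj X x A a) (adj_stage X x A a k) ((\<lambda>z. z k) \<circ> (\<lambda>y k. adj_proj x k y))"
    unfolding Adj_eq_pullback_stages
    by (intro continuous_map_pullback continuous_map_product_projection) auto
  then show ?thesis by (simp add: o_def)
qed

lemma continuous_map_adj_retraction: "continuous_map (Adj X x A a) X (adj_retraction x)"
proof -
  have "continuous_map (adj_stage X x A a 0) X (adj_retraction x)"
    unfolding continuous_map_def topspace_adj_stage[OF xX]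
  proof (intro conjI allI impI)
    show "adj_retraction x \<in> adj_points X A a 0 \<rightarrow> topspace X"
      by (auto simp: adj_points_def adj_retraction_def)
    fix U assume "openin X U"
    moreover have "{p \<in> topspace X. Inl p \<in> {y \<in> adj_points X A a 0. adj_retraction x y \<in> U}} = U"
      using openin_subset[OF \<open>openin X U\<close>] by (auto simp: adj_points_def adj_retraction_def)
    ultimately show "openin (adj_stage X x A a 0) {y \<in> adj_points X A a 0. adj_retraction x y \<in> U}"
      by (auto simp: openin_adj_stage)
  qed
  then have "continuous_map (Adj X x A a) X (adj_retraction x \<circ> adj_proj x 0)"
    using continuous_map_adj_proj continuous_map_compose by blast
  then show ?thesis
    by (rule continuous_map_eq) (auto simp: adj_retraction_def adj_proj_def split: sum.splits)
qed

lemma continuous_map_adj_coord: "continuous_map (Adj X x A a) (A j) (adj_coord a j)"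
proof -
  have "continuous_map (adj_stage X x A a (Suc j)) (A j) (adj_coord a j)"
    unfolding continuous_map_def topspace_adj_stage[OF xX]
  proof (intro conjI allI impI)
    show "adj_coord a j \<in> adj_points X A a (Suc j) \<rightarrow> topspace (A j)"
      by (auto simp: adj_points_def adj_coord_def aA)
    fix U assume U: "openin (A j) U"
    let ?V = "{y \<in> adj_points X A a (Suc j). adj_coord a j y \<in> U}"
    have "{p \<in> topspace X. Inl p \<in> ?V} = (if a j \<in> U then topspace X else {})"
      by (auto simp: adj_points_def adj_coord_def)
    moreover have "{q \<in> topspace (A j). adj_glue x a j q \<in> ?V} = U"
      using openin_subset[OF U] xX by (auto simp: adj_points_def adj_coord_def adj_glue_def)
    moreover have "{q \<in> topspace (A i). adj_glue x a i q \<in> ?V} = (if a j \<in> U then topspace (A i) else {})"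
      if "i < j" for i
      using that xX by (auto simp: adj_points_def adj_coord_def adj_glue_def)
    ultimately show "openin (adj_stage X x A a (Suc j)) ?V"
      using U by (auto simp: openin_adj_stage less_Suc_eq)
  qed
  then have "continuous_map (Adj X x A a) (A j) (adj_coord a j \<circ> adj_proj x (Suc j))"
    using continuous_map_adj_proj continuous_map_compose by blast
  then show ?thesis
    by (rule continuous_map_eq) (auto simp: adj_coord_def adj_proj_def split: sum.splits)
qed

text \<open>The stage topology is already determined by the collapses to \<open>X\<close> and to the \<open>A j\<close>: the
  preimage of an open \<open>U\<close> splits into the part near \<open>X\<close> and the parts inside a single \<open>A j\<close>
  away from \<open>a j\<close>.\<close>

lemma Adj_eq_pullback_embed:
  "Adj X x A a = pullback_topology (adj_all_points X A a) (adj_embed x a)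
      (prod_topology X (product_topology A UNIV))" (is "_ = ?T")
proof (rule topology_eq[THEN iffD2], intro allI iffI)
  have topT: "topspace ?T = adj_all_points X A a"
    by (auto simp: topspace_pullback_topology adj_embed_def adj_retraction_in adj_coord_in)
  have "continuous_map ?T (prod_topology X (product_topology A UNIV)) (id \<circ> adj_embed x a)"
    by (rule continuous_map_pullback) (rule continuous_map_id)
  then have emb: "continuous_map ?T (prod_topology X (product_topology A UNIV)) (adj_embed x a)"
    by simp
  have r: "continuous_map ?T X (adj_retraction x)"
    using continuous_map_compose[OF emb continuous_map_fst] by (simp add: o_def adj_embed_def)
  have c: "continuous_map ?T (A j) (adj_coord a j)" for j
    using continuous_map_compose[OF continuous_map_compose[OF emb continuous_map_snd]
        continuous_map_product_projection[of j UNIV A]] by (simp add: o_def adj_embed_def)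
  have stage: "continuous_map ?T (adj_stage X x A a k) (adj_proj x k)" for k
    unfolding continuous_map_def topspace_adj_stage[OF xX] topT
  proof (intro conjI allI impI)
    show "adj_proj x k \<in> adj_all_points X A a \<rightarrow> adj_points X A a k"
      using adj_proj_in by blast
    fix U assume "openin (adj_stage X x A a k) U"
    define V where "V = {p \<in> topspace X. Inl p \<in> U}"
    define W where "W l = {q \<in> topspace (A l). adj_glue x a l q \<in> U}" for l
    have V: "openin X V" and W: "\<And>l. l < k \<Longrightarrow> openin (A l) (W l)"
      using \<open>openin (adj_stage X x A a k) U\<close> by (auto simp: openin_adj_stage V_def W_def)
    \<comment> \<open>\<open>a l\<close> lies in \<open>W l\<close> iff \<open>x l\<close> lies in
      \<open>V\<close>. Hence for \<open>x l \<in> V\<close> the condition on the coordinate is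
      automatic outside \<open>A l\<close>, while for \<open>x l \<notin> V\<close> it would fail
      there and must not be imposed. The second part removes \<open>a l\<close> because that is the
      value of the coordinate everywhere outside \<open>A l\<close>.\<close>
    have LR: "{y \<in> adj_all_points X A a. adj_proj x k y \<in> U} =
       ({y \<in> topspace ?T. adj_retraction x y \<in> V} \<inter>
         (\<Inter>l\<in>{l. l < k \<and> x l \<in> V}. {y \<in> topspace ?T. adj_coord a l y \<in> W l})) \<union>
       (\<Union>l\<in>{..<k}. {y \<in> topspace ?T. adj_coord a l y \<in> W l - {a l}})" (is "?L = ?R")
    proof (rule set_eqI)
      fix y show "y \<in> ?L \<longleftrightarrow> y \<in> ?R"
      proof (cases y)
        case (Inl p)
        then show ?thesis unfolding topT
          by (auto simp: V_def W_def adj_all_points_def adj_retraction_def adj_coord_def adj_proj_def adj_glue_def aA)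
      next
        case (Inr z)
        obtain j q where z: "z = (j, q)" by force
        show ?thesis unfolding topT Inr z
          by (auto simp: V_def W_def adj_all_points_def adj_retraction_def adj_coord_def adj_proj_def adj_glue_def aA xX)
      qed
    qed
    have 1: "openin ?T {y \<in> topspace ?T. adj_retraction x y \<in> V}"
      using r V openin_continuous_map_preimage by blast
    have 2: "openin ?T {y \<in> topspace ?T. adj_coord a l y \<in> W l}" if "l < k" for l
      using c W[OF that] openin_continuous_map_preimage by blast
    have 3: "openin ?T {y \<in> topspace ?T. adj_coord a l y \<in> W l - {a l}}" if "l < k" for l
    proof -
      have "closedin (A l) {a l}" using t1 aA by (simp add: t1_space_closedin_singleton)
      then show ?thesis using c openin_diff[OF W[OF that]] openin_continuous_map_preimage by blast
    qed
    have "openin ?T ({y \<in> topspace ?T. adj_retraction x y \<in> V} \<inter>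
         (\<Inter>l\<in>{l. l < k \<and> x l \<in> V}. {y \<in> topspace ?T. adj_coord a l y \<in> W l}))"
    proof (cases "{l. l < k \<and> x l \<in> V} = {}")
      case True
      show ?thesis using 1 by (simp only: True INT_empty Int_UNIV_right)
    next
      case False
      then show ?thesis using 1 2 by (intro openin_Int openin_Inter) auto
    qed
    then show "openin ?T {y \<in> adj_all_points X A a. adj_proj x k y \<in> U}"
      unfolding LR using 3 by (intro openin_Un openin_Union) auto
  qed
  fix U
  {
    assume U: "openin (Adj X x A a) U"
    have "continuous_map ?T (product_topology (\<lambda>k. adj_stage X x A a k) UNIV) (\<lambda>y k. adj_proj x k y)"
      using stage by (simp add: continuous_map_componentwise_UNIV)
    then have "continuous_map ?T (Adj X x A a) id"
      unfolding Adj_eq_pullback_stages by (intro continuous_map_pullback') (auto simp: o_def topT)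
    then have "openin ?T {y \<in> topspace ?T. id y \<in> U}" using U openin_continuous_map_preimage by blast
    moreover have "{y \<in> topspace ?T. id y \<in> U} = U"
      using openin_subset[OF U] by (auto simp: topT topspace_Adj)
    ultimately show "openin ?T U" by simp
  next
    assume U: "openin ?T U"
    have "continuous_map (Adj X x A a) (prod_topology X (product_topology A UNIV)) (adj_embed x a)"
      unfolding adj_embed_def
      using continuous_map_adj_retraction continuous_map_adj_coord
      by (simp add: continuous_map_pairwise o_def continuous_map_componentwise_UNIV)
    then have "continuous_map (Adj X x A a) ?T id"
      by (intro continuous_map_pullback') (auto simp: o_def topspace_Adj)
    then have "openin (Adj X x A a) {y \<in> topspace (Adj X x A a). id y \<in> U}"
      using U openin_continuous_map_preimage by blast
    moreover have "{y \<in> topspace (Adj X x A a). id y \<in> U} = U"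
      using openin_subset[OF U] by (auto simp: topT topspace_Adj)
    ultimately show "openin (Adj X x A a) U" by simp
  }
qed

lemma continuous_map_into_Adj:
  assumes "\<And>z. z \<in> topspace Z \<Longrightarrow> f z \<in> adj_all_points X A a"
    and "continuous_map Z X (\<lambda>z. adj_retraction x (f z))"
    and "\<And>j. continuous_map Z (A j) (\<lambda>z. adj_coord a j (f z))"
  shows "continuous_map Z (Adj X x A a) f"
  unfolding Adj_eq_pullback_embed
proof (rule continuous_map_pullback')
  show "continuous_map Z (prod_topology X (product_topology A UNIV)) (adj_embed x a \<circ> f)"
    using assms by (simp add: continuous_map_pairwise adj_embed_def o_def continuous_map_componentwise_UNIV)
qed (use assms in auto)

text \<open>A basic neighbourhood in the product restricts only finitely many coordinates, so
  convergence may be checked for each \<open>j\<close> separately, with no uniformity in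
  \<open>j\<close>.\<close>

lemma maps_converge_Adj:
  assumes f: "\<And>m z. z \<in> topspace Z \<Longrightarrow> f m z \<in> adj_all_points X A a"
    and r: "maps_converge Z X (\<lambda>m z. adj_retraction x (f m z)) y"
    and c: "\<And>j. maps_converge Z (A j) (\<lambda>m z. adj_coord a j (f m z)) (a j)"
  shows "maps_converge Z (Adj X x A a) f (Inl y)"
  unfolding maps_converge_def
proof (intro allI impI)
  fix U assume U: "openin (Adj X x A a) U \<and> Inl y \<in> U"
  then obtain V where V: "openin (prod_topology X (product_topology A UNIV)) V"
    and UV: "U = adj_embed x a -` V \<inter> adj_all_points X A a"
    unfolding Adj_eq_pullback_embed openin_pullback_topology by blast
  have "(y, a) \<in> V"
    using U UV by (auto simp: adj_embed_def adj_retraction_def adj_coord_def)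
  then obtain V1 V2 where V1: "openin X V1" "y \<in> V1" and V2: "openin (product_topology A UNIV) V2" "a \<in> V2"
    and V12: "V1 \<times> V2 \<subseteq> V"
    using V unfolding openin_prod_topology_alt by blast
  obtain W where W: "finite {i. W i \<noteq> topspace (A i)}" "\<And>i. openin (A i) (W i)" "a \<in> Pi\<^sub>E UNIV W" "Pi\<^sub>E UNIV W \<subseteq> V2"
    using V2 unfolding openin_product_topology_alt by auto
  have "eventually (\<lambda>m. (\<lambda>z. adj_retraction x (f m z)) ` topspace Z \<subseteq> V1) sequentially"
    using r V1 unfolding maps_converge_def by blast
  moreover have "eventually (\<lambda>m. \<forall>i\<in>{i. W i \<noteq> topspace (A i)}. (\<lambda>z. adj_coord a i (f m z)) ` topspace Z \<subseteq> W i) sequentially"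
    using W(2,3) c by (intro eventually_ball_finite[OF W(1)] ballI) (simp add: maps_converge_def PiE_iff)
  ultimately show "eventually (\<lambda>m. f m ` topspace Z \<subseteq> U) sequentially"
  proof eventually_elim
    case (elim m)
    have "f m z \<in> U" if z: "z \<in> topspace Z" for z
    proof -
      have "adj_coord a i (f m z) \<in> W i" for i
        using elim(2) z adj_coord_in[OF f[OF z]] by (cases "W i = topspace (A i)") auto
      then have "(\<lambda>i. adj_coord a i (f m z)) \<in> V2" using W(4) by (auto simp: PiE_iff)
      then show ?thesis using elim(1) z f[OF z] V12 by (auto simp: UV adj_embed_def)
    qed
    then show ?case by blast
  qed
qed

end

text \<open>The clause on \<open>g m z = a\<close> makes the homotopy stationary, which is stronger
  than fixing it on \<open>B\<close>. The set \<open>B\<close> narrows the class of sequences: it is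
  empty for cubes and the basepoint for spheres.\<close>

definition rel_contracting :: "'z topology \<Rightarrow> 'z set \<Rightarrow> 'b topology \<Rightarrow> 'b \<Rightarrow> bool" where
  "rel_contracting Z B A a \<longleftrightarrow> (\<forall>g.
     (\<forall>m. continuous_map Z A (g m) \<and> (\<forall>z\<in>B. g m z = a)) \<and> maps_converge Z A g a \<longrightarrow>
     (\<exists>h. (\<forall>m. continuous_map (prod_topology Z (top_of_set {0..1::real})) A (h m) \<and>
             (\<forall>z\<in>topspace Z. h m (z, 0) = g m z \<and> h m (z, 1) = a \<and>
                (g m z = a \<longrightarrow> (\<forall>s\<in>{0..1}. h m (z, s) = a)))) \<and>
          maps_converge (prod_topology Z (top_of_set {0..1::real})) A h a))"

text \<open>A point off \<open>X\<close> lies in exactly one \<open>A j\<close>, and moving it by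
  the homotopy for that \<open>j\<close> is consistent with the others because they rest there. The
  clause for \<open>f m z = Inl p\<close> records that points of \<open>X\<close> never move; it
  keeps basepoints fixed later.\<close>

lemma Adj_homotopy_to_retraction:
  fixes X :: "'a topology" and A :: "nat \<Rightarrow> 'b topology"
  assumes t1: "\<And>j. t1_space (A j)"
    and xX: "\<And>j. x j \<in> topspace X"
    and aA: "\<And>j. a j \<in> topspace (A j)"
    and contr: "\<And>j. rel_contracting Z B (A j) (a j)"
    and f: "\<And>m. continuous_map Z (Adj X x A a) (f m)"
    and fB: "\<And>m z. z \<in> B \<Longrightarrow> f m z = Inl y"
    and y: "y \<in> topspace X"
    and conv: "maps_converge Z (Adj X x A a) f (Inl y)"
  obtains H where "\<And>m. continuous_map (prod_topology Z (top_of_set {0..1::real})) (Adj X x A a) (H m)"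
    and "\<And>m z. z \<in> topspace Z \<Longrightarrow> H m (z, 0) = f m z"
    and "\<And>m z. z \<in> topspace Z \<Longrightarrow> H m (z, 1) = Inl (adj_retraction x (f m z))"
    and "\<And>m z s p. f m z = Inl p \<Longrightarrow> H m (z, s) = Inl p"
    and "maps_converge (prod_topology Z (top_of_set {0..1::real})) (Adj X x A a) H (Inl y)"
proof -
  let ?I = "top_of_set {0..1::real}"
  note top = topspace_Adj[OF t1 xX aA]
  have fA: "f m z \<in> adj_all_points X A a" if "z \<in> topspace Z" for m z
    using continuous_map_funspace[OF f] that top by auto
  have yA: "Inl y \<in> topspace (Adj X x A a)" using y by (simp add: top adj_all_points_def)
  have rconv: "maps_converge Z X (\<lambda>m z. adj_retraction x (f m z)) y"
    using maps_converge_compose[OF conv continuous_map_adj_retraction[OF t1 xX aA] yA]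
      continuous_map_image_subset_topspace[OF f] by (simp add: adj_retraction_def)
  have cconv: "maps_converge Z (A j) (\<lambda>m z. adj_coord a j (f m z)) (a j)" for j
    using maps_converge_compose[OF conv continuous_map_adj_coord[OF t1 xX aA] yA]
      continuous_map_image_subset_topspace[OF f] by (simp add: adj_coord_def)
  have rcont: "continuous_map Z X (\<lambda>z. adj_retraction x (f m z))" for m
    using continuous_map_compose[OF f continuous_map_adj_retraction[OF t1 xX aA]] by (simp add: o_def)
  have ccont: "continuous_map Z (A j) (\<lambda>z. adj_coord a j (f m z))" for m j
    using continuous_map_compose[OF f continuous_map_adj_coord[OF t1 xX aA]] by (simp add: o_def)
  have "\<exists>h. (\<forall>m. continuous_map (prod_topology Z ?I) (A j) (h m) \<and>
             (\<forall>z\<in>topspace Z. h m (z, 0) = adj_coord a j (f m z) \<and> h m (z, 1) = a j \<and>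
                (adj_coord a j (f m z) = a j \<longrightarrow> (\<forall>s\<in>{0..1}. h m (z, s) = a j)))) \<and>
          maps_converge (prod_topology Z ?I) (A j) h (a j)" for j
    using contr[of j] ccont cconv fB unfolding rel_contracting_def
    by (auto simp: adj_coord_def elim!: allE[where x = "\<lambda>m z. adj_coord a j (f m z)"])
  then obtain h where h: "\<And>j m. continuous_map (prod_topology Z ?I) (A j) (h j m)"
    and h0: "\<And>j m z. z \<in> topspace Z \<Longrightarrow> h j m (z, 0) = adj_coord a j (f m z)"
    and h1: "\<And>j m z. z \<in> topspace Z \<Longrightarrow> h j m (z, 1) = a j"
    and hrel: "\<And>j m z s. \<lbrakk>z \<in> topspace Z; adj_coord a j (f m z) = a j; 0 \<le> s; s \<le> 1\<rbrakk> \<Longrightarrow> h j m (z, s) = a j"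
    and hconv: "\<And>j. maps_converge (prod_topology Z ?I) (A j) (h j) (a j)"
    by (metis atLeastAtMost_iff)
  \<comment> \<open>\<open>adj_glue\<close> identifies \<open>a j\<close> with \<open>x j\<close>,
    so a point whose coordinate reaches \<open>a j\<close> arrives in \<open>X\<close> at its image
    under the retraction.\<close>
  define H where "H m = (\<lambda>(z, s). case f m z of Inl p \<Rightarrow> Inl p | Inr (j, q) \<Rightarrow> adj_glue x a j (h j m (z, s)))" for m
  have hA: "h j m w \<in> topspace (A j)" if "w \<in> topspace (prod_topology Z ?I)" for j m w
    using continuous_map_funspace[OF h] that by blast
  have HA: "H m w \<in> adj_all_points X A a" if w: "w \<in> topspace (prod_topology Z ?I)" for m w
  proof -
    obtain z s where ws: "w = (z, s)" "z \<in> topspace Z" using w by auto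
    show ?thesis using fA[OF ws(2), of m] hA[OF w]
      by (auto simp: H_def ws adj_all_points_def adj_glue_def xX split: sum.splits)
  qed
  have rH: "adj_retraction x (H m (z, s)) = adj_retraction x (f m z)" for m z s
    by (auto simp: H_def adj_retraction_def adj_glue_def split: sum.splits)
  \<comment> \<open>Off \<open>A j\<close> both sides equal \<open>a j\<close> by stationarity. This
    turns each coordinate of \<open>H\<close>, which is defined by cases, into the continuous map
    \<open>h j m\<close>.\<close>
  have cH: "adj_coord a j (H m (z, s)) = h j m (z, s)" if "z \<in> topspace Z" "s \<in> {0..1}" for m z s j
  proof (cases "\<exists>q. f m z = Inr (j, q)")
    case True
    then show ?thesis by (auto simp: H_def adj_coord_def adj_glue_def)
  next
    case False
    then have "adj_coord a j (f m z) = a j" "adj_coord a j (H m (z, s)) = a j"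
      by (auto simp: H_def adj_coord_def adj_glue_def split: sum.splits)
    then show ?thesis using hrel[OF that(1), of j m s] that(2) by simp
  qed
  show ?thesis
  proof
    show "continuous_map (prod_topology Z ?I) (Adj X x A a) (H m)" for m
    proof (rule continuous_map_into_Adj[OF t1 xX aA])
      show "continuous_map (prod_topology Z ?I) X (\<lambda>z. adj_retraction x (H m z))"
        by (rule continuous_map_eq[OF continuous_map_compose[OF continuous_map_fst rcont[of m]]])
          (auto simp: rH)
      show "continuous_map (prod_topology Z ?I) (A j) (\<lambda>z. adj_coord a j (H m z))" for j
        by (rule continuous_map_eq[OF h[of j m]]) (auto simp: cH)
    qed (rule HA)
    show "H m (z, 0) = f m z" if "z \<in> topspace Z" for m z
      using fA[OF that, of m] h0[OF that] 
      by (auto simp: H_def adj_all_points_def adj_coord_def adj_glue_def split: sum.splits)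
    show "H m (z, 1) = Inl (adj_retraction x (f m z))" if "z \<in> topspace Z" for m z
      using h1[OF that] by (auto simp: H_def adj_retraction_def adj_glue_def split: sum.splits)
    show "H m (z, s) = Inl p" if "f m z = Inl p" for m z s p
      using that by (simp add: H_def)
    show "maps_converge (prod_topology Z ?I) (Adj X x A a) H (Inl y)"
    proof (rule maps_converge_Adj[OF t1 xX aA])
      show "maps_converge (prod_topology Z ?I) X (\<lambda>m z. adj_retraction x (H m z)) y"
        using rconv unfolding maps_converge_def by (auto simp: image_subset_iff rH elim!: eventually_mono)
      show "maps_converge (prod_topology Z ?I) (A j) (\<lambda>m z. adj_coord a j (H m z)) (a j)" for j
        using hconv[of j] unfolding maps_converge_def by (auto simp: image_subset_iff cH elim!: eventually_mono)
    qed (rule HA)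
  qed
qed

section \<open>Shrinking wedges and sequences of spheres\<close>

lemma maps_converge_iff_finite:
  "maps_converge Z Y f y \<longleftrightarrow>
     (\<forall>U. openin Y U \<and> y \<in> U \<longrightarrow> finite {m. \<not> f m ` topspace Z \<subseteq> U})"
  by (simp add: maps_converge_def eventually_cofinite flip: cofinite_eq_sequentially)

lemma maps_converge_mono:
  assumes "maps_converge Z Y f y" "\<And>m. g m ` topspace Z' \<subseteq> f m ` topspace Z"
  shows "maps_converge Z' Y g y"
  unfolding maps_converge_def
proof (intro allI impI)
  fix U assume "openin Y U \<and> y \<in> U"
  then have "\<forall>\<^sub>F m in sequentially. f m ` topspace Z \<subseteq> U"
    using assms(1) unfolding maps_converge_def by blast
  then show "\<forall>\<^sub>F m in sequentially. g m ` topspace Z' \<subseteq> U"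
    by (rule eventually_mono) (use assms(2) in blast)
qed

lemma topspace_sphere_top:
  "topspace (sphere_top k) = {p \<in> PiE {..k} (\<lambda>_. UNIV::real set). (\<Sum>i\<le>k. (p i)\<^sup>2) = 1}"
  by (auto simp: sphere_top_def)

lemma sphere_base_in: "sphere_base k \<in> topspace (sphere_top k)"
proof -
  have "(\<Sum>i\<le>k. (sphere_base k i)\<^sup>2) = (\<Sum>i\<le>k. if i = 0 then 1 else 0)"
    by (rule sum.cong) (auto simp: sphere_base_def)
  then show ?thesis
    by (auto simp: topspace_sphere_top PiE_iff extensional_def sphere_base_def)
qed

lemma Hausdorff_sphere_top: "Hausdorff_space (sphere_top k)"
  unfolding sphere_top_def
  by (intro Hausdorff_space_subtopology) (simp add: Hausdorff_space_product_topology)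

lemma continuous_map_sphere_coord: "i \<le> k \<Longrightarrow> continuous_map (sphere_top k) euclideanreal (\<lambda>p. p i)"
  unfolding sphere_top_def
  by (intro continuous_map_from_subtopology continuous_map_product_projection) auto

lemma compact_space_sphere_top: "compact_space (sphere_top k)"
proof -
  let ?P = "product_topology (\<lambda>_::nat. euclideanreal) {..k}"
  let ?S = "{p \<in> PiE {..k} (\<lambda>_. UNIV::real set). (\<Sum>i\<le>k. (p i)\<^sup>2) = 1}"
  have "continuous_map ?P euclideanreal (\<lambda>p. \<Sum>i\<le>k. (p i)\<^sup>2)"
    by (intro continuous_intros continuous_map_product_projection) auto
  then have "closedin ?P {p \<in> topspace ?P. (\<Sum>i\<le>k. (p i)\<^sup>2) \<in> {1}}"
    by (rule closedin_continuous_map_preimage) simp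
  then have "closedin ?P ?S" by simp
  moreover have "compactin ?P (PiE {..k} (\<lambda>_. {-1..1}))"
    by (simp add: compactin_PiE)
  moreover have "?S \<subseteq> PiE {..k} (\<lambda>_. {-1..1})"
  proof
    fix p assume p: "p \<in> ?S"
    have "\<bar>p i\<bar> \<le> 1" if "i \<le> k" for i
    proof -
      have "(p i)\<^sup>2 \<le> (\<Sum>i\<le>k. (p i)\<^sup>2)"
        using that by (intro member_le_sum) auto
      then show ?thesis using p by (simp add: abs_square_le_1)
    qed
    then show "p \<in> PiE {..k} (\<lambda>_. {-1..1})" using p by (auto simp: PiE_iff abs_le_iff)
  qed
  ultimately have "compactin ?P ?S"
    using closed_compactin by blast
  then show ?thesis unfolding sphere_top_def by (rule compact_space_subtopology)
qed

lemma openin_shrinking_wedge: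
  "openin (shrinking_wedge k) U \<longleftrightarrow> U \<subseteq> wedge_points k \<and>
      (\<forall>m. openin (sphere_top k) {p \<in> topspace (sphere_top k). wedge_incl k m p \<in> U}) \<and>
      (None \<in> U \<longrightarrow> finite {m. \<not> (wedge_incl k m ` topspace (sphere_top k) \<subseteq> U)})"
proof -
  have "istopology (\<lambda>U. None \<in> U \<longrightarrow> finite {m. \<not> (wedge_incl k m ` topspace (sphere_top k) \<subseteq> U)})"
    unfolding istopology_def
  proof (intro conjI allI impI)
    fix S T
    assume "None \<in> S \<longrightarrow> finite {m. \<not> wedge_incl k m ` topspace (sphere_top k) \<subseteq> S}"
      and "None \<in> T \<longrightarrow> finite {m. \<not> wedge_incl k m ` topspace (sphere_top k) \<subseteq> T}"
      and "None \<in> S \<inter> T"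
    then have "finite ({m. \<not> wedge_incl k m ` topspace (sphere_top k) \<subseteq> S} \<union>
        {m. \<not> wedge_incl k m ` topspace (sphere_top k) \<subseteq> T})" by simp
    then show "finite {m. \<not> wedge_incl k m ` topspace (sphere_top k) \<subseteq> S \<inter> T}"
      by (rule rev_finite_subset) auto
  next
    fix K
    assume K: "\<forall>S\<in>K. None \<in> S \<longrightarrow> finite {m. \<not> wedge_incl k m ` topspace (sphere_top k) \<subseteq> S}"
      and "None \<in> \<Union> K"
    then obtain S where "S \<in> K" "finite {m. \<not> wedge_incl k m ` topspace (sphere_top k) \<subseteq> S}" by auto
    then show "finite {m. \<not> wedge_incl k m ` topspace (sphere_top k) \<subseteq> \<Union> K}"
      by (elim rev_finite_subset) auto
  qed
  then have "istopology (\<lambda>U. (U \<subseteq> wedge_points k \<and>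
      (\<forall>m\<in>UNIV. openin (sphere_top k) {p \<in> topspace (sphere_top k). wedge_incl k m p \<in> U})) \<and>
      (None \<in> U \<longrightarrow> finite {m. \<not> (wedge_incl k m ` topspace (sphere_top k) \<subseteq> U)}))"
    by (intro istopology_conj istopology_final)
  then show ?thesis
    unfolding shrinking_wedge_def by (simp add: topology_inverse' conj_assoc)
qed

lemma topspace_shrinking_wedge: "topspace (shrinking_wedge k) = wedge_points k"
proof (rule antisym)
  show "topspace (shrinking_wedge k) \<subseteq> wedge_points k"
    using openin_shrinking_wedge openin_topspace by blast
  have "wedge_incl k m p \<in> wedge_points k" if "p \<in> topspace (sphere_top k)" for m p
    using that by (auto simp: wedge_points_def)
  then have "{p \<in> topspace (sphere_top k). wedge_incl k m p \<in> wedge_points k} = topspace (sphere_top k)"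
    and "wedge_incl k m ` topspace (sphere_top k) \<subseteq> wedge_points k" for m
    by auto
  then have "openin (shrinking_wedge k) (wedge_points k)"
    by (simp add: openin_shrinking_wedge)
  then show "wedge_points k \<subseteq> topspace (shrinking_wedge k)"
    by (rule openin_subset)
qed

lemma wedge_incl_base [simp]: "wedge_incl k m (sphere_base k) = None"
  by (simp add: wedge_incl_def)

lemma None_in_shrinking_wedge: "None \<in> topspace (shrinking_wedge k)"
  unfolding topspace_shrinking_wedge wedge_points_def
  using sphere_base_in[of k] wedge_incl_base[of k 0] by (metis UN_I UNIV_I imageI)

lemma continuous_map_wedge_incl: "continuous_map (sphere_top k) (shrinking_wedge k) (wedge_incl k m)"
  by (auto simp: continuous_map_def openin_shrinking_wedge topspace_shrinking_wedge wedge_points_def)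

text \<open>Away from \<open>None\<close> the wedge is locally a single sphere. At
  \<open>None\<close>, compactness of \<open>T\<close> turns an open set around
  \<open>{sphere_base k} \<times> T\<close> into a tube, and convergence lets all but finitely many
  tubes be whole, as neighbourhoods of the wedge point require.\<close>

lemma continuous_map_from_shrinking_wedge_prod:
  assumes T: "compact_space T"
    and cont: "\<And>m. continuous_map (prod_topology (sphere_top k) T) Y (\<lambda>(p, s). H (wedge_incl k m p, s))"
    and base: "\<And>s. s \<in> topspace T \<Longrightarrow> H (None, s) = y"
    and conv: "maps_converge (prod_topology (sphere_top k) T) Y (\<lambda>m (p, s). H (wedge_incl k m p, s)) y"
  shows "continuous_map (prod_topology (shrinking_wedge k) T) Y H"
  unfolding continuous_map_def
proof (intro conjI allI impI)
  let ?S = "sphere_top k"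
  show "H \<in> topspace (prod_topology (shrinking_wedge k) T) \<rightarrow> topspace Y"
  proof
    fix w assume "w \<in> topspace (prod_topology (shrinking_wedge k) T)"
    then obtain m p s where "w = (wedge_incl k m p, s)" "p \<in> topspace ?S" "s \<in> topspace T"
      by (auto simp: topspace_shrinking_wedge wedge_points_def)
    then show "H w \<in> topspace Y"
      using continuous_map_funspace[OF cont[of m]] by (auto dest!: funcset_mem[where x = "(p, s)"])
  qed
  fix U assume U: "openin Y U"
  define W where "W m = {z \<in> topspace (prod_topology ?S T). (\<lambda>(p, s). H (wedge_incl k m p, s)) z \<in> U}" for m
  have W: "openin (prod_topology ?S T) (W m)" for m
    unfolding W_def by (rule openin_continuous_map_preimage[OF cont U])
  show "openin (prod_topology (shrinking_wedge k) T) {z \<in> topspace (prod_topology (shrinking_wedge k) T). H z \<in> U}"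
    unfolding openin_prod_topology_alt
  proof (intro allI impI)
    fix w s assume "(w, s) \<in> {z \<in> topspace (prod_topology (shrinking_wedge k) T). H z \<in> U}"
    then have w: "w \<in> wedge_points k" and s: "s \<in> topspace T" and HU: "H (w, s) \<in> U"
      by (auto simp: topspace_shrinking_wedge)
    show "\<exists>P Q. openin (shrinking_wedge k) P \<and> openin T Q \<and> w \<in> P \<and> s \<in> Q \<and>
        P \<times> Q \<subseteq> {z \<in> topspace (prod_topology (shrinking_wedge k) T). H z \<in> U}"
    proof (cases w)
      case None
      then have yU: "y \<in> U" using HU base s by simp
      have "\<exists>N. openin ?S N \<and> sphere_base k \<in> N \<and> N \<times> topspace T \<subseteq> W m" for m
      proof -
        have "{sphere_base k} \<times> topspace T \<subseteq> W m"
          using base yU sphere_base_in by (auto simp: W_def)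
        then obtain N Q where "openin ?S N" "sphere_base k \<in> N" "topspace T \<subseteq> Q" "N \<times> Q \<subseteq> W m"
          using tube_lemma_right[OF W[of m], of "topspace T" "sphere_base k"] T sphere_base_in
          unfolding compact_space_def by blast
        then show ?thesis by (meson order_trans Sigma_mono order_refl)
      qed
      then obtain N0 where N0: "\<And>m. openin ?S (N0 m)" "\<And>m. sphere_base k \<in> N0 m"
        "\<And>m. N0 m \<times> topspace T \<subseteq> W m" by metis
      \<comment> \<open>The tube is enlarged to the whole sphere whenever possible; otherwise
        \<open>P\<close> could miss points of infinitely many spheres and fail to be open.\<close>
      define N where "N m = (if topspace ?S \<times> topspace T \<subseteq> W m then topspace ?S else N0 m)" for m
      have N: "openin ?S (N m)" "sphere_base k \<in> N m" "N m \<times> topspace T \<subseteq> W m" "N m \<subseteq> topspace ?S" for m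
        using N0[of m] openin_subset[OF N0(1)[of m]] sphere_base_in by (auto simp: N_def)
      define P where "P = (\<Union>m. wedge_incl k m ` N m)"
      have P: "{p \<in> topspace ?S. wedge_incl k m p \<in> P} = N m" for m
        using N(2,4) by (auto simp: P_def wedge_incl_def split: if_splits)
      have "finite {m. \<not> topspace ?S \<times> topspace T \<subseteq> W m}"
        using conv U yU unfolding maps_converge_iff_finite
        by (auto elim!: allE[where x = U] rev_finite_subset simp: W_def image_subset_iff)
      moreover have "wedge_incl k m ` topspace ?S \<subseteq> P" if "topspace ?S \<times> topspace T \<subseteq> W m" for m
        unfolding P_def by (rule order_trans[OF _ UN_upper[of m]]) (simp_all add: N_def that)
      then have "{m. \<not> wedge_incl k m ` topspace ?S \<subseteq> P} \<subseteq> {m. \<not> topspace ?S \<times> topspace T \<subseteq> W m}"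
        by blast
      ultimately have "finite {m. \<not> wedge_incl k m ` topspace ?S \<subseteq> P}"
        using finite_subset by blast
      moreover have "P \<subseteq> wedge_points k"
        using N(4) by (auto simp: P_def wedge_points_def)
      ultimately have "openin (shrinking_wedge k) P"
        unfolding openin_shrinking_wedge P using N(1) by simp
      moreover have "None \<in> P"
        unfolding P_def using imageI[OF N(2)[of 0], of "wedge_incl k 0"] by (intro UN_I[of 0]) simp_all
      moreover have "P \<times> topspace T \<subseteq> {z \<in> topspace (prod_topology (shrinking_wedge k) T). H z \<in> U}"
      proof clarify
        fix w t assume "w \<in> P" "t \<in> topspace T"
        then obtain m p where "w = wedge_incl k m p" "p \<in> N m" by (auto simp: P_def)
        then have "(p, t) \<in> W m" using N(3) \<open>t \<in> topspace T\<close> by blast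
        then show "(w, t) \<in> topspace (prod_topology (shrinking_wedge k) T) \<and> H (w, t) \<in> U"
          using \<open>w = wedge_incl k m p\<close> \<open>w \<in> P\<close> \<open>t \<in> topspace T\<close> \<open>P \<subseteq> wedge_points k\<close>
          by (auto simp: W_def topspace_shrinking_wedge)
      qed
      ultimately show ?thesis using None s by blast
    next
      case (Some mp)
      then obtain m p where mp: "w = Some (m, p)" "p \<in> topspace ?S" "p \<noteq> sphere_base k"
        using w by (auto simp: wedge_points_def wedge_incl_def split: if_splits)
      then have psW: "(p, s) \<in> W m" using HU s by (simp add: W_def wedge_incl_def)
      obtain P Q where PQ: "openin ?S P" "openin T Q" "p \<in> P" "s \<in> Q" "P \<times> Q \<subseteq> W m"
        using iffD1[OF openin_prod_topology_alt W[of m], rule_format, OF psW] by (elim exE conjE)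
      \<comment> \<open>Without the basepoint the image avoids \<open>None\<close>, so it stays in
        the \<open>m\<close>-th sphere and the finiteness condition on open sets is void.\<close>
      have P': "openin ?S (P - {sphere_base k})"
        using PQ(1) Hausdorff_imp_t1_space[OF Hausdorff_sphere_top] sphere_base_in
        by (intro openin_diff) (auto simp: t1_space_closedin_singleton)
      have "{p' \<in> topspace ?S. wedge_incl k m' p' \<in> (\<lambda>q. Some (m, q)) ` (P - {sphere_base k})} =
          (if m' = m then P - {sphere_base k} else {})" for m'
        using openin_subset[OF PQ(1)] by (auto simp: wedge_incl_def split: if_splits)
      moreover have sub: "(\<lambda>q. Some (m, q)) ` (P - {sphere_base k}) \<subseteq> wedge_points k"
        using openin_subset[OF PQ(1)] by (force simp: wedge_points_def wedge_incl_def image_iff)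
      ultimately have "openin (shrinking_wedge k) ((\<lambda>q. Some (m, q)) ` (P - {sphere_base k}))"
        using P' unfolding openin_shrinking_wedge by auto
      moreover have "(\<lambda>q. Some (m, q)) ` (P - {sphere_base k}) \<times> Q \<subseteq>
          {z \<in> topspace (prod_topology (shrinking_wedge k) T). H z \<in> U}"
      proof
        fix z assume "z \<in> (\<lambda>q. Some (m, q)) ` (P - {sphere_base k}) \<times> Q"
        then obtain q t where z: "z = (Some (m, q), t)" and q: "q \<in> P" "q \<noteq> sphere_base k" "t \<in> Q"
          by auto
        then have "(q, t) \<in> W m" using PQ(5) by blast
        moreover have "Some (m, q) \<in> wedge_points k" using sub q by blast
        ultimately show "z \<in> {z \<in> topspace (prod_topology (shrinking_wedge k) T). H z \<in> U}"
          using q z by (simp add: W_def topspace_shrinking_wedge wedge_incl_def)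
      qed
      ultimately show ?thesis using PQ mp by blast
    qed
  qed
qed

text \<open>The converse at the wedge point: the base of a tube around
  \<open>{None} \<times> T\<close> is a neighbourhood of \<open>None\<close>, hence contains all but
  finitely many spheres.\<close>

lemma maps_converge_from_shrinking_wedge_prod:
  assumes T: "compact_space T"
    and H: "continuous_map (prod_topology (shrinking_wedge k) T) Y H"
    and base: "\<And>s. s \<in> topspace T \<Longrightarrow> H (None, s) = y"
  shows "maps_converge (prod_topology (sphere_top k) T) Y (\<lambda>m (p, s). H (wedge_incl k m p, s)) y"
  unfolding maps_converge_iff_finite
proof (intro allI impI)
  fix U assume U: "openin Y U \<and> y \<in> U"
  define W where "W = {z \<in> topspace (prod_topology (shrinking_wedge k) T). H z \<in> U}"
  have "openin (prod_topology (shrinking_wedge k) T) W"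
    unfolding W_def using openin_continuous_map_preimage[OF H] U by blast
  moreover have "{None} \<times> topspace T \<subseteq> W"
    using base U None_in_shrinking_wedge by (auto simp: W_def)
  ultimately obtain N Q where N: "openin (shrinking_wedge k) N" "None \<in> N" "topspace T \<subseteq> Q" "N \<times> Q \<subseteq> W"
    using tube_lemma_right[of "shrinking_wedge k" T W "topspace T" None] T None_in_shrinking_wedge
    unfolding compact_space_def by blast
  then have "finite {m. \<not> wedge_incl k m ` topspace (sphere_top k) \<subseteq> N}"
    unfolding openin_shrinking_wedge by blast
  then show "finite {m. \<not> (\<lambda>(p, s). H (wedge_incl k m p, s)) ` topspace (prod_topology (sphere_top k) T) \<subseteq> U}"
    by (rule rev_finite_subset) (use N(3,4) in \<open>fastforce simp: W_def\<close>)
qed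

lemma compact_space_unit_interval: "compact_space (top_of_set {0..1::real})"
  by (simp add: compact_space_subtopology)

section \<open>Maps and homotopies on the wedge assembled from its spheres\<close>

definition wedge_fold :: "'a \<Rightarrow> (nat \<Rightarrow> (nat \<Rightarrow> real) \<Rightarrow> 'a) \<Rightarrow> (nat \<times> (nat \<Rightarrow> real)) option \<Rightarrow> 'a" where
  "wedge_fold y \<phi> w = (case w of None \<Rightarrow> y | Some (m, p) \<Rightarrow> \<phi> m p)"

lemma wedge_fold_incl: "\<phi> m (sphere_base k) = y \<Longrightarrow> wedge_fold y \<phi> (wedge_incl k m p) = \<phi> m p"
  by (simp add: wedge_fold_def wedge_incl_def)

lemma continuous_map_wedge_fold:
  assumes cont: "\<And>m. continuous_map (sphere_top k) Y (\<phi> m)"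
    and base: "\<And>m. \<phi> m (sphere_base k) = y"
    and conv: "maps_converge (sphere_top k) Y \<phi> y"
  shows "continuous_map (shrinking_wedge k) Y (wedge_fold y \<phi>)"
proof -
  let ?I = "top_of_set {0..1::real}"
  \<comment> \<open>The map is read as a homotopy constant in time, so that the criterion for
    products with a compact factor applies.\<close>
  have "continuous_map (prod_topology (shrinking_wedge k) ?I) Y (\<lambda>(w, s). wedge_fold y \<phi> w)"
  proof (rule continuous_map_from_shrinking_wedge_prod[OF compact_space_unit_interval])
    show "continuous_map (prod_topology (sphere_top k) ?I) Y
        (\<lambda>(p, s). (\<lambda>(w, s). wedge_fold y \<phi> w) (wedge_incl k m p, s))" for m
      using continuous_map_compose[OF continuous_map_fst cont[of m], of ?I]
      by (simp add: wedge_fold_incl base o_def case_prod_unfold)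
    show "maps_converge (prod_topology (sphere_top k) ?I) Y
        (\<lambda>m (p, s). (\<lambda>(w, s). wedge_fold y \<phi> w) (wedge_incl k m p, s)) y"
      using conv unfolding maps_converge_def
      by (auto simp: wedge_fold_incl base image_subset_iff elim!: eventually_mono)
  qed (simp add: wedge_fold_def)
  moreover have "continuous_map (shrinking_wedge k) (prod_topology (shrinking_wedge k) ?I) (\<lambda>w. (w, 0))"
    by (simp add: continuous_map_pairwise o_def)
  ultimately have "continuous_map (shrinking_wedge k) Y ((\<lambda>(w, s). wedge_fold y \<phi> w) \<circ> (\<lambda>w. (w, 0::real)))"
    by (rule continuous_map_compose[rotated])
  then show ?thesis by (simp add: o_def)
qed

lemma maps_converge_wedge_incl:
  assumes f: "continuous_map (shrinking_wedge k) Y f" and "f None = y"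
  shows "maps_converge (sphere_top k) Y (\<lambda>m p. f (wedge_incl k m p)) y"
proof -
  let ?I = "top_of_set {0..1::real}"
  have "maps_converge (prod_topology (sphere_top k) ?I) Y (\<lambda>m (p, s). (f \<circ> fst) (wedge_incl k m p, s)) y"
    using assms
    by (intro maps_converge_from_shrinking_wedge_prod[OF compact_space_unit_interval]
        continuous_map_compose[OF continuous_map_fst f]) auto
  then show ?thesis
    by (rule maps_converge_mono) (force simp: image_iff intro!: bexI[of _ "(_, 0)"])
qed

lemma continuous_map_swap_prod:
  assumes "continuous_map (prod_topology X Y) Z h"
  shows "continuous_map (prod_topology Y X) Z (\<lambda>(v, u). h (u, v))"
  using continuous_map_compose[OF continuous_map_pairedI[OF continuous_map_snd continuous_map_fst] assms]
  by (simp add: o_def case_prod_unfold)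

lemma homotopic_with_based:
  assumes b: "b \<in> topspace H"
    and h: "continuous_map (prod_topology H (top_of_set {0..1::real})) X h"
    and h0: "\<And>w. w \<in> topspace H \<Longrightarrow> h (w, 0) = f w"
    and h1: "\<And>w. w \<in> topspace H \<Longrightarrow> h (w, 1) = g w"
    and hb: "\<And>s. s \<in> {0..1} \<Longrightarrow> h (b, s) = x"
  shows "homotopic_with (\<lambda>h. h b = x) H X f g"
proof (subst homotopic_with)
  show "(u b = x) = (v b = x)" if "\<And>z. z \<in> topspace H \<Longrightarrow> u z = v z" for u v :: "'a \<Rightarrow> 'b"
    using that b by simp
  show "\<exists>h. continuous_map (prod_topology (top_of_set {0..1::real}) H) X h \<and>
        (\<forall>x\<in>topspace H. h (0, x) = f x) \<and> (\<forall>x\<in>topspace H. h (1, x) = g x) \<and>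
        (\<forall>t\<in>{0..1}. h (t, b) = x)"
    by (intro exI[of _ "\<lambda>(s, w). h (w, s)"] conjI continuous_map_swap_prod[OF h]) (auto simp: h0 h1 hb)
qed

lemma homotopic_with_shrinking_wedge:
  assumes H: "\<And>m. continuous_map (prod_topology (sphere_top k) (top_of_set {0..1::real})) Y (H m)"
    and H0: "\<And>m p. p \<in> topspace (sphere_top k) \<Longrightarrow> H m (p, 0) = f (wedge_incl k m p)"
    and H1: "\<And>m p. p \<in> topspace (sphere_top k) \<Longrightarrow> H m (p, 1) = g (wedge_incl k m p)"
    and base: "\<And>m s. s \<in> {0..1} \<Longrightarrow> H m (sphere_base k, s) = y"
    and conv: "maps_converge (prod_topology (sphere_top k) (top_of_set {0..1::real})) Y H y"
  shows "homotopic_with (\<lambda>h. h None = y) (shrinking_wedge k) Y f g"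
proof -
  let ?I = "top_of_set {0..1::real}"
  define h where "h = (\<lambda>(w, s). wedge_fold y (\<lambda>m p. H m (p, s)) w)"
  have h: "h (wedge_incl k m p, s) = H m (p, s)" if "s \<in> {0..1}" for m p s
    unfolding h_def using wedge_fold_incl[of "\<lambda>m p. H m (p, s)" m k y p] base[OF that] by simp
  have "continuous_map (prod_topology (shrinking_wedge k) ?I) Y h"
  proof (rule continuous_map_from_shrinking_wedge_prod[OF compact_space_unit_interval])
    show "continuous_map (prod_topology (sphere_top k) ?I) Y (\<lambda>(p, s). h (wedge_incl k m p, s))" for m
      by (rule continuous_map_eq[OF H[of m]]) (auto simp: h)
    show "maps_converge (prod_topology (sphere_top k) ?I) Y (\<lambda>m (p, s). h (wedge_incl k m p, s)) y"
      using conv unfolding maps_converge_def by (auto simp: h image_subset_iff elim!: eventually_mono)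
  qed (simp add: h_def wedge_fold_def)
  then show ?thesis
  proof (rule homotopic_with_based[OF None_in_shrinking_wedge])
    show "h (w, 0) = f w" "h (w, 1) = g w" if "w \<in> topspace (shrinking_wedge k)" for w
      using that H0 H1 by (auto simp: topspace_shrinking_wedge wedge_points_def h)
  qed (simp add: h_def wedge_fold_def)
qed

section \<open>Connectivity in terms of null sequences of spheres\<close>

definition seq_contractible :: "nat \<Rightarrow> 'a topology \<Rightarrow> 'a \<Rightarrow> bool" where
  "seq_contractible k A a \<longleftrightarrow> (\<forall>\<phi>.
     (\<forall>i. continuous_map (sphere_top k) A (\<phi> i) \<and> \<phi> i (sphere_base k) = a) \<and>
       maps_converge (sphere_top k) A \<phi> a \<longrightarrow>
     (\<exists>h. (\<forall>i. continuous_map (prod_topology (sphere_top k) (top_of_set {0..1::real})) A (h i) \<and>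
             (\<forall>p\<in>topspace (sphere_top k). h i (p, 0) = \<phi> i p \<and> h i (p, 1) = a) \<and>
             (\<forall>s\<in>{0..1}. h i (sphere_base k, s) = a)) \<and>
          maps_converge (prod_topology (sphere_top k) (top_of_set {0..1::real})) A h a))"

definition based_contractible_maps :: "'h topology \<Rightarrow> 'h \<Rightarrow> 'a topology \<Rightarrow> 'a \<Rightarrow> bool" where
  "based_contractible_maps H b X x \<longleftrightarrow>
     (\<forall>f\<in>based_maps H b X x. homotopic_with (\<lambda>h. h b = x) H X f (\<lambda>_. x))"

text \<open>The constant map is always based, so there is only one class exactly if every based map
  is homotopic to it.\<close>

lemma based_homotopy_classes_singleton_iff:
  assumes "x \<in> topspace X"
  shows "(\<exists>c. based_homotopy_classes H b X x = {c}) \<longleftrightarrow> based_contractible_maps H b X x"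
proof
  let ?c = "\<lambda>f. {g \<in> based_maps H b X x. homotopic_with (\<lambda>h. h b = x) H X f g}"
  have const: "(\<lambda>_. x) \<in> based_maps H b X x" using assms by (simp add: based_maps_def)
  {
    assume "\<exists>c. based_homotopy_classes H b X x = {c}"
    then obtain c where c: "based_homotopy_classes H b X x = {c}" by blast
    have "?c f = c" if "f \<in> based_maps H b X x" for f
    proof -
      have "?c f \<in> based_homotopy_classes H b X x" unfolding based_homotopy_classes_def using that by blast
      then show ?thesis by (simp add: c)
    qed
    then have eq: "?c f = ?c (\<lambda>_. x)" if "f \<in> based_maps H b X x" for f
      using that const by simp
    show "based_contractible_maps H b X x"
      unfolding based_contractible_maps_def
    proof
      fix f assume f: "f \<in> based_maps H b X x"
      have "(\<lambda>_. x) \<in> ?c (\<lambda>_. x)" using const by (simp add: based_maps_def)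
      then show "homotopic_with (\<lambda>h. h b = x) H X f (\<lambda>_. x)"
        unfolding eq[OF f, symmetric] by simp
    qed
  next
    assume B: "based_contractible_maps H b X x"
    have "?c f = ?c (\<lambda>_. x)" if "f \<in> based_maps H b X x" for f
      using B that unfolding based_contractible_maps_def
      by (metis (no_types, lifting) homotopic_with_symD homotopic_with_trans)
    then have "based_homotopy_classes H b X x = {?c (\<lambda>_. x)}"
      unfolding based_homotopy_classes_def using const by blast
    then show "\<exists>c. based_homotopy_classes H b X x = {c}" by blast
  }
qed

text \<open>A null sequence of based spheres is one map of the wedge, and a based nullhomotopy of
  that map restricts to nullhomotopies of the spheres that converge as a sequence. This is the
  source of all size control in the fillings.\<close>

lemma based_contractible_maps_imp_seq_contractible:
  assumes "based_contractible_maps (shrinking_wedge k) None A a"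
  shows "seq_contractible k A a"
  unfolding seq_contractible_def
proof (intro allI impI)
  let ?I = "top_of_set {0..1::real}"
  fix \<phi> :: "nat \<Rightarrow> (nat \<Rightarrow> real) \<Rightarrow> 'a"
  assume \<phi>: "(\<forall>i. continuous_map (sphere_top k) A (\<phi> i) \<and> \<phi> i (sphere_base k) = a) \<and>
       maps_converge (sphere_top k) A \<phi> a"
  have "wedge_fold a \<phi> \<in> based_maps (shrinking_wedge k) None A a"
    using continuous_map_wedge_fold[of k A \<phi> a] \<phi> by (simp add: based_maps_def wedge_fold_def)
  then have "homotopic_with (\<lambda>h. h None = a) (shrinking_wedge k) A (wedge_fold a \<phi>) (\<lambda>_. a)"
    using assms by (simp add: based_contractible_maps_def)
  then obtain H where H: "continuous_map (prod_topology ?I (shrinking_wedge k)) A H"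
    and H0: "\<And>w. H (0, w) = wedge_fold a \<phi> w" and H1: "\<And>w. H (1, w) = a"
    and Hb: "\<And>s. s \<in> {0..1} \<Longrightarrow> H (s, None) = a"
    unfolding homotopic_with_def by blast
  define K where "K = (\<lambda>(w, s). H (s, w))"
  have K: "continuous_map (prod_topology (shrinking_wedge k) ?I) A K"
    unfolding K_def by (rule continuous_map_swap_prod[OF H])
  define h where "h = (\<lambda>i (p, s). K (wedge_incl k i p, s))"
  show "\<exists>h. (\<forall>i. continuous_map (prod_topology (sphere_top k) ?I) A (h i) \<and>
             (\<forall>p\<in>topspace (sphere_top k). h i (p, 0) = \<phi> i p \<and> h i (p, 1) = a) \<and>
             (\<forall>s\<in>{0..1}. h i (sphere_base k, s) = a)) \<and>
          maps_converge (prod_topology (sphere_top k) ?I) A h a"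
  proof (intro exI[of _ h] conjI allI ballI)
    fix i
    have "continuous_map (prod_topology (sphere_top k) ?I) (prod_topology (shrinking_wedge k) ?I)
        (\<lambda>z. (wedge_incl k i (fst z), snd z))"
      using continuous_map_compose[OF continuous_map_fst continuous_map_wedge_incl[of k i]]
      by (intro continuous_map_pairedI continuous_map_snd) (simp add: o_def)
    then have "continuous_map (prod_topology (sphere_top k) ?I) A (K \<circ> (\<lambda>z. (wedge_incl k i (fst z), snd z)))"
      using K by (rule continuous_map_compose)
    then show "continuous_map (prod_topology (sphere_top k) ?I) A (h i)"
      by (simp add: h_def o_def case_prod_unfold)
    show "h i (p, 0) = \<phi> i p" "h i (p, 1) = a" for p
      using \<phi> by (auto simp: h_def K_def H0 H1 wedge_fold_incl)
    show "h i (sphere_base k, s) = a" if "s \<in> {0..1}" for s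
      using that by (simp add: h_def K_def Hb)
  next
    show "maps_converge (prod_topology (sphere_top k) ?I) A h a"
      unfolding h_def
      by (rule maps_converge_from_shrinking_wedge_prod[OF compact_space_unit_interval K])
        (simp add: K_def Hb)
  qed
qed

text \<open>\<open>H\<close> is a retract of \<open>H'\<close>: contract \<open>f \<circ> v\<close>
  on \<open>H'\<close> and restrict the homotopy along \<open>u\<close>.\<close>

lemma based_contractible_maps_retract:
  assumes u: "continuous_map H H' u" "u b = b'" and v: "continuous_map H' H v" "v b' = b"
    and vu: "\<And>z. z \<in> topspace H \<Longrightarrow> v (u z) = z" and b: "b \<in> topspace H"
    and H': "based_contractible_maps H' b' X x"
  shows "based_contractible_maps H b X x"
  unfolding based_contractible_maps_def
proof
  fix f assume f: "f \<in> based_maps H b X x"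
  then have "f \<circ> v \<in> based_maps H' b' X x"
    using v by (auto simp: based_maps_def intro: continuous_map_compose)
  then have "homotopic_with (\<lambda>h. h b' = x) H' X (f \<circ> v) (\<lambda>_. x)"
    using H' by (simp add: based_contractible_maps_def)
  then have "homotopic_with (\<lambda>h. h b = x) H X (f \<circ> v \<circ> u) ((\<lambda>_. x) \<circ> u)"
    by (rule homotopic_with_compose_continuous_map_right) (use u in auto)
  moreover have "homotopic_with (\<lambda>h. h b = x) H X f (f \<circ> v \<circ> u)"
    using f b vu u v by (intro homotopic_with_equal) (auto simp: based_maps_def)
  ultimately show "homotopic_with (\<lambda>h. h b = x) H X f (\<lambda>_. x)"
    using homotopic_with_trans by (fastforce simp: o_def)
qed

section \<open>The convergent sequence as a shrinking wedge of 0-spheres\<close>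

lemma topspace_H0: "topspace H0 = insert 0 (range (\<lambda>m. 1 / real (Suc m)))"
proof -
  have "{1 / real m |m. m \<ge> 1} = (\<lambda>m. 1 / real m) ` {1..}" by auto
  also have "{1..} = range Suc"
    by (auto simp: image_iff) (metis Suc_le_D)
  finally show ?thesis by (simp add: H0_def image_image)
qed

lemma openin_H0_singleton: "openin H0 {1 / real (Suc m)}"
proof -
  \<comment> \<open>The denominators \<open>m + 1/2\<close> and \<open>m + 3/2\<close> separate
    \<open>m + 1\<close> from its neighbours \<open>m\<close> and \<open>m + 2\<close>.\<close>
  have "topspace H0 \<inter> {1 / (real m + 3/2) <..< 1 / (real m + 1/2)} = {1 / real (Suc m)}"
    unfolding topspace_H0 by (auto simp: field_simps)
  moreover have "openin H0 (topspace H0 \<inter> {1 / (real m + 3/2) <..< 1 / (real m + 1/2)})"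
    by (simp only: H0_def topspace_euclidean_subtopology openin_open_Int open_greaterThanLessThan)
  ultimately show ?thesis by simp
qed

lemma openin_H0I:
  assumes "U \<subseteq> topspace H0" "0 \<in> U \<Longrightarrow> finite (topspace H0 - U)"
  shows "openin H0 U"
proof (cases "0 \<in> U")
  case True
  have "closedin H0 (topspace H0 - U)"
    using assms(2)[OF True] Hausdorff_imp_t1_space[of H0]
    by (simp add: t1_space_closedin_finite H0_def Hausdorff_space_subtopology)
  then show ?thesis using openin_closedin[OF assms(1)] by simp
next
  case False
  then have "U = (\<Union>m\<in>{m. 1 / real (Suc m) \<in> U}. {1 / real (Suc m)})"
    using assms(1) unfolding topspace_H0 by auto
  then show ?thesis using openin_H0_singleton by (metis (no_types, lifting) imageE openin_Union)
qed

lemma sphere_zero_cases: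
  assumes "p \<in> topspace (sphere_top 0)"
  shows "p = sphere_base 0 \<or> p = (\<lambda>i. if i = 0 then -1 else undefined)"
proof -
  have p: "p \<in> extensional {..0}" "(p 0)\<^sup>2 = 1"
    using assms by (auto simp: topspace_sphere_top PiE_iff)
  then have "p 0 = 1 \<or> p 0 = -1" by (simp add: power2_eq_1_iff)
  then show ?thesis using p by (auto simp: sphere_base_def extensional_def fun_eq_iff)
qed

text \<open>Sending \<open>1 / (m + 1)\<close> to the point of the \<open>m\<close>-th 0-sphere
  other than its basepoint is a homeomorphism. It puts the case \<open>k = 0\<close> of
  connectivity, which is stated with \<open>H0\<close>, into the same form as the others.\<close>

lemma based_contractible_maps_H0_iff:
  "based_contractible_maps H0 0 X x \<longleftrightarrow> based_contractible_maps (shrinking_wedge 0) None X x"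
proof -
  define e :: "nat \<Rightarrow> real" where "e = (\<lambda>i. if i = 0 then -1 else undefined)"
  have eS: "e \<in> topspace (sphere_top 0)" and eb: "e \<noteq> sphere_base 0"
    by (auto simp: e_def topspace_sphere_top PiE_iff extensional_def sphere_base_def fun_eq_iff)
  have pt: "p = sphere_base 0 \<or> p = e" if "p \<in> topspace (sphere_top 0)" for p
    using sphere_zero_cases[OF that] by (simp add: e_def)
  have incl: "wedge_incl 0 m e = Some (m, e)" for m using eb by (simp add: wedge_incl_def)
  have pts: "w = None \<or> (\<exists>m. w = Some (m, e))" if "w \<in> topspace (shrinking_wedge 0)" for w
    using that pt unfolding topspace_shrinking_wedge wedge_points_def by (auto simp: wedge_incl_def split: if_splits)
  have Some_in: "Some (m, e) \<in> topspace (shrinking_wedge 0)" for m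
    unfolding topspace_shrinking_wedge wedge_points_def using eS incl by (metis UN_I UNIV_I imageI)
  define u :: "real \<Rightarrow> (nat \<times> (nat \<Rightarrow> real)) option"
    where "u t = (if t = 0 then None else Some (THE m. t = 1 / real (Suc m), e))" for t
  define v :: "(nat \<times> (nat \<Rightarrow> real)) option \<Rightarrow> real"
    where "v = wedge_fold 0 (\<lambda>m p. if p = e then 1 / real (Suc m) else 0)"
  have u: "u (1 / real (Suc m)) = Some (m, e)" for m
    by (simp add: u_def)
  have v: "v None = 0" "v (Some (m, e)) = 1 / real (Suc m)" for m
    by (auto simp: v_def wedge_fold_def)
  have ucont: "continuous_map H0 (shrinking_wedge 0) u"
    unfolding continuous_map_def
  proof (intro conjI allI impI)
    show "u \<in> topspace H0 \<rightarrow> topspace (shrinking_wedge 0)"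
      unfolding topspace_H0 using Some_in u None_in_shrinking_wedge by (auto simp: u_def)
    fix U assume U: "openin (shrinking_wedge 0) U"
    show "openin H0 {t \<in> topspace H0. u t \<in> U}"
    proof (rule openin_H0I)
      assume "0 \<in> {t \<in> topspace H0. u t \<in> U}"
      then have None: "None \<in> U" by (simp add: u_def)
      then have fin: "finite {m. \<not> wedge_incl 0 m ` topspace (sphere_top 0) \<subseteq> U}"
        using U unfolding openin_shrinking_wedge by blast
      have "topspace H0 - {t \<in> topspace H0. u t \<in> U} \<subseteq>
          (\<lambda>m. 1 / real (Suc m)) ` {m. \<not> wedge_incl 0 m ` topspace (sphere_top 0) \<subseteq> U}"
      proof
        fix t assume t: "t \<in> topspace H0 - {t \<in> topspace H0. u t \<in> U}"
        then have "t \<noteq> 0" using None by (auto simp: u_def)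
        then obtain m where m: "t = 1 / real (Suc m)" using t unfolding topspace_H0 by auto
        then have "Some (m, e) \<notin> U" using t u by auto
        then have "\<not> wedge_incl 0 m ` topspace (sphere_top 0) \<subseteq> U" using eS incl by (metis image_subset_iff)
        then show "t \<in> (\<lambda>m. 1 / real (Suc m)) ` {m. \<not> wedge_incl 0 m ` topspace (sphere_top 0) \<subseteq> U}"
          using m by blast
      qed
      then show "finite (topspace H0 - {t \<in> topspace H0. u t \<in> U})"
        using fin finite_subset by blast
    qed auto
  qed
  have vcont: "continuous_map (shrinking_wedge 0) H0 v"
    unfolding v_def
  proof (rule continuous_map_wedge_fold)
    have "finite (topspace (sphere_top 0))"
      by (rule finite_subset[of _ "{sphere_base 0, e}"]) (use pt in auto)
    then have "sphere_top 0 = discrete_topology (topspace (sphere_top 0))"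
      by (rule finite_t1_space_imp_discrete_topology[OF refl _ Hausdorff_imp_t1_space[OF Hausdorff_sphere_top]])
    moreover have "continuous_map (discrete_topology (topspace (sphere_top 0))) H0
        (\<lambda>p. if p = e then 1 / real (Suc m) else 0)" for m
      by (simp only: continuous_map_from_discrete_topology) (auto simp: topspace_H0)
    ultimately show "continuous_map (sphere_top 0) H0 (\<lambda>p. if p = e then 1 / real (Suc m) else 0)" for m
      by simp
    show "maps_converge (sphere_top 0) H0 (\<lambda>m p. if p = e then 1 / real (Suc m) else 0) 0"
      unfolding maps_converge_def
    proof (intro allI impI)
      fix U assume U: "openin H0 U \<and> 0 \<in> U"
      then obtain V where V: "open V" "U = V \<inter> topspace H0"
        unfolding H0_def by (auto simp: openin_subtopology)
      have "(\<lambda>m. 1 / real (Suc m)) \<longlonglongrightarrow> 0" by (rule LIMSEQ_Suc[OF lim_1_over_n])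
      then have "eventually (\<lambda>m. 1 / real (Suc m) \<in> V) sequentially"
        using V U by (auto simp: tendsto_def)
      then show "\<forall>\<^sub>F m in sequentially. (\<lambda>p. if p = e then 1 / real (Suc m) else 0) ` topspace (sphere_top 0) \<subseteq> U"
        by (rule eventually_mono) (use V U in \<open>auto simp: topspace_H0\<close>)
    qed
  qed (use eb in auto)
  have vu: "v (u t) = t" if "t \<in> topspace H0" for t
    using that u v unfolding topspace_H0 by (auto simp: u_def)
  have uv: "u (v w) = w" if "w \<in> topspace (shrinking_wedge 0)" for w
    using pts[OF that] u v by (auto simp: u_def)
  have u0: "u 0 = None" "0 \<in> topspace H0" by (auto simp: u_def topspace_H0)
  show ?thesis
  proof
    show "based_contractible_maps (shrinking_wedge 0) None X x" if "based_contractible_maps H0 0 X x"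
      by (rule based_contractible_maps_retract[OF vcont v(1) ucont u0(1) _ None_in_shrinking_wedge that]) (rule uv)
    show "based_contractible_maps H0 0 X x" if "based_contractible_maps (shrinking_wedge 0) None X x"
      by (rule based_contractible_maps_retract[OF ucont u0(1) vcont v(1) _ u0(2) that]) (rule vu)
  qed
qed

lemma seq_n_connected_at_iff:
  assumes "x \<in> topspace X"
  shows "seq_n_connected_at X x n \<longleftrightarrow>
    (\<forall>k\<le>n. based_contractible_maps (shrinking_wedge k) None X x)"
  unfolding seq_n_connected_at_def based_homotopy_classes_singleton_iff[OF assms]
    based_contractible_maps_H0_iff
  by (metis One_nat_def Suc_leI le0 not_gr_zero)

section \<open>Extending sequences of maps from the boundary of a box\<close>

text \<open>There are \<open>k + 1\<close> coordinates, so the boundary is a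
  \<open>k\<close>-sphere. Coordinate 0 is later the time of a homotopy over a
  \<open>k\<close>-cell, and the others are directions in the cell.\<close>

definition box_top :: "nat \<Rightarrow> (nat \<Rightarrow> real) topology" where
  "box_top k = product_topology (\<lambda>_. top_of_set {-1..1}) {..k}"

definition box_boundary :: "nat \<Rightarrow> (nat \<Rightarrow> real) set" where
  "box_boundary k = {z \<in> topspace (box_top k). \<exists>i\<le>k. \<bar>z i\<bar> = 1}"

lemma topspace_box_top: "topspace (box_top k) = PiE {..k} (\<lambda>_. {-1..1})"
  by (simp add: box_top_def)

lemma continuous_map_box_coord: "i \<le> k \<Longrightarrow> continuous_map (box_top k) euclideanreal (\<lambda>z. z i)"
  using continuous_map_product_projection[of i "{..k}" "\<lambda>_. top_of_set {-1..1::real}"]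
  by (simp add: box_top_def continuous_map_in_subtopology)

lemma continuous_map_Max:
  assumes "finite I" "I \<noteq> {}" "\<And>i. i \<in> I \<Longrightarrow> continuous_map X euclideanreal (f i)"
  shows "continuous_map X euclideanreal (\<lambda>x. Max ((\<lambda>i. f i x) ` I))"
  using assms
proof (induction I rule: finite_ne_induct)
  case (insert i I)
  then show ?case by (simp add: continuous_map_real_max)
qed simp

section \<open>Radial projections between the sphere and the boundary of the box\<close>

definition sup_norm :: "nat \<Rightarrow> (nat \<Rightarrow> real) \<Rightarrow> real" where
  "sup_norm k z = Max ((\<lambda>i. \<bar>z i\<bar>) ` {..k})"

lemma sup_norm_ge: "i \<le> k \<Longrightarrow> \<bar>z i\<bar> \<le> sup_norm k z"
  unfolding sup_norm_def by (rule Max_ge) auto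

lemma sup_norm_attained: "\<exists>i\<le>k. sup_norm k z = \<bar>z i\<bar>"
proof -
  have "sup_norm k z \<in> (\<lambda>i. \<bar>z i\<bar>) ` {..k}"
    unfolding sup_norm_def by (rule Max_in) auto
  then show ?thesis by auto
qed

lemma sup_norm_eqI:
  assumes "i \<le> k" "\<bar>z i\<bar> = c" "\<And>j. j \<le> k \<Longrightarrow> \<bar>z j\<bar> \<le> c"
  shows "sup_norm k z = c"
  unfolding sup_norm_def by (rule Max_eqI) (use assms in auto)

lemma sup_norm_sphere_pos:
  assumes "p \<in> topspace (sphere_top k)"
  shows "sup_norm k p > 0"
proof (rule ccontr)
  assume "\<not> sup_norm k p > 0"
  then have "p i = 0" if "i \<le> k" for i using sup_norm_ge[OF that, of p] by simp
  then show False using assms by (simp add: topspace_sphere_top)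
qed

definition sphere_to_box :: "nat \<Rightarrow> (nat \<Rightarrow> real) \<Rightarrow> nat \<Rightarrow> real" where
  "sphere_to_box k p = (\<lambda>i\<in>{..k}. p i / sup_norm k p)"

lemma sphere_to_box_in:
  assumes "p \<in> topspace (sphere_top k)"
  shows "sphere_to_box k p \<in> box_boundary k"
proof -
  note pos = sup_norm_sphere_pos[OF assms]
  obtain i where i: "i \<le> k" "sup_norm k p = \<bar>p i\<bar>" using sup_norm_attained by blast
  have "\<bar>p j / sup_norm k p\<bar> \<le> 1" if "j \<le> k" for j
    using sup_norm_ge[OF that, of p] pos by (simp add: abs_divide)
  then have "sphere_to_box k p \<in> topspace (box_top k)"
    unfolding topspace_box_top sphere_to_box_def by (simp only: restrict_PiE_iff atMost_iff atLeastAtMost_iff abs_le_iff) auto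
  moreover have "\<bar>sphere_to_box k p i\<bar> = 1"
    using i pos by (simp add: sphere_to_box_def abs_divide)
  ultimately show ?thesis using i(1) by (auto simp: box_boundary_def)
qed

lemma continuous_map_sphere_to_box:
  "continuous_map (sphere_top k) (subtopology (box_top k) (box_boundary k)) (sphere_to_box k)"
proof -
  have "continuous_map (sphere_top k) euclideanreal (\<lambda>p. p i / sup_norm k p)" if "i \<le> k" for i
    unfolding sup_norm_def
    using that sup_norm_sphere_pos unfolding sup_norm_def
    by (intro continuous_map_real_divide continuous_map_Max continuous_map_real_abs continuous_map_sphere_coord)
      (auto dest: less_imp_neq[symmetric])
  moreover have "p i / sup_norm k p \<in> {-1..1}" if "p \<in> topspace (sphere_top k)" "i \<le> k" for p i
    using sphere_to_box_in[OF that(1)] that(2)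
    by (auto simp: box_boundary_def topspace_box_top sphere_to_box_def PiE_iff)
  ultimately have "continuous_map (sphere_top k) (box_top k) (sphere_to_box k)"
    unfolding box_top_def sphere_to_box_def
    by (auto simp: continuous_map_componentwise continuous_map_in_subtopology)
  then show ?thesis
    using sphere_to_box_in by (auto simp: continuous_map_in_subtopology)
qed

text \<open>The basepoint of the sphere lands on the face where coordinate 0 is 1. The maps to be
  extended are constant there, so they become based maps of the sphere.\<close>

lemma sphere_to_box_base: "sphere_to_box k (sphere_base k) 0 = 1"
proof -
  have "sup_norm k (sphere_base k) = 1"
    by (rule sup_norm_eqI[of 0]) (auto simp: sphere_base_def)
  then show ?thesis by (simp add: sphere_to_box_def sphere_base_def)
qed

definition box_centre :: "nat \<Rightarrow> nat \<Rightarrow> real" where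
  "box_centre k = (\<lambda>i\<in>{..k}. 0)"

definition box_to_sphere :: "nat \<Rightarrow> (nat \<Rightarrow> real) \<Rightarrow> nat \<Rightarrow> real" where
  "box_to_sphere k z = (\<lambda>i\<in>{..k}. z i / sqrt (\<Sum>j\<le>k. (z j)\<^sup>2))"

lemma box_norm_pos:
  assumes "z \<in> topspace (box_top k)" "z \<noteq> box_centre k"
  shows "(\<Sum>j\<le>k. (z j)\<^sup>2) > 0"
proof -
  have "\<exists>i\<le>k. z i \<noteq> 0"
  proof (rule ccontr)
    assume "\<not> (\<exists>i\<le>k. z i \<noteq> 0)"
    then have "z = box_centre k"
      using assms(1) by (auto simp: box_centre_def topspace_box_top PiE_iff extensional_def fun_eq_iff)
    then show False using assms(2) by simp
  qed
  then obtain i where i: "i \<le> k" "z i \<noteq> 0" by blast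
  have "(z i)\<^sup>2 \<le> (\<Sum>j\<le>k. (z j)\<^sup>2)" using i by (intro member_le_sum) auto
  moreover have "(z i)\<^sup>2 > 0" using i by simp
  ultimately show ?thesis by linarith
qed

lemma box_to_sphere_in:
  assumes "z \<in> topspace (box_top k)" "z \<noteq> box_centre k"
  shows "box_to_sphere k z \<in> topspace (sphere_top k)"
proof -
  have "(\<Sum>i\<le>k. (box_to_sphere k z i)\<^sup>2) = (\<Sum>i\<le>k. (z i)\<^sup>2 / (\<Sum>j\<le>k. (z j)\<^sup>2))"
    by (rule sum.cong) (auto simp: box_to_sphere_def power_divide sum_nonneg)
  also have "\<dots> = 1"
    using box_norm_pos[OF assms] by (simp flip: sum_divide_distrib)
  finally show ?thesis by (simp add: topspace_sphere_top box_to_sphere_def)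
qed

lemma continuous_map_box_to_sphere:
  "continuous_map (subtopology (box_top k) (- {box_centre k})) (sphere_top k) (box_to_sphere k)"
proof -
  let ?B = "subtopology (box_top k) (- {box_centre k})"
  have "continuous_map ?B euclideanreal (\<lambda>z. z i / sqrt (\<Sum>j\<le>k. (z j)\<^sup>2))" if "i \<le> k" for i
  proof (intro continuous_map_real_divide)
    have s: "continuous_map ?B euclideanreal (\<lambda>z. \<Sum>j\<le>k. (z j)\<^sup>2)"
      by (intro continuous_intros continuous_map_from_subtopology continuous_map_box_coord) auto
    have "continuous_map euclideanreal euclideanreal sqrt"
      by (simp add: continuous_on_real_sqrt)
    then show "continuous_map ?B euclideanreal (\<lambda>z. sqrt (\<Sum>j\<le>k. (z j)\<^sup>2))"
      using continuous_map_compose[OF s, of euclideanreal sqrt] by (simp only: o_def)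
    show "sqrt (\<Sum>j\<le>k. (z j)\<^sup>2) \<noteq> 0" if "z \<in> topspace ?B" for z
      using box_norm_pos[of z k] that by auto
  qed (use that in \<open>simp add: continuous_map_from_subtopology continuous_map_box_coord\<close>)
  then have "continuous_map ?B (product_topology (\<lambda>_. euclideanreal) {..k}) (box_to_sphere k)"
    by (auto simp: continuous_map_componentwise box_to_sphere_def)
  moreover have "box_to_sphere k z \<in> topspace (sphere_top k)" if "z \<in> topspace ?B" for z
    using that by (intro box_to_sphere_in) auto
  ultimately show ?thesis
    unfolding sphere_top_def continuous_map_in_subtopology by (auto simp: sphere_top_def)
qed

text \<open>Both maps rescale by a positive factor, and a boundary point is the only one on its ray
  of supremum norm 1.\<close>

lemma sphere_to_box_inverse:
  assumes z: "z \<in> box_boundary k"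
  shows "z \<noteq> box_centre k" "sphere_to_box k (box_to_sphere k z) = z"
proof -
  obtain i where i: "i \<le> k" "\<bar>z i\<bar> = 1" and zB: "z \<in> topspace (box_top k)"
    using z by (auto simp: box_boundary_def)
  show nz: "z \<noteq> box_centre k" using i by (auto simp: box_centre_def)
  define c where "c = sqrt (\<Sum>j\<le>k. (z j)\<^sup>2)"
  have c: "c > 0" using box_norm_pos[OF zB nz] by (simp add: c_def)
  have "sup_norm k (box_to_sphere k z) = 1 / c"
  proof (rule sup_norm_eqI[OF i(1)])
    show "\<bar>box_to_sphere k z i\<bar> = 1 / c"
      using i c by (simp add: box_to_sphere_def c_def abs_divide)
    have "\<bar>z j\<bar> \<le> 1" if "j \<le> k" for j
      using zB that by (auto simp: topspace_box_top PiE_iff abs_le_iff)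
    then show "\<bar>box_to_sphere k z j\<bar> \<le> 1 / c" if "j \<le> k" for j
      using that c by (simp add: box_to_sphere_def abs_divide divide_right_mono flip: c_def)
  qed
  then show "sphere_to_box k (box_to_sphere k z) = z"
    using c zB by (auto simp: sphere_to_box_def box_to_sphere_def topspace_box_top PiE_iff
        extensional_def fun_eq_iff simp flip: c_def)
qed

text \<open>The box is the cone over its boundary. A nullhomotopy of the boundary map, run along the
  rays to the centre, extends the map over the box. The extension takes no values besides those of
  the nullhomotopy and \<open>a\<close>, so convergence is inherited.\<close>

lemma box_extension_seq:
  fixes \<phi> :: "nat \<Rightarrow> (nat \<Rightarrow> real) \<Rightarrow> 'a"
  assumes A: "seq_contractible k A a"
    and cont: "\<And>i. continuous_map (subtopology (box_top k) (box_boundary k)) A (\<phi> i)"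
    and top: "\<And>i z. \<lbrakk>z \<in> box_boundary k; z 0 = 1\<rbrakk> \<Longrightarrow> \<phi> i z = a"
    and conv: "\<And>U. \<lbrakk>openin A U; a \<in> U\<rbrakk> \<Longrightarrow> finite {i. \<not> \<phi> i ` box_boundary k \<subseteq> U}"
  obtains \<Phi> where "\<And>i. continuous_map (box_top k) A (\<Phi> i)"
    and "\<And>i z. z \<in> box_boundary k \<Longrightarrow> \<Phi> i z = \<phi> i z"
    and "\<And>U. \<lbrakk>openin A U; a \<in> U\<rbrakk> \<Longrightarrow> finite {i. \<not> \<Phi> i ` topspace (box_top k) \<subseteq> U}"
proof -
  let ?S = "sphere_top k" and ?I = "top_of_set {0..1::real}" and ?B = "box_top k"
  define \<psi> where "\<psi> i = \<phi> i \<circ> sphere_to_box k" for i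
  have "continuous_map ?S A (\<psi> i)" "\<psi> i (sphere_base k) = a" for i
    unfolding \<psi>_def
    using continuous_map_compose[OF continuous_map_sphere_to_box cont]
      top[OF sphere_to_box_in[OF sphere_base_in] sphere_to_box_base] by (auto simp: o_def)
  moreover have "maps_converge ?S A \<psi> a"
    unfolding maps_converge_iff_finite
  proof (intro allI impI)
    fix U assume "openin A U \<and> a \<in> U"
    then have "finite {i. \<not> \<phi> i ` box_boundary k \<subseteq> U}" using conv by blast
    then show "finite {i. \<not> \<psi> i ` topspace ?S \<subseteq> U}"
      by (rule rev_finite_subset) (use sphere_to_box_in in \<open>auto simp: \<psi>_def\<close>)
  qed
  ultimately obtain h where h: "\<And>i. continuous_map (prod_topology ?S ?I) A (h i)"
    and h0: "\<And>i p. p \<in> topspace ?S \<Longrightarrow> h i (p, 0) = \<psi> i p"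
    and h1: "\<And>i p. p \<in> topspace ?S \<Longrightarrow> h i (p, 1) = a"
    and hconv: "maps_converge (prod_topology ?S ?I) A h a"
    using A unfolding seq_contractible_def by metis
  \<comment> \<open>The time of the nullhomotopy as a function on the box: 0 on the boundary and 1
    at the centre.\<close>
  define \<rho> where "\<rho> z = (\<Prod>i\<le>k. 1 - (z i)\<^sup>2)" for z :: "nat \<Rightarrow> real"
  have \<rho>_cont: "continuous_map ?B ?I \<rho>"
  proof -
    have "continuous_map ?B euclideanreal \<rho>"
      unfolding \<rho>_def by (intro continuous_intros continuous_map_box_coord) auto
    moreover have "\<rho> z \<in> {0..1}" if "z \<in> topspace ?B" for z
    proof -
      have "(z i)\<^sup>2 \<le> 1" if "i \<le> k" for i
        using \<open>z \<in> topspace ?B\<close> that by (auto simp: topspace_box_top PiE_iff abs_square_le_1 abs_le_iff minus_le_iff)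
      then show ?thesis unfolding \<rho>_def by (auto intro!: prod_nonneg prod_le_1)
    qed
    ultimately show ?thesis by (auto simp: continuous_map_in_subtopology)
  qed
  have \<rho>_bd: "\<rho> z = 0" if "z \<in> box_boundary k" for z
  proof -
    obtain i where "i \<le> k" "\<bar>z i\<bar> = 1" using \<open>z \<in> box_boundary k\<close> by (auto simp: box_boundary_def)
    then have "1 - (z i)\<^sup>2 = 0" by (metis power2_abs one_power2 diff_self)
    then show ?thesis unfolding \<rho>_def using \<open>i \<le> k\<close> by (auto intro!: prod_zero)
  qed
  have \<rho>_centre: "\<rho> (box_centre k) = 1" by (simp add: \<rho>_def box_centre_def)
  have cB: "box_centre k \<in> topspace ?B" by (simp add: topspace_box_top box_centre_def)
  \<comment> \<open>The direction is undefined at the centre, but at time 1 the nullhomotopy is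
    \<open>a\<close> in every direction.\<close>
  define \<Phi> where "\<Phi> i z = (if z = box_centre k then a else h i (box_to_sphere k z, \<rho> z))" for i z
  have pair: "(box_to_sphere k z, \<rho> z) \<in> topspace (prod_topology ?S ?I)"
    if "z \<in> topspace ?B" "z \<noteq> box_centre k" for z
    using box_to_sphere_in[OF that] continuous_map_funspace[OF \<rho>_cont] that by auto
  have "h 0 (sphere_base k, 1) \<in> topspace A"
    by (rule funcset_mem[OF continuous_map_funspace[OF h]]) (simp add: sphere_base_in)
  then have aA: "a \<in> topspace A" by (simp add: h1 sphere_base_in)
  show ?thesis
  proof
    fix i
    show "continuous_map ?B A (\<Phi> i)"
      unfolding continuous_map_def
    proof (intro conjI allI impI)
      show "\<Phi> i \<in> topspace ?B \<rightarrow> topspace A"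
        using funcset_mem[OF continuous_map_funspace[OF h[of i]] pair] aA by (simp add: \<Phi>_def)
      fix U assume U: "openin A U"
      have "openin ?B {z \<in> topspace ?B - {box_centre k}. h i (box_to_sphere k z, \<rho> z) \<in> U}"
      proof -
        have op: "openin ?B (topspace ?B \<inter> - {box_centre k})"
          using openin_diff[OF openin_topspace, of ?B "{box_centre k}"] cB
          by (simp add: box_top_def Hausdorff_space_product_topology Hausdorff_space_subtopology
              closedin_Hausdorff_singleton Diff_eq)
        have "continuous_map (subtopology ?B (- {box_centre k})) (prod_topology ?S ?I)
            (\<lambda>z. (box_to_sphere k z, \<rho> z))"
          by (intro continuous_map_pairedI continuous_map_box_to_sphere
              continuous_map_from_subtopology[OF \<rho>_cont])
        then have "continuous_map (subtopology ?B (- {box_centre k})) A (h i \<circ> (\<lambda>z. (box_to_sphere k z, \<rho> z)))"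
          using h by (rule continuous_map_compose)
        then have "openin (subtopology ?B (- {box_centre k}))
            {z \<in> topspace (subtopology ?B (- {box_centre k})). (h i \<circ> (\<lambda>z. (box_to_sphere k z, \<rho> z))) z \<in> U}"
          using U by (rule openin_continuous_map_preimage)
        moreover have "{z \<in> topspace (subtopology ?B (- {box_centre k})). (h i \<circ> (\<lambda>z. (box_to_sphere k z, \<rho> z))) z \<in> U}
            = {z \<in> topspace ?B - {box_centre k}. h i (box_to_sphere k z, \<rho> z) \<in> U}" by auto
        ultimately show ?thesis
          using openin_open_subtopology[OF op] by (simp add: subtopology_restrict)
      qed
      \<comment> \<open>All directions occur near the centre, so a time close enough to 1 must work
        for all of them at once; compactness of the sphere provides it.\<close>
      moreover have "\<exists>D. openin ?B D \<and> box_centre k \<in> D \<and> D \<subseteq> {z \<in> topspace ?B. \<Phi> i z \<in> U}" if "a \<in> U"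
      proof -
        define W where "W = {w \<in> topspace (prod_topology ?S ?I). h i w \<in> U}"
        have W: "openin (prod_topology ?S ?I) W"
          unfolding W_def by (rule openin_continuous_map_preimage[OF h U])
        have "topspace ?S \<times> {1} \<subseteq> W"
          using h1 that by (auto simp: W_def)
        then obtain V Q where V: "topspace ?S \<subseteq> Q" "openin ?I V" "1 \<in> V" "Q \<times> V \<subseteq> W"
          using tube_lemma_left[OF W, of "topspace ?S" 1] compact_space_sphere_top[of k]
          unfolding compact_space_def by auto
        have "openin ?B {z \<in> topspace ?B. \<rho> z \<in> V}"
          by (rule openin_continuous_map_preimage[OF \<rho>_cont V(2)])
        moreover have "{z \<in> topspace ?B. \<rho> z \<in> V} \<subseteq> {z \<in> topspace ?B. \<Phi> i z \<in> U}"
        proof clarify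
          fix z assume z: "z \<in> topspace ?B" "\<rho> z \<in> V"
          show "\<Phi> i z \<in> U"
          proof (cases "z = box_centre k")
            case False
            then have "(box_to_sphere k z, \<rho> z) \<in> W" using V(1,4) z box_to_sphere_in by blast
            then show ?thesis using False by (simp add: \<Phi>_def W_def)
          qed (use that in \<open>simp add: \<Phi>_def\<close>)
        qed
        ultimately show ?thesis using \<rho>_centre cB V(3) by (intro exI[of _ "{z \<in> topspace ?B. \<rho> z \<in> V}"]) auto
      qed
      ultimately show "openin ?B {z \<in> topspace ?B. \<Phi> i z \<in> U}"
      proof (subst openin_subopen, intro ballI)
        fix z assume *: "openin ?B {z \<in> topspace ?B - {box_centre k}. h i (box_to_sphere k z, \<rho> z) \<in> U}"
          and **: "a \<in> U \<Longrightarrow> \<exists>D. openin ?B D \<and> box_centre k \<in> D \<and> D \<subseteq> {z \<in> topspace ?B. \<Phi> i z \<in> U}"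
          and z: "z \<in> {z \<in> topspace ?B. \<Phi> i z \<in> U}"
        show "\<exists>T. openin ?B T \<and> z \<in> T \<and> T \<subseteq> {z \<in> topspace ?B. \<Phi> i z \<in> U}"
        proof (cases "z = box_centre k")
          case True
          then show ?thesis using ** z by (simp add: \<Phi>_def)
        next
          case False
          then show ?thesis using * z
            by (intro exI[of _ "{z \<in> topspace ?B - {box_centre k}. h i (box_to_sphere k z, \<rho> z) \<in> U}"])
              (auto simp: \<Phi>_def)
        qed
      qed
    qed
    show "\<Phi> i z = \<phi> i z" if z: "z \<in> box_boundary k" for z
      using sphere_to_box_inverse[OF z] box_to_sphere_in[of z k] h0 \<rho>_bd[OF z] z
      by (simp add: \<Phi>_def \<psi>_def box_boundary_def)
  next
    fix U assume U: "openin A U" "a \<in> U"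
    then have "finite {i. \<not> h i ` topspace (prod_topology ?S ?I) \<subseteq> U}"
      using hconv unfolding maps_converge_iff_finite by blast
    then show "finite {i. \<not> \<Phi> i ` topspace ?B \<subseteq> U}"
    proof (rule rev_finite_subset, intro Collect_mono impI, elim contrapos_nn)
      fix i assume "h i ` topspace (prod_topology ?S ?I) \<subseteq> U"
      then show "\<Phi> i ` topspace ?B \<subseteq> U"
        using pair U(2) by (force simp: \<Phi>_def)
    qed
  qed
qed

text \<open>The spheres to be filled will be indexed by pairs of a sequence index and a cell. An
  injection into the naturals makes them one sequence, and the positions left over are padded with
  constant maps at \<open>a\<close>.\<close>

lemma box_extension:
  fixes \<phi> :: "'i::countable \<Rightarrow> (nat \<Rightarrow> real) \<Rightarrow> 'a"
  assumes A: "seq_contractible k A a" and aA: "a \<in> topspace A"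
    and cont: "\<And>i. continuous_map (subtopology (box_top k) (box_boundary k)) A (\<phi> i)"
    and top: "\<And>i z. \<lbrakk>z \<in> box_boundary k; z 0 = 1\<rbrakk> \<Longrightarrow> \<phi> i z = a"
    and conv: "\<And>U. \<lbrakk>openin A U; a \<in> U\<rbrakk> \<Longrightarrow> finite {i. \<not> \<phi> i ` box_boundary k \<subseteq> U}"
  obtains \<Phi> where "\<And>i. continuous_map (box_top k) A (\<Phi> i)"
    and "\<And>i z. z \<in> box_boundary k \<Longrightarrow> \<Phi> i z = \<phi> i z"
    and "\<And>U. \<lbrakk>openin A U; a \<in> U\<rbrakk> \<Longrightarrow> finite {i. \<not> \<Phi> i ` topspace (box_top k) \<subseteq> U}"
proof -
  define \<psi> where "\<psi> m = (if m \<in> range (to_nat :: 'i \<Rightarrow> nat) then \<phi> (from_nat m) else (\<lambda>_. a))" for m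
  obtain \<Psi> where \<Psi>: "\<And>m. continuous_map (box_top k) A (\<Psi> m)"
    "\<And>m z. z \<in> box_boundary k \<Longrightarrow> \<Psi> m z = \<psi> m z"
    "\<And>U. \<lbrakk>openin A U; a \<in> U\<rbrakk> \<Longrightarrow> finite {m. \<not> \<Psi> m ` topspace (box_top k) \<subseteq> U}"
  proof (rule box_extension_seq[OF A, of \<psi>])
    show "continuous_map (subtopology (box_top k) (box_boundary k)) A (\<psi> m)" for m
      using cont aA by (simp add: \<psi>_def)
    show "\<psi> m z = a" if "z \<in> box_boundary k" "z 0 = 1" for m z
      using top[OF that] by (simp add: \<psi>_def)
    fix U assume U: "openin A U" "a \<in> U"
    have "finite (to_nat ` {i. \<not> \<phi> i ` box_boundary k \<subseteq> U})"
      using conv[OF U] by simp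
    then show "finite {m. \<not> \<psi> m ` box_boundary k \<subseteq> U}"
      by (rule rev_finite_subset) (use U in \<open>auto simp: \<psi>_def image_iff image_subset_iff split: if_splits\<close>)
  qed blast
  show ?thesis
  proof
    show "continuous_map (box_top k) A (\<Psi> (to_nat i))" for i :: 'i by (rule \<Psi>)
    show "\<Psi> (to_nat i) z = \<phi> i z" if "z \<in> box_boundary k" for i z
      using \<Psi>(2)[OF that] by (simp add: \<psi>_def)
    fix U assume U: "openin A U" "a \<in> U"
    have "finite (to_nat -` {m. \<not> \<Psi> m ` topspace (box_top k) \<subseteq> U} :: 'i set)"
      by (rule finite_vimageI[OF \<Psi>(3)[OF U]]) simp
    then show "finite {i :: 'i. \<not> \<Psi> (to_nat i) ` topspace (box_top k) \<subseteq> U}"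
      by (simp add: vimage_def)
  qed
qed

section \<open>Dyadic cell decomposition of an open subset of the cube\<close>

text \<open>An open cell at scale \<open>2 ^ -N\<close> is encoded by \<open>N\<close> and the floors and ceilings of the
  coordinates of \<open>2 ^ N * t\<close>; a coordinate is degenerate iff floor and ceiling agree.\<close>

type_synonym dyadic_cell = "nat \<times> (int \<times> int) list"

definition dyadic_code :: "nat \<Rightarrow> nat \<Rightarrow> (nat \<Rightarrow> real) \<Rightarrow> (int \<times> int) list" where
  "dyadic_code n N t = map (\<lambda>i. (\<lfloor>2 ^ N * t i\<rfloor>, \<lceil>2 ^ N * t i\<rceil>)) [0..<n]"

definition closed_cell :: "nat \<Rightarrow> dyadic_cell \<Rightarrow> (nat \<Rightarrow> real) set" where
  "closed_cell n c = {u \<in> topspace (cube n). \<forall>i<n.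
     of_int (fst (snd c ! i)) \<le> 2 ^ fst c * u i \<and> 2 ^ fst c * u i \<le> of_int (snd (snd c ! i))}"

text \<open>The cardinality of this set is the dimension of the cell.\<close>

definition cell_dirs :: "nat \<Rightarrow> dyadic_cell \<Rightarrow> nat set" where
  "cell_dirs n c = {i. i < n \<and> fst (snd c ! i) \<noteq> snd (snd c ! i)}"

text \<open>Some closed dyadic cube of side \<open>2 ^ -N\<close> contains both points. The cubes
  are closed so that a point on a common wall is near the points on both sides; this makes the sets
  \<open>core N\<close> below open.\<close>

definition dyadic_near :: "nat \<Rightarrow> nat \<Rightarrow> (nat \<Rightarrow> real) \<Rightarrow> (nat \<Rightarrow> real) \<Rightarrow> bool" where
  "dyadic_near n N t u \<longleftrightarrow> (\<forall>i<n. \<exists>j::int.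
     of_int j \<le> 2 ^ N * t i \<and> 2 ^ N * t i \<le> of_int j + 1 \<and>
     of_int j \<le> 2 ^ N * u i \<and> 2 ^ N * u i \<le> of_int j + 1)"

lemma topspace_cube: "topspace (cube n) = PiE {..<n} (\<lambda>_. {0..1})"
  by (simp add: cube_def)

lemma continuous_map_cube_coord: "i < n \<Longrightarrow> continuous_map (cube n) euclideanreal (\<lambda>z. z i)"
  using continuous_map_product_projection[of i "{..<n}" "\<lambda>_. top_of_set {0..1::real}"]
  by (simp add: cube_def continuous_map_in_subtopology)

lemma compact_space_cube: "compact_space (cube n)"
  by (simp add: cube_def compact_space_product_topology compact_space_subtopology)

lemma dyadic_code_nth: "i < n \<Longrightarrow> dyadic_code n N t ! i = (\<lfloor>2 ^ N * t i\<rfloor>, \<lceil>2 ^ N * t i\<rceil>)"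
  by (simp add: dyadic_code_def)

lemma in_closed_cell_code: "u \<in> closed_cell n (N, dyadic_code n N t) \<longleftrightarrow> u \<in> topspace (cube n) \<and>
   (\<forall>i<n. of_int \<lfloor>2 ^ N * t i\<rfloor> \<le> 2 ^ N * u i \<and> 2 ^ N * u i \<le> of_int \<lceil>2 ^ N * t i\<rceil>)"
  by (auto simp: closed_cell_def dyadic_code_nth)

lemma closed_cell_self: "t \<in> topspace (cube n) \<Longrightarrow> t \<in> closed_cell n (N, dyadic_code n N t)"
  by (simp add: in_closed_cell_code)

lemma closedin_closed_cell: "closedin (cube n) (closed_cell n c)"
proof -
  have "closedin (cube n) {u \<in> topspace (cube n). 2 ^ fst c * u i \<in>
      {of_int (fst (snd c ! i)) .. of_int (snd (snd c ! i))}}" if "i < n" for i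
    by (rule closedin_continuous_map_preimage[of _ euclideanreal])
      (auto intro!: continuous_intros continuous_map_cube_coord that)
  moreover have "closed_cell n c = topspace (cube n) \<inter> (\<Inter>i\<in>{..<n}. {u \<in> topspace (cube n). 2 ^ fst c * u i \<in>
      {of_int (fst (snd c ! i)) .. of_int (snd (snd c ! i))}})"
    by (auto simp: closed_cell_def)
  ultimately show ?thesis
    by (cases "n = 0") (auto intro!: closedin_Int closedin_Inter simp: closed_cell_def)
qed

lemma compactin_closed_cell: "compactin (cube n) (closed_cell n c)"
  using closedin_closed_cell closedin_compact_space compact_space_cube by blast

lemma dyadic_near_refl: "dyadic_near n N t t"
  unfolding dyadic_near_def
proof (intro allI impI)
  fix i
  show "\<exists>j::int. of_int j \<le> 2 ^ N * t i \<and> 2 ^ N * t i \<le> of_int j + 1 \<and>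
     of_int j \<le> 2 ^ N * t i \<and> 2 ^ N * t i \<le> of_int j + 1"
    by (rule exI[of _ "\<lfloor>2 ^ N * t i\<rfloor>"]) linarith
qed

lemma dyadic_near_closed_cell:
  assumes "u \<in> closed_cell n (N, dyadic_code n N t)"
  shows "dyadic_near n N t u"
  unfolding dyadic_near_def
proof (intro allI impI)
  fix i assume "i < n"
  then have "of_int \<lfloor>2 ^ N * t i\<rfloor> \<le> 2 ^ N * u i" "2 ^ N * u i \<le> of_int \<lceil>2 ^ N * t i\<rceil>"
    using assms by (auto simp: in_closed_cell_code)
  moreover have "\<lceil>2 ^ N * t i\<rceil> \<le> \<lfloor>2 ^ N * t i\<rfloor> + 1" by linarith
  then have "of_int \<lceil>2 ^ N * t i\<rceil> \<le> (of_int \<lfloor>2 ^ N * t i\<rfloor> + 1 :: real)" by linarith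
  ultimately show "\<exists>j::int. of_int j \<le> 2 ^ N * t i \<and> 2 ^ N * t i \<le> of_int j + 1 \<and>
     of_int j \<le> 2 ^ N * u i \<and> 2 ^ N * u i \<le> of_int j + 1"
    by (intro exI[of _ "\<lfloor>2 ^ N * t i\<rfloor>"]) linarith
qed

text \<open>The walls of the coarse grid are also walls of the fine one, so a closed coarse cube
  through \<open>t\<close> contains the whole closed fine cell of \<open>t\<close>, in particular
  \<open>u\<close>.\<close>

lemma dyadic_near_coarser:
  assumes u: "u \<in> closed_cell n (N, dyadic_code n N t)" and "M \<le> N" and near: "dyadic_near n M t v"
  shows "dyadic_near n M u v"
  unfolding dyadic_near_def
proof (intro allI impI)
  fix i assume i: "i < n"
  obtain j :: int where j: "of_int j \<le> 2 ^ M * t i" "2 ^ M * t i \<le> of_int j + 1"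
    "of_int j \<le> 2 ^ M * v i" "2 ^ M * v i \<le> of_int j + 1"
    using near i unfolding dyadic_near_def by blast
  have pow: "(2::real) ^ N = 2 ^ (N - M) * 2 ^ M" using \<open>M \<le> N\<close> by (simp flip: power_add)
  have "of_int (2 ^ (N - M) * j) \<le> 2 ^ N * t i"
    using mult_left_mono[OF j(1), of "2 ^ (N - M)"] by (simp add: pow mult.assoc)
  then have "2 ^ (N - M) * j \<le> \<lfloor>2 ^ N * t i\<rfloor>" by (simp only: le_floor_iff)
  then have "of_int (2 ^ (N - M) * j) \<le> 2 ^ N * u i"
    using u i unfolding in_closed_cell_code by (meson of_int_le_iff order_trans)
  then have 1: "of_int j \<le> 2 ^ M * u i" by (simp add: pow mult.assoc)
  have "2 ^ N * t i \<le> of_int (2 ^ (N - M) * (j + 1))"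
    using mult_left_mono[OF j(2), of "2 ^ (N - M)"] by (simp add: pow mult.assoc)
  then have "\<lceil>2 ^ N * t i\<rceil> \<le> 2 ^ (N - M) * (j + 1)" by (simp only: ceiling_le_iff)
  then have "2 ^ N * u i \<le> of_int (2 ^ (N - M) * (j + 1))"
    using u i unfolding in_closed_cell_code by (meson of_int_le_iff order_trans)
  then have 2: "2 ^ M * u i \<le> of_int j + 1" by (simp add: pow mult.assoc)
  show "\<exists>j::int. of_int j \<le> 2 ^ M * u i \<and> 2 ^ M * u i \<le> of_int j + 1 \<and>
     of_int j \<le> 2 ^ M * v i \<and> 2 ^ M * v i \<le> of_int j + 1"
    using 1 2 j by blast
qed

lemma dyadic_near_mono:
  assumes "dyadic_near n N t u" "M \<le> N"
  shows "dyadic_near n M t u"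
  unfolding dyadic_near_def
proof (intro allI impI)
  fix i assume i: "i < n"
  obtain j :: int where j: "of_int j \<le> 2 ^ N * t i" "2 ^ N * t i \<le> of_int j + 1"
    "of_int j \<le> 2 ^ N * u i" "2 ^ N * u i \<le> of_int j + 1"
    using assms i unfolding dyadic_near_def by blast
  define D where "D = (2::int) ^ (N - M)"
  have D: "D > 0" by (simp add: D_def)
  have pow: "(2::real) ^ N = of_int D * 2 ^ M" using \<open>M \<le> N\<close> by (simp add: D_def flip: power_add)
  \<comment> \<open>\<open>j div D\<close> is the position of the coarse interval that contains the
    \<open>j\<close>-th fine one.\<close>
  have "D * (j div D) \<le> j" "j + 1 \<le> D * (j div D + 1)"
    using D pos_mod_bound[OF D, of j] pos_mod_sign[OF D, of j] mult_div_mod_eq[of D j]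
    unfolding distrib_left by linarith+
  then have "of_int (D * (j div D)) \<le> (of_int j :: real)" "of_int (j + 1) \<le> (of_int (D * (j div D + 1)) :: real)"
    unfolding of_int_le_iff by auto
  then have *: "of_int D * of_int (j div D) \<le> of_int D * (2 ^ M * s)"
      "of_int D * (2 ^ M * s) \<le> of_int D * (of_int (j div D) + 1)"
    if "of_int j \<le> 2 ^ N * s" "2 ^ N * s \<le> of_int j + 1" for s :: real
    using that by (auto simp: pow mult.assoc)
  have "of_int (j div D) \<le> 2 ^ M * s" "2 ^ M * s \<le> of_int (j div D) + 1"
    if "of_int j \<le> 2 ^ N * s" "2 ^ N * s \<le> of_int j + 1" for s :: real
    using *[OF that] D by auto
  then show "\<exists>j::int. of_int j \<le> 2 ^ M * t i \<and> 2 ^ M * t i \<le> of_int j + 1 \<and>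
     of_int j \<le> 2 ^ M * u i \<and> 2 ^ M * u i \<le> of_int j + 1"
    using j by blast
qed

lemma floor_ceiling_eq_of_between:
  fixes r s :: real
  assumes "of_int \<lfloor>s\<rfloor> \<le> r" "r \<le> of_int \<lceil>s\<rceil>" and r: "\<lfloor>r\<rfloor> \<noteq> \<lceil>r\<rceil>" and s: "\<lfloor>s\<rfloor> \<noteq> \<lceil>s\<rceil>"
  shows "\<lfloor>r\<rfloor> = \<lfloor>s\<rfloor> \<and> \<lceil>r\<rceil> = \<lceil>s\<rceil>"
proof -
  have c: "\<lceil>s\<rceil> = \<lfloor>s\<rfloor> + 1" using s by linarith
  have "r \<noteq> of_int \<lfloor>s\<rfloor>" "r \<noteq> of_int \<lceil>s\<rceil>" using r by (metis floor_of_int ceiling_of_int)+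
  then have "of_int \<lfloor>s\<rfloor> < r" "r < of_int \<lfloor>s\<rfloor> + 1" using assms(1,2) c by auto
  then show ?thesis unfolding c by (simp add: floor_eq_iff ceiling_eq_iff)
qed

section \<open>Cells of an open set at a scale depending on the point\<close>

locale open_in_cube =
  fixes n :: nat and E :: "(nat \<Rightarrow> real) set"
  assumes openE: "openin (cube n) E"
begin

text \<open>The points all of whose closed cubes of side \<open>2 ^ -N\<close> lie in \<open>E\<close>.  Taking the least such \<open>N\<close>
  as the local scale makes the open cells a locally finite partition of \<open>E\<close> in which the boundary
  of a cell lies in cells of smaller dimension.\<close>

definition core :: "nat \<Rightarrow> (nat \<Rightarrow> real) set" where
  "core N = {t \<in> topspace (cube n). \<forall>u\<in>topspace (cube n). dyadic_near n N t u \<longrightarrow> u \<in> E}"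

definition level :: "(nat \<Rightarrow> real) \<Rightarrow> nat" where
  "level t = (LEAST N. t \<in> core N)"

definition cell_of :: "(nat \<Rightarrow> real) \<Rightarrow> dyadic_cell" where
  "cell_of t = (level t, dyadic_code n (level t) t)"

lemma E_subset: "E \<subseteq> topspace (cube n)"
  using openE by (rule openin_subset)

lemma core_subset: "core N \<subseteq> E"
  using dyadic_near_refl by (auto simp: core_def)

lemma core_mono: "M \<le> N \<Longrightarrow> core M \<subseteq> core N"
  using dyadic_near_mono by (fastforce simp: core_def)

lemma ex_core:
  assumes "t \<in> E"
  shows "\<exists>N. t \<in> core N"
proof -
  have "openin (product_topology (\<lambda>_. top_of_set {0..1}) {..<n}) E"
    using openE by (simp add: cube_def)
  then have "\<exists>U. finite {i \<in> {..<n}. U i \<noteq> topspace (top_of_set {0..1::real})} \<and>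
      (\<forall>i\<in>{..<n}. openin (top_of_set {0..1}) (U i)) \<and> t \<in> PiE {..<n} U \<and> PiE {..<n} U \<subseteq> E"
    using assms unfolding openin_product_topology_alt by (rule bspec)
  then obtain U where U: "\<And>i. i < n \<Longrightarrow> openin (top_of_set {0..1}) (U i)" "t \<in> PiE {..<n} U" "PiE {..<n} U \<subseteq> E"
    by auto
  have "\<exists>e>0. \<forall>s\<in>{0..1}. \<bar>s - t i\<bar> < e \<longrightarrow> s \<in> U i" if "i < n" for i
    using U(1)[OF that] U(2) that unfolding openin_euclidean_subtopology_iff
    by (auto simp: PiE_iff dist_real_def)
  then obtain e where e: "\<And>i. i < n \<Longrightarrow> e i > 0" "\<And>i s. \<lbrakk>i < n; s \<in> {0..1}; \<bar>s - t i\<bar> < e i\<rbrakk> \<Longrightarrow> s \<in> U i"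
    by metis
  have "\<forall>\<^sub>F N in sequentially. \<forall>i\<in>{..<n}. 1 / 2 ^ N < e i"
  proof (intro eventually_ball_finite ballI)
    fix i assume "i \<in> {..<n}"
    have "(\<lambda>N. (1 / 2) ^ N :: real) \<longlonglongrightarrow> 0" by (rule LIMSEQ_power_zero) simp
    then show "\<forall>\<^sub>F N in sequentially. 1 / 2 ^ N < e i"
      using e(1)[of i] \<open>i \<in> {..<n}\<close> by (auto simp: power_one_over dest!: order_tendstoD(2))
  qed simp
  then obtain N where N: "\<And>i. i < n \<Longrightarrow> 1 / 2 ^ N < e i"
    using eventually_happens'[OF sequentially_bot] by blast
  have "u \<in> E" if u: "u \<in> topspace (cube n)" "dyadic_near n N t u" for u
  proof -
    have "u i \<in> U i" if i: "i < n" for i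
    proof (rule e(2)[OF i])
      show "u i \<in> {0..1}" using u i by (auto simp: topspace_cube PiE_iff)
      obtain j :: int where "of_int j \<le> 2 ^ N * t i" "2 ^ N * t i \<le> of_int j + 1"
        "of_int j \<le> 2 ^ N * u i" "2 ^ N * u i \<le> of_int j + 1"
        using u i unfolding dyadic_near_def by blast
      then have "\<bar>2 ^ N * (u i - t i)\<bar> \<le> 1" unfolding right_diff_distrib by linarith
      then have "2 ^ N * \<bar>u i - t i\<bar> \<le> 1" unfolding abs_mult by simp
      then have "\<bar>u i - t i\<bar> \<le> 1 / 2 ^ N" by (simp add: pos_le_divide_eq mult.commute)
      then show "\<bar>u i - t i\<bar> < e i" using N[OF i] by linarith
    qed
    then have "u \<in> PiE {..<n} U" using u by (auto simp: topspace_cube PiE_iff)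
    then show ?thesis using U(3) by blast
  qed
  then have "t \<in> core N" using assms E_subset by (auto simp: core_def)
  then show ?thesis ..
qed

lemma core_level: "t \<in> E \<Longrightarrow> t \<in> core (level t)"
  unfolding level_def using ex_core by (metis LeastI)

lemma level_le: "t \<in> core N \<Longrightarrow> level t \<le> N"
  unfolding level_def by (rule Least_le)

lemma openin_core: "openin (cube n) (core N)"
proof (subst openin_subopen, intro ballI)
  fix t assume t: "t \<in> core N"
  \<comment> \<open>The open star of the cell of \<open>t\<close>: every closed cube at scale
    \<open>N\<close> that contains a point of it also contains \<open>t\<close>. Hence a point of
    the star is near only to points that \<open>t\<close> is near to.\<close>
  define T where "T = topspace (cube n) \<inter> (\<Inter>i\<in>{..<n}. {u \<in> topspace (cube n).
      2 ^ N * u i \<in> {of_int \<lceil>2 ^ N * t i\<rceil> - 1 <..< of_int \<lfloor>2 ^ N * t i\<rfloor> + 1}})"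
  have "openin (cube n) {u \<in> topspace (cube n). 2 ^ N * u i \<in>
      {of_int \<lceil>2 ^ N * t i\<rceil> - 1 <..< of_int \<lfloor>2 ^ N * t i\<rfloor> + 1}}" if "i < n" for i
    by (rule openin_continuous_map_preimage[of _ euclideanreal])
      (auto intro!: continuous_intros continuous_map_cube_coord that)
  then have "openin (cube n) T"
    unfolding T_def by (cases "n = 0") (auto intro!: openin_Int openin_Inter)
  moreover have "t \<in> T"
    using t unfolding T_def core_def by auto linarith+
  moreover have "T \<subseteq> core N"
  proof
    fix u assume u: "u \<in> T"
    have "dyadic_near n N t v" if v: "dyadic_near n N u v" for v
      unfolding dyadic_near_def
    proof (intro allI impI)
      fix i assume i: "i < n"
      obtain j :: int where j: "of_int j \<le> 2 ^ N * u i" "2 ^ N * u i \<le> of_int j + 1"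
        "of_int j \<le> 2 ^ N * v i" "2 ^ N * v i \<le> of_int j + 1"
        using v i unfolding dyadic_near_def by blast
      have "of_int \<lceil>2 ^ N * t i\<rceil> - 1 < 2 ^ N * u i" "2 ^ N * u i < of_int \<lfloor>2 ^ N * t i\<rfloor> + 1"
      proof -
        have "u \<in> {u \<in> topspace (cube n).
            2 ^ N * u i \<in> {of_int \<lceil>2 ^ N * t i\<rceil> - 1 <..< of_int \<lfloor>2 ^ N * t i\<rfloor> + 1}}"
          using u i unfolding T_def by blast
        then show "of_int \<lceil>2 ^ N * t i\<rceil> - 1 < 2 ^ N * u i" "2 ^ N * u i < of_int \<lfloor>2 ^ N * t i\<rfloor> + 1"
          by simp_all
      qed
      then have "j < \<lfloor>2 ^ N * t i\<rfloor> + 1" "\<lceil>2 ^ N * t i\<rceil> - 1 < j + 1"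
        using j by linarith+
      then have "of_int j \<le> 2 ^ N * t i" "2 ^ N * t i \<le> of_int j + 1" by linarith+
      then show "\<exists>j::int. of_int j \<le> 2 ^ N * t i \<and> 2 ^ N * t i \<le> of_int j + 1 \<and>
         of_int j \<le> 2 ^ N * v i \<and> 2 ^ N * v i \<le> of_int j + 1"
        using j by blast
    qed
    then show "u \<in> core N" using t u unfolding core_def T_def by auto
  qed
  ultimately show "\<exists>T. openin (cube n) T \<and> t \<in> T \<and> T \<subseteq> core N" by blast
qed

lemma compactin_subset_core:
  assumes K: "compactin (cube n) K" "K \<subseteq> E"
  shows "\<exists>N. K \<subseteq> core N"
proof -
  have "K \<subseteq> \<Union> (range core)" using K(2) ex_core by blast
  then obtain F where F: "finite F" "F \<subseteq> range core" "K \<subseteq> \<Union> F"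
    using K(1) openin_core unfolding compactin_def by (metis (no_types, lifting) imageE)
  then obtain I where I: "finite I" "F = core ` I" by (meson finite_subset_image)
  have "core i \<subseteq> core (Max I)" if "i \<in> I" for i using that I by (intro core_mono) auto
  then show ?thesis using F(3) I(2) by blast
qed

lemma in_closed_cell_of: "t \<in> E \<Longrightarrow> t \<in> closed_cell n (cell_of t)"
  unfolding cell_of_def using E_subset by (intro closed_cell_self) auto

lemma closed_cell_of_subset: "t \<in> E \<Longrightarrow> closed_cell n (cell_of t) \<subseteq> E"
  using core_level[of t] dyadic_near_closed_cell
  by (auto simp: core_def cell_of_def closed_cell_def)

text \<open>Scales can only become finer towards the frontier of a cell. If \<open>u\<close> had a
  coarser scale, every cube of that scale through \<open>t\<close> would also contain
  \<open>u\<close>, so its points in the unit cube would lie in \<open>E\<close> and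
  \<open>t\<close> would already belong to that core.\<close>

lemma level_closed_cell:
  assumes "t \<in> E" "u \<in> closed_cell n (cell_of t)"
  shows "level t \<le> level u"
proof (rule ccontr)
  assume "\<not> level t \<le> level u"
  then have *: "level u \<le> level t" "level u < level t" by auto
  have "u \<in> core (level u)" using assms closed_cell_of_subset core_level by blast
  then have "t \<in> core (level u)"
    using dyadic_near_coarser[OF assms(2)[unfolded cell_of_def] *(1)] assms(1) E_subset
    by (auto simp: core_def)
  then show False using level_le *(2) by fastforce
qed

text \<open>Two points with the same code lie in each other's closed cells at that scale, so the
  comparison of levels works both ways. Thus the level is constant on an open cell, and the open
  cells partition \<open>E\<close>.\<close>

lemma cell_of_eqI:
  assumes t: "t \<in> E" and u: "u \<in> topspace (cube n)"
    and code: "dyadic_code n (level t) u = dyadic_code n (level t) t"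
  shows "cell_of u = cell_of t"
proof -
  have ut: "u \<in> closed_cell n (cell_of t)" and tu: "t \<in> closed_cell n (level t, dyadic_code n (level t) u)"
    using closed_cell_self[OF u, of "level t"] in_closed_cell_of[OF t] code by (simp_all add: cell_of_def)
  have "u \<in> core (level t)"
    using core_level[OF t] dyadic_near_coarser[OF tu order_refl] u by (auto simp: core_def)
  then have "level u = level t"
    using level_le level_closed_cell[OF t ut] by (simp add: le_antisym)
  then show ?thesis using code by (simp add: cell_of_def)
qed

text \<open>In a degenerate direction of \<open>t\<close> the scaled coordinate of \<open>u\<close>
  is an integer and stays one at the finer scale of \<open>u\<close>, so \<open>u\<close> gains no
  direction. If it kept all of them, its code at the scale of \<open>t\<close> would agree with that
  of \<open>t\<close> and the cells would coincide.\<close>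

lemma cell_dirs_closed_cell:
  assumes t: "t \<in> E" and u: "u \<in> closed_cell n (cell_of t)" and ne: "cell_of u \<noteq> cell_of t"
  shows "card (cell_dirs n (cell_of u)) < card (cell_dirs n (cell_of t))"
proof (rule psubset_card_mono)
  define N where "N = level t"
  have uc: "u \<in> topspace (cube n)"
    and bd: "\<And>i. i < n \<Longrightarrow> of_int \<lfloor>2 ^ N * t i\<rfloor> \<le> 2 ^ N * u i \<and> 2 ^ N * u i \<le> of_int \<lceil>2 ^ N * t i\<rceil>"
    using u by (auto simp: cell_of_def in_closed_cell_code N_def)
  have le: "N \<le> level u" unfolding N_def by (rule level_closed_cell[OF t u])
  have dirs_t: "i \<in> cell_dirs n (cell_of t) \<longleftrightarrow> i < n \<and> \<lfloor>2 ^ N * t i\<rfloor> \<noteq> \<lceil>2 ^ N * t i\<rceil>" for i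
    by (auto simp: cell_dirs_def cell_of_def dyadic_code_nth N_def)
  have dirs_u: "i < n \<and> \<lfloor>2 ^ N * u i\<rfloor> \<noteq> \<lceil>2 ^ N * u i\<rceil>" if i: "i \<in> cell_dirs n (cell_of u)" for i
  proof -
    have i: "i < n" "\<lfloor>2 ^ level u * u i\<rfloor> \<noteq> \<lceil>2 ^ level u * u i\<rceil>"
      using that by (auto simp: cell_dirs_def cell_of_def dyadic_code_nth)
    have pow: "(2::real) ^ level u = 2 ^ (level u - N) * 2 ^ N" using le by (simp flip: power_add)
    have "\<lfloor>2 ^ N * u i\<rfloor> \<noteq> \<lceil>2 ^ N * u i\<rceil>"
    proof
      assume eq: "\<lfloor>2 ^ N * u i\<rfloor> = \<lceil>2 ^ N * u i\<rceil>"
      then have "2 ^ N * u i = of_int \<lfloor>2 ^ N * u i\<rfloor>" by linarith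
      then have "2 ^ level u * u i = of_int (2 ^ (level u - N) * \<lfloor>2 ^ N * u i\<rfloor>)"
        by (metis pow mult.assoc of_int_mult of_int_power of_int_numeral)
      then show False using i(2) by (metis floor_of_int ceiling_of_int)
    qed
    then show ?thesis using i(1) by blast
  qed
  have same: "\<lfloor>2 ^ N * u i\<rfloor> = \<lfloor>2 ^ N * t i\<rfloor> \<and> \<lceil>2 ^ N * u i\<rceil> = \<lceil>2 ^ N * t i\<rceil>"
    if "i < n" "i \<notin> cell_dirs n (cell_of t) \<or> i \<in> cell_dirs n (cell_of u)" for i
  proof (cases "\<lfloor>2 ^ N * t i\<rfloor> = \<lceil>2 ^ N * t i\<rceil>")
    case True
    then have "2 ^ N * u i = of_int \<lfloor>2 ^ N * t i\<rfloor>" using bd[OF that(1)] by linarith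
    then show ?thesis using True by simp
  next
    case False
    then have "\<lfloor>2 ^ N * u i\<rfloor> \<noteq> \<lceil>2 ^ N * u i\<rceil>" using that dirs_t dirs_u by blast
    then show ?thesis using floor_ceiling_eq_of_between bd[OF that(1)] False by blast
  qed
  have sub: "cell_dirs n (cell_of u) \<subseteq> cell_dirs n (cell_of t)"
  proof
    fix i assume "i \<in> cell_dirs n (cell_of u)"
    then show "i \<in> cell_dirs n (cell_of t)"
      using same[of i] dirs_u[of i] dirs_t[of i] by auto
  qed
  show "cell_dirs n (cell_of u) \<subset> cell_dirs n (cell_of t)"
  proof (rule psubsetI[OF sub], rule notI)
    assume "cell_dirs n (cell_of u) = cell_dirs n (cell_of t)"
    then have "dyadic_code n N u = dyadic_code n N t"
      using same unfolding dyadic_code_def by (intro map_cong) auto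
    then show False using cell_of_eqI[OF t uc] ne by (simp add: N_def)
  qed
qed (simp add: cell_dirs_def)

lemma finite_cells_level: "finite (cell_of ` {t \<in> E. level t \<le> N})"
proof (rule finite_subset)
  let ?R = "\<lambda>M. {0..2 ^ M} \<times> {0..2 ^ M} :: (int \<times> int) set"
  show "cell_of ` {t \<in> E. level t \<le> N} \<subseteq> (\<Union>M\<le>N. {M} \<times> {c. set c \<subseteq> ?R M \<and> length c = n})"
  proof
    fix c assume "c \<in> cell_of ` {t \<in> E. level t \<le> N}"
    then obtain t where t: "t \<in> E" "level t \<le> N" and c: "c = cell_of t" by blast
    have "(\<lfloor>2 ^ M * t i\<rfloor>, \<lceil>2 ^ M * t i\<rceil>) \<in> ?R M" if "i < n" for i M
    proof -
      have "0 \<le> t i" "t i \<le> 1" using t that E_subset by (auto simp: topspace_cube PiE_iff)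
      then have "0 \<le> 2 ^ M * t i" "2 ^ M * t i \<le> of_int (2 ^ M)" by simp_all
      then show ?thesis
        using floor_mono[of "2 ^ M * t i" "of_int (2 ^ M)"] ceiling_mono[of 0 "2 ^ M * t i"]
        by (simp add: ceiling_le_iff)
    qed
    then show "c \<in> (\<Union>M\<le>N. {M} \<times> {c. set c \<subseteq> ?R M \<and> length c = n})"
      using t c by (auto simp: cell_of_def dyadic_code_def)
  qed
qed (auto intro!: finite_lists_length_eq)

text \<open>Levels do not drop on a closed cell, so a cell meeting \<open>core N\<close> has level
  at most \<open>N\<close>. Since the cores are open and cover \<open>E\<close>, the closed cells
  form a locally finite family in \<open>E\<close>.\<close>

lemma finite_cells_meeting_core:
  "finite {c \<in> cell_of ` E. closed_cell n c \<inter> core N \<noteq> {}}"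
proof (rule finite_subset[OF _ finite_cells_level[of N]], rule subsetI)
  fix c assume "c \<in> {c \<in> cell_of ` E. closed_cell n c \<inter> core N \<noteq> {}}"
  then obtain t u where c: "c = cell_of t" and t: "t \<in> E"
    and u: "u \<in> closed_cell n (cell_of t)" "u \<in> core N" by blast
  have "level t \<le> N" using level_closed_cell[OF t u(1)] level_le[OF u(2)] by linarith
  then show "c \<in> cell_of ` {t \<in> E. level t \<le> N}" using c t by blast
qed

end

section \<open>Parametrising the product of a cell with the interval\<close>

text \<open>Numbering starts at 1 because coordinate 0 of the box is the time.\<close>

definition cell_enum :: "nat \<Rightarrow> dyadic_cell \<Rightarrow> nat \<Rightarrow> nat" where
  "cell_enum n c = (SOME e. bij_betw e {1..card (cell_dirs n c)} (cell_dirs n c))"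

definition cell_index :: "nat \<Rightarrow> dyadic_cell \<Rightarrow> nat \<Rightarrow> nat" where
  "cell_index n c = the_inv_into {1..card (cell_dirs n c)} (cell_enum n c)"

definition cell_to_box :: "nat \<Rightarrow> dyadic_cell \<Rightarrow> (nat \<Rightarrow> real) \<times> real \<Rightarrow> nat \<Rightarrow> real" where
  "cell_to_box n c = (\<lambda>(t, s). \<lambda>j\<in>{..card (cell_dirs n c)}. if j = 0 then 2 * s - 1
     else 2 * (2 ^ fst c * t (cell_enum n c j) - of_int (fst (snd c ! cell_enum n c j))) - 1)"

text \<open>Degenerate directions are filled in with the common value of floor and ceiling.\<close>

definition box_to_cell :: "nat \<Rightarrow> dyadic_cell \<Rightarrow> (nat \<Rightarrow> real) \<Rightarrow> (nat \<Rightarrow> real) \<times> real" where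
  "box_to_cell n c z = ((\<lambda>i\<in>{..<n}. (of_int (fst (snd c ! i)) +
     (if i \<in> cell_dirs n c then (z (cell_index n c i) + 1) / 2 else 0)) / 2 ^ fst c), (z 0 + 1) / 2)"

lemma cell_enum_bij: "bij_betw (cell_enum n c) {1..card (cell_dirs n c)} (cell_dirs n c)"
  unfolding cell_enum_def
  by (rule someI_ex[OF ex_bij_betw_nat_finite_1]) (simp add: cell_dirs_def)

lemma cell_enum_in: "\<lbrakk>j \<le> card (cell_dirs n c); j \<noteq> 0\<rbrakk> \<Longrightarrow> cell_enum n c j \<in> cell_dirs n c"
  using cell_enum_bij[of n c] by (auto simp: bij_betw_def)

lemma cell_index_enum: "\<lbrakk>j \<le> card (cell_dirs n c); j \<noteq> 0\<rbrakk> \<Longrightarrow> cell_index n c (cell_enum n c j) = j"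
  unfolding cell_index_def
  using cell_enum_bij[of n c] by (intro the_inv_into_f_f) (auto simp: bij_betw_def)

lemma cell_index_in:
  assumes "i \<in> cell_dirs n c"
  shows "cell_index n c i \<le> card (cell_dirs n c)" "cell_index n c i \<noteq> 0"
    "cell_enum n c (cell_index n c i) = i"
proof -
  have "i \<in> cell_enum n c ` {1..card (cell_dirs n c)}"
    unfolding bij_betw_imp_surj_on[OF cell_enum_bij] by (rule assms)
  then obtain j where j: "j \<in> {1..card (cell_dirs n c)}" "i = cell_enum n c j" by blast
  then show "cell_index n c i \<le> card (cell_dirs n c)" "cell_index n c i \<noteq> 0"
    "cell_enum n c (cell_index n c i) = i"
    using cell_index_enum[of j n c] by auto
qed

context
  fixes n :: nat and c :: dyadic_cell and t0 :: "nat \<Rightarrow> real"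
  assumes t0: "t0 \<in> topspace (cube n)"
    and c: "c = (fst c, dyadic_code n (fst c) t0)"
begin

lemma cell_lo_hi:
  assumes "i < n"
  shows "fst (snd c ! i) = \<lfloor>2 ^ fst c * t0 i\<rfloor>" "snd (snd c ! i) = \<lceil>2 ^ fst c * t0 i\<rceil>"
proof -
  have "snd c ! i = (\<lfloor>2 ^ fst c * t0 i\<rfloor>, \<lceil>2 ^ fst c * t0 i\<rceil>)"
    using dyadic_code_nth[OF assms] c by (metis snd_conv)
  then show "fst (snd c ! i) = \<lfloor>2 ^ fst c * t0 i\<rfloor>" "snd (snd c ! i) = \<lceil>2 ^ fst c * t0 i\<rceil>" by simp_all
qed

lemma cell_hi:
  assumes "i < n"
  shows "snd (snd c ! i) = fst (snd c ! i) + (if i \<in> cell_dirs n c then 1 else 0)"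
  using assms cell_lo_hi[OF assms] unfolding cell_dirs_def by simp linarith

lemma cell_bounds:
  assumes "i < n"
  shows "0 \<le> fst (snd c ! i)" "real_of_int (snd (snd c ! i)) \<le> 2 ^ fst c"
proof -
  have "0 \<le> t0 i" "t0 i \<le> 1" using t0 assms by (auto simp: topspace_cube PiE_iff)
  then have "0 \<le> 2 ^ fst c * t0 i" "2 ^ fst c * t0 i \<le> of_int (2 ^ fst c)" by simp_all
  then have "0 \<le> \<lfloor>2 ^ fst c * t0 i\<rfloor>" "\<lceil>2 ^ fst c * t0 i\<rceil> \<le> 2 ^ fst c"
    by (simp_all only: ceiling_le_iff zero_le_floor)
  then show "0 \<le> fst (snd c ! i)" "real_of_int (snd (snd c ! i)) \<le> 2 ^ fst c"
    using of_int_le_iff[of "\<lceil>2 ^ fst c * t0 i\<rceil>" "2 ^ fst c", where ?'a = real]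
    unfolding cell_lo_hi[OF assms] by simp_all
qed

lemma box_to_cell_in:
  assumes z: "z \<in> topspace (box_top (card (cell_dirs n c)))"
  shows "fst (box_to_cell n c z) \<in> closed_cell n c" "snd (box_to_cell n c z) \<in> {0..1}"
proof -
  have zj: "-1 \<le> z j" "z j \<le> 1" if "j \<le> card (cell_dirs n c)" for j
    using z that by (auto simp: topspace_box_top PiE_iff)
  show "snd (box_to_cell n c z) \<in> {0..1}"
    using zj[of 0] by (simp add: box_to_cell_def)
  let ?u = "fst (box_to_cell n c z)"
  have u: "2 ^ fst c * ?u i = of_int (fst (snd c ! i)) +
      (if i \<in> cell_dirs n c then (z (cell_index n c i) + 1) / 2 else 0)" if "i < n" for i
    using that by (simp add: box_to_cell_def)
  have bd: "of_int (fst (snd c ! i)) \<le> 2 ^ fst c * ?u i" "2 ^ fst c * ?u i \<le> of_int (snd (snd c ! i))"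
    if "i < n" for i
    unfolding u[OF that] cell_hi[OF that] using zj[of "cell_index n c i"] cell_index_in(1)[of i n c] by auto
  have "0 \<le> ?u i" "?u i \<le> 1" if "i < n" for i
  proof -
    have "0 \<le> 2 ^ fst c * ?u i" "2 ^ fst c * ?u i \<le> 2 ^ fst c * 1"
      using bd[OF that] cell_bounds[OF that] by linarith+
    then show "0 \<le> ?u i" "?u i \<le> 1"
      using mult_le_cancel_left_pos[of "2 ^ fst c" 0 "?u i"] by simp_all
  qed
  then have "?u \<in> topspace (cube n)"
    by (auto simp: topspace_cube PiE_iff box_to_cell_def)
  then show "?u \<in> closed_cell n c" using bd by (simp add: closed_cell_def)
qed

lemma continuous_map_box_to_cell:
  "continuous_map (box_top (card (cell_dirs n c))) (prod_topology (cube n) (top_of_set {0..1})) (box_to_cell n c)"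
proof -
  let ?B = "box_top (card (cell_dirs n c))"
  have 1: "continuous_map ?B euclideanreal (\<lambda>z. (of_int (fst (snd c ! i)) +
     (if i \<in> cell_dirs n c then (z (cell_index n c i) + 1) / 2 else 0)) / 2 ^ fst c)" for i
    using cell_index_in(1)[of i n c]
    by (cases "i \<in> cell_dirs n c") (auto intro!: continuous_intros continuous_map_box_coord)
  have 2: "continuous_map ?B euclideanreal (\<lambda>z. (z 0 + 1) / 2)"
    by (auto intro!: continuous_intros continuous_map_box_coord)
  have "continuous_map ?B (product_topology (\<lambda>_. euclideanreal) {..<n}) (\<lambda>z. fst (box_to_cell n c z))"
    using 1 by (auto simp: continuous_map_componentwise box_to_cell_def)
  moreover have "fst (box_to_cell n c z) \<in> PiE {..<n} (\<lambda>_. {0..1})" if "z \<in> topspace ?B" for z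
    using box_to_cell_in(1)[OF that] by (auto simp: closed_cell_def topspace_cube)
  ultimately have "continuous_map ?B (cube n) (\<lambda>z. fst (box_to_cell n c z))"
    by (auto simp: cube_def continuous_map_componentwise continuous_map_in_subtopology PiE_iff)
  moreover have "continuous_map ?B (top_of_set {0..1}) (\<lambda>z. snd (box_to_cell n c z))"
    using 2 box_to_cell_in(2) by (auto simp: continuous_map_in_subtopology box_to_cell_def)
  ultimately show ?thesis by (simp add: continuous_map_pairwise o_def)
qed

lemma cell_to_box_in:
  assumes u: "u \<in> closed_cell n c" and s: "s \<in> {0..1}"
  shows "cell_to_box n c (u, s) \<in> topspace (box_top (card (cell_dirs n c)))"
proof -
  have "-1 \<le> cell_to_box n c (u, s) j \<and> cell_to_box n c (u, s) j \<le> 1" if j: "j \<le> card (cell_dirs n c)" for j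
  proof (cases "j = 0")
    case True
    then show ?thesis using s by (simp add: cell_to_box_def)
  next
    case False
    have i: "cell_enum n c j \<in> cell_dirs n c" "cell_enum n c j < n"
      using cell_enum_in[OF j False] by (auto simp: cell_dirs_def)
    have "of_int (fst (snd c ! cell_enum n c j)) \<le> 2 ^ fst c * u (cell_enum n c j)"
      "2 ^ fst c * u (cell_enum n c j) \<le> of_int (fst (snd c ! cell_enum n c j)) + 1"
      using u i cell_hi[OF i(2)] by (auto simp: closed_cell_def)
    then show ?thesis using False j by (simp add: cell_to_box_def)
  qed
  then show ?thesis by (auto simp: topspace_box_top PiE_iff cell_to_box_def)
qed

lemma continuous_map_cell_to_box:
  "continuous_map (subtopology (prod_topology (cube n) (top_of_set {0..1})) (closed_cell n c \<times> {0..1}))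
     (box_top (card (cell_dirs n c))) (cell_to_box n c)"
proof -
  let ?P = "prod_topology (cube n) (top_of_set {0..1::real})"
  let ?X = "subtopology ?P (closed_cell n c \<times> {0..1})"
  have coord: "continuous_map ?X euclideanreal (\<lambda>w. fst w i)" if "i < n" for i
    using continuous_map_compose[OF continuous_map_fst continuous_map_cube_coord[OF that], of "top_of_set {0..1::real}"]
    by (intro continuous_map_from_subtopology) (simp add: o_def)
  have time: "continuous_map ?X euclideanreal snd"
    using continuous_map_snd[of "cube n" "top_of_set {0..1::real}"]
    by (intro continuous_map_from_subtopology) (simp add: continuous_map_in_subtopology)
  have "continuous_map ?X euclideanreal (\<lambda>w. cell_to_box n c w j)" if j: "j \<le> card (cell_dirs n c)" for j
  proof (cases "j = 0")
    case True
    then show ?thesis using time by (auto simp: cell_to_box_def case_prod_unfold intro!: continuous_intros)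
  next
    case False
    then have "cell_enum n c j < n" using cell_enum_in[OF j] by (auto simp: cell_dirs_def)
    then show ?thesis using False j coord
      by (auto simp: cell_to_box_def case_prod_unfold intro!: continuous_intros)
  qed
  moreover have "cell_to_box n c w \<in> topspace (box_top (card (cell_dirs n c)))" if "w \<in> topspace ?X" for w
    using that cell_to_box_in by auto
  ultimately show ?thesis
    by (auto simp: box_top_def continuous_map_componentwise continuous_map_in_subtopology PiE_iff)
qed

lemma box_to_cell_to_box:
  assumes u: "u \<in> closed_cell n c"
  shows "box_to_cell n c (cell_to_box n c (u, s)) = (u, s)"
proof -
  have "fst (box_to_cell n c (cell_to_box n c (u, s))) i = u i" for i
  proof (cases "i < n")
    case i: True
    show ?thesis
    proof (cases "i \<in> cell_dirs n c")
      case True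
      then show ?thesis using i cell_index_in[OF True]
        by (simp add: box_to_cell_def cell_to_box_def field_simps)
    next
      case False
      then have "2 ^ fst c * u i = of_int (fst (snd c ! i))"
        using u i cell_hi[OF i] by (auto simp: closed_cell_def)
      then show ?thesis using i False by (simp add: box_to_cell_def field_simps)
    qed
  next
    case False
    then show ?thesis using u
      by (auto simp: box_to_cell_def closed_cell_def topspace_cube PiE_iff extensional_def)
  qed
  moreover have "snd (box_to_cell n c (cell_to_box n c (u, s))) = s"
    by (simp add: box_to_cell_def cell_to_box_def)
  ultimately show ?thesis by (simp add: prod_eq_iff fun_eq_iff)
qed

text \<open>A point of the closed cell with another code has an integer coordinate in some
  nondegenerate direction, that is, at an end of a unit interval. Conversely, by
  \<open>box_to_cell_boundary\<close>, apart from the two ends in time the boundary lies over points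
  with another code.\<close>

lemma cell_to_box_boundary:
  assumes u: "u \<in> closed_cell n c" and s: "s \<in> {0..1}"
    and bd: "s = 0 \<or> s = 1 \<or> dyadic_code n (fst c) u \<noteq> snd c"
  shows "cell_to_box n c (u, s) \<in> box_boundary (card (cell_dirs n c))"
proof -
  have "\<exists>j\<le>card (cell_dirs n c). \<bar>cell_to_box n c (u, s) j\<bar> = 1"
  proof (cases "s = 0 \<or> s = 1")
    case True
    then show ?thesis by (intro exI[of _ 0]) (auto simp: cell_to_box_def)
  next
    case False
    then have ne: "dyadic_code n (fst c) u \<noteq> dyadic_code n (fst c) t0" using bd c by (metis snd_conv)
    then obtain i where i: "i < n" and ne': "\<not> (\<lfloor>2 ^ fst c * u i\<rfloor> = \<lfloor>2 ^ fst c * t0 i\<rfloor> \<and> \<lceil>2 ^ fst c * u i\<rceil> = \<lceil>2 ^ fst c * t0 i\<rceil>)"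
      unfolding dyadic_code_def by auto
    have b: "of_int \<lfloor>2 ^ fst c * t0 i\<rfloor> \<le> 2 ^ fst c * u i" "2 ^ fst c * u i \<le> of_int \<lceil>2 ^ fst c * t0 i\<rceil>"
      using u i cell_lo_hi[OF i] by (auto simp: closed_cell_def)
    have dir: "i \<in> cell_dirs n c"
    proof (rule ccontr)
      assume "i \<notin> cell_dirs n c"
      then have eq: "\<lfloor>2 ^ fst c * t0 i\<rfloor> = \<lceil>2 ^ fst c * t0 i\<rceil>"
        using i cell_lo_hi[OF i] by (simp add: cell_dirs_def)
      then have "2 ^ fst c * u i = of_int \<lfloor>2 ^ fst c * t0 i\<rfloor>" using b by linarith
      then show False using ne' eq by simp
    qed
    then have "\<lfloor>2 ^ fst c * t0 i\<rfloor> \<noteq> \<lceil>2 ^ fst c * t0 i\<rceil>"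
      using cell_lo_hi[OF i] by (simp add: cell_dirs_def)
    then have "\<lfloor>2 ^ fst c * u i\<rfloor> = \<lceil>2 ^ fst c * u i\<rceil>"
      using floor_ceiling_eq_of_between[OF b] ne' by blast
    then obtain w :: int where w: "2 ^ fst c * u i = of_int w"
      by (metis floor_correct le_of_int_ceiling order_antisym)
    have hi: "\<lceil>2 ^ fst c * t0 i\<rceil> = \<lfloor>2 ^ fst c * t0 i\<rfloor> + 1"
      using cell_hi[OF i] dir unfolding cell_lo_hi[OF i] by simp
    have "\<lfloor>2 ^ fst c * t0 i\<rfloor> \<le> w" "w \<le> \<lfloor>2 ^ fst c * t0 i\<rfloor> + 1"
      using b unfolding w hi of_int_le_iff by simp_all
    then have "w = \<lfloor>2 ^ fst c * t0 i\<rfloor> \<or> w = \<lfloor>2 ^ fst c * t0 i\<rfloor> + 1" by linarith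
    then have "2 ^ fst c * u i = of_int (fst (snd c ! i)) \<or> 2 ^ fst c * u i = of_int (fst (snd c ! i)) + 1"
      unfolding w cell_lo_hi[OF i] by auto
    then have "\<bar>cell_to_box n c (u, s) (cell_index n c i)\<bar> = 1"
      using cell_index_in[OF dir] by (auto simp: cell_to_box_def)
    then show ?thesis using cell_index_in(1)[OF dir] by blast
  qed
  then show ?thesis using cell_to_box_in[OF u s] by (simp add: box_boundary_def)
qed

lemma box_to_cell_boundary:
  assumes z: "z \<in> box_boundary (card (cell_dirs n c))"
  shows "z 0 = 1 \<or> z 0 = -1 \<or> dyadic_code n (fst c) (fst (box_to_cell n c z)) \<noteq> snd c"
proof -
  obtain j where j: "j \<le> card (cell_dirs n c)" "\<bar>z j\<bar> = 1" using z by (auto simp: box_boundary_def)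
  show ?thesis
  proof (cases "j = 0")
    case True
    then show ?thesis using j by auto
  next
    case False
    let ?i = "cell_enum n c j"
    have i: "?i \<in> cell_dirs n c" "?i < n" using cell_enum_in[OF j(1) False] by (auto simp: cell_dirs_def)
    have "2 ^ fst c * fst (box_to_cell n c z) ?i = of_int (fst (snd c ! ?i)) + (z j + 1) / 2"
      using i cell_index_enum[OF j(1) False] by (simp add: box_to_cell_def)
    moreover have "z j = 1 \<or> z j = -1" using j(2) by linarith
    ultimately have "2 ^ fst c * fst (box_to_cell n c z) ?i = of_int (fst (snd c ! ?i) + 1) \<or>
        2 ^ fst c * fst (box_to_cell n c z) ?i = of_int (fst (snd c ! ?i))" by auto
    then have "\<lfloor>2 ^ fst c * fst (box_to_cell n c z) ?i\<rfloor> = \<lceil>2 ^ fst c * fst (box_to_cell n c z) ?i\<rceil>"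
      by (metis floor_of_int ceiling_of_int)
    then have "dyadic_code n (fst c) (fst (box_to_cell n c z)) ! ?i \<noteq> snd c ! ?i"
      using i(1) unfolding cell_dirs_def dyadic_code_nth[OF i(2)] by (metis (mono_tags) fst_conv snd_conv mem_Collect_eq)
    then show ?thesis by metis
  qed
qed

end

lemma box_to_cell_time: "snd (box_to_cell n c z) = (z 0 + 1) / 2"
  by (simp add: box_to_cell_def)

section \<open>Contracting null sequences of maps on cubes\<close>

locale null_sequence =
  fixes n :: nat and A :: "'b topology" and a :: 'b and g :: "nat \<Rightarrow> (nat \<Rightarrow> real) \<Rightarrow> 'b"
  assumes t1: "t1_space A" and aA: "a \<in> topspace A"
    and gcont: "\<And>m. continuous_map (cube n) A (g m)"
    and gconv: "maps_converge (cube n) A g a"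
begin

abbreviation cyl :: "((nat \<Rightarrow> real) \<times> real) topology" where
  "cyl \<equiv> prod_topology (cube n) (top_of_set {0..1})"

text \<open>No closure is taken: the set is open because points of \<open>A\<close> are closed, and
  the homotopy must not move anything outside it.\<close>

definition supp :: "nat \<Rightarrow> (nat \<Rightarrow> real) set" where
  "supp m = {t \<in> topspace (cube n). g m t \<noteq> a}"

lemma open_in_cube_supp: "open_in_cube n (supp m)"
proof
  have "openin A (topspace A - {a})"
    using t1 aA by (simp add: t1_space_closedin_singleton openin_diff)
  then have "openin (cube n) {t \<in> topspace (cube n). g m t \<in> topspace A - {a}}"
    using gcont openin_continuous_map_preimage by blast
  moreover have "{t \<in> topspace (cube n). g m t \<in> topspace A - {a}} = supp m"
    using continuous_map_funspace[OF gcont[of m]] by (auto simp: supp_def)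
  ultimately show "openin (cube n) (supp m)" by simp
qed

sublocale C: open_in_cube n "supp m" for m
  by (rule open_in_cube_supp)

definition cells :: "nat \<Rightarrow> dyadic_cell set" where
  "cells m = C.cell_of m ` supp m"

abbreviation cdim :: "dyadic_cell \<Rightarrow> nat" where
  "cdim c \<equiv> card (cell_dirs n c)"

lemma cell_of_in_cells: "t \<in> supp m \<Longrightarrow> C.cell_of m t \<in> cells m"
  by (simp add: cells_def)

lemma cell_subset_supp: "c \<in> cells m \<Longrightarrow> closed_cell n c \<subseteq> supp m"
  using C.closed_cell_of_subset by (auto simp: cells_def)

lemma cells_code:
  assumes "c \<in> cells m"
  obtains t0 where "t0 \<in> topspace (cube n)" "c = (fst c, dyadic_code n (fst c) t0)"
    "t0 \<in> supp m" "c = C.cell_of m t0"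
proof -
  obtain t where t: "t \<in> supp m" "c = C.cell_of m t" using assms unfolding cells_def by blast
  show thesis
    by (rule that[of t]) (use t C.E_subset[of m] in \<open>auto simp: C.cell_of_def\<close>)
qed

lemma cdim_less:
  assumes "c \<in> cells m" "u \<in> closed_cell n c"
  shows "C.cell_of m u = c \<or> cdim (C.cell_of m u) < cdim c"
  using assms C.cell_dirs_closed_cell by (auto simp: cells_def)

lemma cell_of_eq_code:
  assumes "c \<in> cells m" "u \<in> closed_cell n c" "dyadic_code n (fst c) u = snd c"
  shows "C.cell_of m u = c"
  using assms C.cell_of_eqI[of _ m u]
  by (auto simp: cells_def C.cell_of_def closed_cell_def)

lemma code_ne_cdim_less:
  assumes c: "c \<in> cells m" and u: "u \<in> closed_cell n c" and "dyadic_code n (fst c) u \<noteq> snd c"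
  shows "cdim (C.cell_of m u) < cdim c"
proof -
  have "C.cell_of m u \<noteq> c"
  proof
    assume "C.cell_of m u = c"
    then have "dyadic_code n (fst c) u = snd c" by (auto simp: C.cell_of_def)
    then show False using assms(3) by simp
  qed
  then show ?thesis using cdim_less[OF c u] by blast
qed

lemma finite_cells_meeting_compact:
  assumes "compactin (cube n) K" "K \<subseteq> supp m"
  shows "finite {c \<in> cells m. closed_cell n c \<inter> K \<noteq> {}}"
proof -
  obtain N where "K \<subseteq> C.core m N" using C.compactin_subset_core[OF assms] by blast
  then have "{c \<in> cells m. closed_cell n c \<inter> K \<noteq> {}} \<subseteq>
      {c \<in> C.cell_of m ` supp m. closed_cell n c \<inter> C.core m N \<noteq> {}}" by (auto simp: cells_def)
  then show ?thesis using C.finite_cells_meeting_core finite_subset by blast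
qed

lemma finite_cells_meeting_cell:
  "c' \<in> cells m \<Longrightarrow> finite {c \<in> cells m. closed_cell n c \<inter> closed_cell n c' \<noteq> {}}"
  using finite_cells_meeting_compact[OF compactin_closed_cell] cell_subset_supp by blast

text \<open>For each \<open>m\<close> the part of the cube that \<open>g m\<close> sends outside
  \<open>U\<close> is compact in \<open>supp m\<close>, so it meets finitely many cells, and for
  almost all \<open>m\<close> it is empty. Thus the restrictions of all \<open>g m\<close> to all
  their cells form one null sequence.\<close>

lemma finite_cells_outside:
  assumes U: "openin A U" "a \<in> U"
  shows "finite {(m, c). c \<in> cells m \<and> \<not> g m ` closed_cell n c \<subseteq> U}"
proof -
  define K where "K m = {t \<in> topspace (cube n). g m t \<in> topspace A - U}" for m
  have "closedin (cube n) (K m)" for m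
    unfolding K_def by (rule closedin_continuous_map_preimage[OF gcont]) (use U in blast)
  then have "compactin (cube n) (K m)" for m
    using closedin_compact_space compact_space_cube by blast
  moreover have "K m \<subseteq> supp m" for m using U by (auto simp: K_def supp_def)
  ultimately have fin: "finite {c \<in> cells m. closed_cell n c \<inter> K m \<noteq> {}}" for m
    by (rule finite_cells_meeting_compact)
  have "finite {m. \<not> g m ` topspace (cube n) \<subseteq> U}"
    using gconv U unfolding maps_converge_iff_finite by blast
  then have "finite (SIGMA m:{m. \<not> g m ` topspace (cube n) \<subseteq> U}. {c \<in> cells m. closed_cell n c \<inter> K m \<noteq> {}})"
    using fin by (rule finite_SigmaI)
  moreover have "{(m, c). c \<in> cells m \<and> \<not> g m ` closed_cell n c \<subseteq> U} \<subseteq>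
      (SIGMA m:{m. \<not> g m ` topspace (cube n) \<subseteq> U}. {c \<in> cells m. closed_cell n c \<inter> K m \<noteq> {}})"
  proof
    fix p assume "p \<in> {(m, c). c \<in> cells m \<and> \<not> g m ` closed_cell n c \<subseteq> U}"
    then obtain m c where p: "p = (m, c)" and c: "c \<in> cells m" and "\<not> g m ` closed_cell n c \<subseteq> U"
      by blast
    then obtain t where t: "t \<in> closed_cell n c" "g m t \<notin> U" by blast
    have tc: "t \<in> topspace (cube n)" using t by (simp add: closed_cell_def)
    then have "g m t \<in> topspace A" using continuous_map_funspace[OF gcont[of m]] by blast
    then have "t \<in> K m" using t tc by (simp add: K_def)
    then show "p \<in> (SIGMA m:{m. \<not> g m ` topspace (cube n) \<subseteq> U}. {c \<in> cells m. closed_cell n c \<inter> K m \<noteq> {}})"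
      using p c t tc by blast
  qed
  ultimately show ?thesis by (rule rev_finite_subset)
qed

text \<open>A homotopy to the constant map that is already continuous on the cells of dimension below
  \<open>k\<close>; on the other cells only its values at the two ends matter.\<close>

definition skeleton_homotopy :: "nat \<Rightarrow> (nat \<Rightarrow> (nat \<Rightarrow> real) \<times> real \<Rightarrow> 'b) \<Rightarrow> bool" where
  "skeleton_homotopy k h \<longleftrightarrow>
     (\<forall>m. \<forall>t\<in>topspace (cube n). h m (t, 0) = g m t \<and> h m (t, 1) = a \<and>
        (g m t = a \<longrightarrow> (\<forall>s\<in>{0..1}. h m (t, s) = a))) \<and>
     (\<forall>m. \<forall>c\<in>cells m. cdim c < k \<longrightarrow>
        continuous_map (subtopology cyl (closed_cell n c \<times> {0..1})) A (h m)) \<and>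
     (\<forall>U. openin A U \<and> a \<in> U \<longrightarrow>
        finite {(m, c). c \<in> cells m \<and> cdim c < k \<and> \<not> h m ` (closed_cell n c \<times> {0..1}) \<subseteq> U})"

text \<open>The jump right after time 0 is harmless: no cell has negative dimension, so only the
  values at the ends and stationarity are demanded.\<close>

lemma skeleton_homotopy_zero: "skeleton_homotopy 0 (\<lambda>m (t, s). if s = 0 then g m t else a)"
  by (auto simp: skeleton_homotopy_def)

text \<open>The boundary is covered by closed pieces: the top face, the bottom face, and the parts
  over the lower-dimensional closed cells that meet \<open>c\<close>. On each of them continuity is
  known, and there are finitely many because the closed cell is compact inside
  \<open>supp m\<close>.\<close>

lemma continuous_map_cell_boundary:
  assumes h: "skeleton_homotopy k h" and c: "c \<in> cells m" "cdim c = k"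
  shows "continuous_map (subtopology (box_top k) (box_boundary k)) A (\<lambda>z. h m (box_to_cell n c z))"
proof -
  let ?B = "subtopology (box_top k) (box_boundary k)"
  obtain t0 where t0: "t0 \<in> topspace (cube n)" "c = (fst c, dyadic_code n (fst c) t0)"
    using cells_code[OF c(1)] by blast
  have b2c: "continuous_map ?B cyl (box_to_cell n c)"
    using continuous_map_box_to_cell[OF t0] c(2) by (simp add: continuous_map_from_subtopology)
  have topB: "topspace ?B = box_boundary k" by (auto simp: box_boundary_def)
  have bin: "fst (box_to_cell n c z) \<in> closed_cell n c" "snd (box_to_cell n c z) \<in> {0..1}"
    if "z \<in> box_boundary k" for z
    using box_to_cell_in[OF t0, of z] that c(2) by (auto simp: box_boundary_def)
  have z0: "continuous_map ?B euclideanreal (\<lambda>z. z 0)"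
    by (simp add: continuous_map_from_subtopology continuous_map_box_coord)
  \<comment> \<open>These cells need not be faces of \<open>c\<close>: where the scale becomes
    finer, a face of \<open>c\<close> is subdivided.\<close>
  define L where "L = {c' \<in> cells m. cdim c' < k \<and> closed_cell n c' \<inter> closed_cell n c \<noteq> {}}"
  define T where "T c' = {z \<in> box_boundary k. box_to_cell n c z \<in> closed_cell n c' \<times> {0..1}}" for c'
  let ?T1 = "{z \<in> box_boundary k. z 0 = 1}" and ?T0 = "{z \<in> box_boundary k. z 0 = -1}"
  have L: "finite L"
    by (rule finite_subset[OF _ finite_cells_meeting_cell[OF c(1)]]) (auto simp: L_def)
  have vals: "h m (t, 0) = g m t" "h m (t, 1) = a" if "t \<in> closed_cell n c" for t
    using h that unfolding skeleton_homotopy_def closed_cell_def by auto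
  show ?thesis
  proof (rule pasting_lemma_closed[where I = "{?T1, ?T0} \<union> T ` L" and T = id and f = "\<lambda>_ z. h m (box_to_cell n c z)"])
    show "finite ({?T1, ?T0} \<union> T ` L)" using L by simp
  next
    fix S assume S: "S \<in> {?T1, ?T0} \<union> T ` L"
    then consider "S = ?T1" | "S = ?T0" | c' where "c' \<in> L" "S = T c'" by blast
    then show "closedin ?B (id S)"
    proof cases
      case 1
      have "closedin ?B {z \<in> topspace ?B. z 0 \<in> {1}}"
        by (rule closedin_continuous_map_preimage[OF z0]) simp
      then show ?thesis unfolding topB by (simp add: 1)
    next
      case 2
      have "closedin ?B {z \<in> topspace ?B. z 0 \<in> {-1}}"
        by (rule closedin_continuous_map_preimage[OF z0]) simp
      then show ?thesis unfolding topB by (simp add: 2)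
    next
      case 3
      have "closedin cyl (closed_cell n c' \<times> {0..1})"
        by (simp add: closedin_prod_Times_iff closedin_closed_cell)
      then have "closedin ?B {z \<in> topspace ?B. box_to_cell n c z \<in> closed_cell n c' \<times> {0..1}}"
        by (rule closedin_continuous_map_preimage[OF b2c])
      then show ?thesis unfolding topB by (simp add: 3 T_def)
    qed
    from S consider "S = ?T1" | "S = ?T0" | c' where "c' \<in> L" "S = T c'" by blast
    then show "continuous_map (subtopology ?B (id S)) A (\<lambda>z. h m (box_to_cell n c z))"
    proof cases
      case 1
      have "continuous_map (subtopology ?B ?T1) A (\<lambda>_. a)" using aA by simp
      then show ?thesis unfolding 1 id_def
      proof (rule continuous_map_eq)
        fix z assume "z \<in> topspace (subtopology ?B ?T1)"
        then have z: "z \<in> box_boundary k" "z 0 = 1" by auto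
        then have "box_to_cell n c z = (fst (box_to_cell n c z), 1)"
          by (simp add: prod_eq_iff box_to_cell_time)
        then show "a = h m (box_to_cell n c z)" using vals(2) bin(1)[OF z(1)] by metis
      qed
    next
      case 2
      have "continuous_map ?B (cube n) (fst \<circ> box_to_cell n c)"
        by (rule continuous_map_compose[OF b2c continuous_map_fst])
      then have "continuous_map ?B A (g m \<circ> (fst \<circ> box_to_cell n c))"
        using gcont by (rule continuous_map_compose)
      then have "continuous_map (subtopology ?B ?T0) A (g m \<circ> (fst \<circ> box_to_cell n c))"
        by (rule continuous_map_from_subtopology)
      then show ?thesis unfolding 2 id_def
      proof (rule continuous_map_eq)
        fix z assume "z \<in> topspace (subtopology ?B ?T0)"
        then have z: "z \<in> box_boundary k" "z 0 = -1" by auto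
        then have "box_to_cell n c z = (fst (box_to_cell n c z), 0)"
          by (simp add: prod_eq_iff box_to_cell_time)
        then show "(g m \<circ> (fst \<circ> box_to_cell n c)) z = h m (box_to_cell n c z)"
          using vals(1) bin(1)[OF z(1)] by (metis comp_apply)
      qed
    next
      case 3
      have hc: "continuous_map (subtopology cyl (closed_cell n c' \<times> {0..1})) A (h m)"
        using h 3(1) unfolding skeleton_homotopy_def L_def by blast
      have "continuous_map (subtopology ?B (T c')) (subtopology cyl (closed_cell n c' \<times> {0..1})) (box_to_cell n c)"
        using continuous_map_from_subtopology[OF b2c, of "T c'"]
        by (auto simp: continuous_map_in_subtopology T_def)
      then have "continuous_map (subtopology ?B (T c')) A (h m \<circ> box_to_cell n c)"
        using hc by (rule continuous_map_compose)
      then show ?thesis by (simp add: 3(2) o_def)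
    qed
  next
    fix z assume "z \<in> topspace ?B"
    then have z: "z \<in> box_boundary k" using topB by simp
    let ?u = "fst (box_to_cell n c z)"
    consider "z 0 = 1" | "z 0 = -1" | "dyadic_code n (fst c) ?u \<noteq> snd c"
      using box_to_cell_boundary[OF t0, of z] z c(2) by blast
    then show "\<exists>S. S \<in> {?T1, ?T0} \<union> T ` L \<and> z \<in> id S \<and> h m (box_to_cell n c z) = h m (box_to_cell n c z)"
    proof cases
      case 3
      have u: "?u \<in> supp m" using bin(1)[OF z] cell_subset_supp[OF c(1)] by blast
      have "C.cell_of m ?u \<in> L"
        using code_ne_cdim_less[OF c(1) bin(1)[OF z] 3] c(2) C.in_closed_cell_of[OF u]
          cell_of_in_cells[OF u] bin(1)[OF z] by (auto simp: L_def)
      moreover have "z \<in> T (C.cell_of m ?u)"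
        using z bin(2)[OF z] C.in_closed_cell_of[OF u] by (simp add: T_def mem_Times_iff)
      ultimately show ?thesis by auto
    qed (use z in auto)
  qed simp
qed

text \<open>The top face is mapped to \<open>a\<close>, so a boundary that leaves \<open>U\<close>
  does so on the bottom face, where the values are those of \<open>g m\<close>, or over a lower cell
  on which \<open>h m\<close> leaves \<open>U\<close>. The first happens for finitely many cells; in
  the second case there are finitely many such lower cells, each meeting finitely many
  others.\<close>

lemma finite_cell_boundaries_outside:
  assumes h: "skeleton_homotopy k h" and U: "openin A U" "a \<in> U"
  shows "finite {(m, c). c \<in> cells m \<and> cdim c = k \<and> \<not> (\<lambda>z. h m (box_to_cell n c z)) ` box_boundary k \<subseteq> U}"
    (is "finite ?bad")
proof -
  define S where "S = {(m, c). c \<in> cells m \<and> cdim c < k \<and> \<not> h m ` (closed_cell n c \<times> {0..1}) \<subseteq> U}"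
  have "finite S" using h U unfolding skeleton_homotopy_def S_def by blast
  then have fin: "finite (\<Union>(m, c')\<in>S. {m} \<times> {c \<in> cells m. closed_cell n c \<inter> closed_cell n c' \<noteq> {}})"
    by (rule finite_UN_I) (auto simp: S_def finite_cells_meeting_cell)
  have "?bad \<subseteq> {(m, c). c \<in> cells m \<and> \<not> g m ` closed_cell n c \<subseteq> U} \<union>
      (\<Union>(m, c')\<in>S. {m} \<times> {c \<in> cells m. closed_cell n c \<inter> closed_cell n c' \<noteq> {}})"
  proof (rule subsetI, rule ccontr)
    fix p
    assume "p \<in> ?bad" and notin: "p \<notin> {(m, c). c \<in> cells m \<and> \<not> g m ` closed_cell n c \<subseteq> U} \<union>
      (\<Union>(m, c')\<in>S. {m} \<times> {c \<in> cells m. closed_cell n c \<inter> closed_cell n c' \<noteq> {}})"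
    then obtain m c z where p: "p = (m, c)" and c: "c \<in> cells m" and k: "k = cdim c"
      and z: "z \<in> box_boundary (cdim c)" and out: "h m (box_to_cell n c z) \<notin> U"
      by auto
    have sub: "g m ` closed_cell n c \<subseteq> U" using notin p c by blast
    obtain t0 where t0: "t0 \<in> topspace (cube n)" "c = (fst c, dyadic_code n (fst c) t0)"
      using cells_code[OF c] by blast
    define u where "u = fst (box_to_cell n c z)"
    define s where "s = snd (box_to_cell n c z)"
    have us: "box_to_cell n c z = (u, s)" by (simp add: u_def s_def)
    have u: "u \<in> closed_cell n c" and s: "s \<in> {0..1}"
      using box_to_cell_in[OF t0, of z] z by (auto simp: box_boundary_def u_def s_def)
    have uc: "u \<in> topspace (cube n)" using u by (simp add: closed_cell_def)
    have h01: "h m (u, 0) = g m u" "h m (u, 1) = a" using h uc unfolding skeleton_homotopy_def by auto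
    have "s \<noteq> 1" using out us h01 U by auto
    moreover have "s \<noteq> 0" using out us h01 sub u by auto
    ultimately have "dyadic_code n (fst c) u \<noteq> snd c"
      using box_to_cell_boundary[OF t0 z] unfolding u_def s_def box_to_cell_time by auto
    then have d: "cdim (C.cell_of m u) < cdim c" by (rule code_ne_cdim_less[OF c u])
    have us': "u \<in> supp m" using u cell_subset_supp[OF c] by blast
    have "(u, s) \<in> closed_cell n (C.cell_of m u) \<times> {0..1}" using C.in_closed_cell_of[OF us'] s by simp
    then have "(m, C.cell_of m u) \<in> S"
      using d out us cell_of_in_cells[OF us'] unfolding S_def k by (simp, metis imageI subsetD)
    moreover have "closed_cell n c \<inter> closed_cell n (C.cell_of m u) \<noteq> {}"
      using u C.in_closed_cell_of[OF us'] by blast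
    ultimately show False using notin p c by blast
  qed
  then show ?thesis by (rule finite_subset) (rule finite_UnI[OF finite_cells_outside[OF U] fin])
qed

text \<open>All boundaries over \<open>k\<close>-cells, for every \<open>m\<close>, are filled in a
  single application of sequential contractibility; filling them one at a time would lose the
  finiteness clause.\<close>

lemma skeleton_homotopy_Suc:
  assumes h: "skeleton_homotopy k h" and A: "seq_contractible k A a"
  shows "\<exists>h'. skeleton_homotopy (Suc k) h'"
proof -
  \<comment> \<open>The index runs over all pairs; those that do not name a \<open>k\<close>-cell of
    the given \<open>m\<close> get constant maps at \<open>a\<close>, which do not affect
    convergence.\<close>
  define \<phi> where "\<phi> = (\<lambda>(m, c). if c \<in> cells m \<and> cdim c = k then (\<lambda>z. h m (box_to_cell n c z)) else (\<lambda>_. a))"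
  have hval: "h m (t, 0) = g m t" "h m (t, 1) = a"
    "\<lbrakk>g m t = a; s \<in> {0..1}\<rbrakk> \<Longrightarrow> h m (t, s) = a" if "t \<in> topspace (cube n)" for m t s
    using h that unfolding skeleton_homotopy_def by blast+
  obtain \<Phi> where \<Phi>: "\<And>i. continuous_map (box_top k) A (\<Phi> i)"
    and \<Phi>bd: "\<And>i z. z \<in> box_boundary k \<Longrightarrow> \<Phi> i z = \<phi> i z"
    and \<Phi>fin: "\<And>U. \<lbrakk>openin A U; a \<in> U\<rbrakk> \<Longrightarrow> finite {i. \<not> \<Phi> i ` topspace (box_top k) \<subseteq> U}"
  proof (rule box_extension[OF A aA, of \<phi>])
    fix i :: "nat \<times> dyadic_cell"
    obtain m c where i: "i = (m, c)" by (cases i)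
    show "continuous_map (subtopology (box_top k) (box_boundary k)) A (\<phi> i)"
      using continuous_map_cell_boundary[OF h] aA by (auto simp: i \<phi>_def)
    fix z assume z: "z \<in> box_boundary k" "z 0 = 1"
    show "\<phi> i z = a"
    proof (cases "c \<in> cells m \<and> cdim c = k")
      case True
      obtain t0 where t0: "t0 \<in> topspace (cube n)" "c = (fst c, dyadic_code n (fst c) t0)"
        using True cells_code by blast
      have "fst (box_to_cell n c z) \<in> topspace (cube n)"
        using box_to_cell_in(1)[OF t0, of z] z True by (auto simp: box_boundary_def closed_cell_def)
      moreover have "box_to_cell n c z = (fst (box_to_cell n c z), 1)"
        using z by (simp add: prod_eq_iff box_to_cell_time)
      ultimately have "h m (box_to_cell n c z) = a" using hval(2) by metis
      then show ?thesis using True by (simp add: i \<phi>_def)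
    qed (auto simp: i \<phi>_def)
  next
    fix U assume U: "openin A U" "a \<in> U"
    show "finite {i. \<not> \<phi> i ` box_boundary k \<subseteq> U}"
      by (rule finite_subset[OF _ finite_cell_boundaries_outside[OF h U]])
        (use U in \<open>auto simp: \<phi>_def split: if_splits\<close>)
  qed blast
  \<comment> \<open>Only the values over open \<open>k\<close>-cells change. By \<open>bd\<close>
    the filling agrees with the old homotopy over the frontier, so \<open>top\<close> holds on whole
    closed cells.\<close>
  define h' where "h' m = (\<lambda>(t, s). if t \<in> supp m \<and> cdim (C.cell_of m t) = k then
      \<Phi> (m, C.cell_of m t) (cell_to_box n (C.cell_of m t) (t, s)) else h m (t, s))" for m
  have bd: "\<Phi> (m, c) (cell_to_box n c (u, s)) = h m (u, s)"
    if c: "c \<in> cells m" "cdim c = k" and u: "u \<in> closed_cell n c" and s: "s \<in> {0..1}"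
      and "s = 0 \<or> s = 1 \<or> dyadic_code n (fst c) u \<noteq> snd c" for m c u s
  proof -
    obtain t0 where t0: "t0 \<in> topspace (cube n)" "c = (fst c, dyadic_code n (fst c) t0)"
      using c(1) cells_code by blast
    have "cell_to_box n c (u, s) \<in> box_boundary k"
      using cell_to_box_boundary[OF t0 u s] that(5) c(2) by simp
    then show ?thesis using \<Phi>bd c box_to_cell_to_box[OF t0 u] by (simp add: \<phi>_def)
  qed
  have top: "h' m (u, s) = \<Phi> (m, c) (cell_to_box n c (u, s))"
    if c: "c \<in> cells m" "cdim c = k" and u: "u \<in> closed_cell n c" and s: "s \<in> {0..1}" for m c u s
  proof (cases "C.cell_of m u = c")
    case True
    then show ?thesis using c u cell_subset_supp[OF c(1)] by (auto simp: h'_def)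
  next
    case False
    then have "dyadic_code n (fst c) u \<noteq> snd c" using cell_of_eq_code[OF c(1) u] by blast
    moreover have "cdim (C.cell_of m u) \<noteq> k" using cdim_less[OF c(1) u] False c(2) by auto
    ultimately show ?thesis using bd[OF c u s] by (simp add: h'_def)
  qed
  \<comment> \<open>A closed cell of dimension below \<open>k\<close> contains no point of a
    \<open>k\<close>-cell, so nothing changes over it.\<close>
  have low: "h' m (u, s) = h m (u, s)" if "c \<in> cells m" "cdim c < k" "u \<in> closed_cell n c" for m c u s
    using cdim_less[OF that(1,3)] that(2) by (auto simp: h'_def)
  show ?thesis
    unfolding skeleton_homotopy_def
  proof (intro exI[of _ h'] conjI allI ballI impI)
    fix m t assume t: "t \<in> topspace (cube n)"
    have ends: "h' m (t, s) = h m (t, s)" if "s = 0 \<or> s = 1" for s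
    proof (cases "t \<in> supp m \<and> cdim (C.cell_of m t) = k")
      case True
      then show ?thesis
        using top[of "C.cell_of m t" m t s] bd[of "C.cell_of m t" m t s] cell_of_in_cells[of t m]
          C.in_closed_cell_of[of t m] that by auto
    qed (auto simp: h'_def)
    show "h' m (t, 0) = g m t" "h' m (t, 1) = a" using ends[of 0] ends[of 1] hval[OF t] by auto
    show "h' m (t, s) = a" if "g m t = a" "s \<in> {0..1}" for s
      using hval(3)[OF t that] that(1) by (simp add: h'_def supp_def)
  next
    fix m c assume c: "c \<in> cells m" "cdim c < Suc k"
    let ?X = "subtopology cyl (closed_cell n c \<times> {0..1})"
    show "continuous_map ?X A (h' m)"
    proof (cases "cdim c = k")
      case True
      obtain t0 where t0: "t0 \<in> topspace (cube n)" "c = (fst c, dyadic_code n (fst c) t0)"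
        using c(1) cells_code by blast
      have "continuous_map ?X (box_top k) (cell_to_box n c)"
        using continuous_map_cell_to_box[OF t0] unfolding True .
      then have "continuous_map ?X A (\<Phi> (m, c) \<circ> cell_to_box n c)"
        using \<Phi> by (rule continuous_map_compose)
      then show ?thesis
        by (rule continuous_map_eq) (use top[OF c(1) True] in auto)
    next
      case False
      then have d: "cdim c < k" using c(2) by simp
      then have "continuous_map ?X A (h m)" using h c(1) unfolding skeleton_homotopy_def by blast
      then show ?thesis
        by (rule continuous_map_eq) (use low[OF c(1) d] in auto)
    qed
  next
    fix U assume U: "openin A U \<and> a \<in> U"
    have 1: "finite {(m, c). c \<in> cells m \<and> cdim c < k \<and> \<not> h m ` (closed_cell n c \<times> {0..1}) \<subseteq> U}"
      using h U unfolding skeleton_homotopy_def by blast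
    have 2: "finite {i. \<not> \<Phi> i ` topspace (box_top k) \<subseteq> U}" using \<Phi>fin U by blast
    have "{(m, c). c \<in> cells m \<and> cdim c < Suc k \<and> \<not> h' m ` (closed_cell n c \<times> {0..1}) \<subseteq> U} \<subseteq>
        {(m, c). c \<in> cells m \<and> cdim c < k \<and> \<not> h m ` (closed_cell n c \<times> {0..1}) \<subseteq> U} \<union>
        {i. \<not> \<Phi> i ` topspace (box_top k) \<subseteq> U}"
    proof
      fix p assume "p \<in> {(m, c). c \<in> cells m \<and> cdim c < Suc k \<and> \<not> h' m ` (closed_cell n c \<times> {0..1}) \<subseteq> U}"
      then obtain m c where p: "p = (m, c)" and c: "c \<in> cells m" "cdim c < Suc k"
        and ns: "\<not> h' m ` (closed_cell n c \<times> {0..1}) \<subseteq> U"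
        by blast
      obtain u s where u: "u \<in> closed_cell n c" and s: "s \<in> {0..1}" and out: "h' m (u, s) \<notin> U"
        using ns by (auto simp: image_subset_iff)
      obtain t0 where t0: "t0 \<in> topspace (cube n)" "c = (fst c, dyadic_code n (fst c) t0)"
        using c(1) cells_code by blast
      show "p \<in> {(m, c). c \<in> cells m \<and> cdim c < k \<and> \<not> h m ` (closed_cell n c \<times> {0..1}) \<subseteq> U} \<union>
          {i. \<not> \<Phi> i ` topspace (box_top k) \<subseteq> U}"
      proof (cases "cdim c = k")
        case True
        then have "cell_to_box n c (u, s) \<in> topspace (box_top k)"
          using cell_to_box_in[OF t0 u s] by simp
        then show ?thesis using top[OF c(1) True u s] out p by auto
      next
        case False
        then have d: "cdim c < k" using c(2) by simp
        then have "h m (u, s) \<notin> U" using low[OF c(1) d u] out by simp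
        then show ?thesis using p c(1) d u s by blast
      qed
    qed
    then show "finite {(m, c). c \<in> cells m \<and> cdim c < Suc k \<and> \<not> h' m ` (closed_cell n c \<times> {0..1}) \<subseteq> U}"
      using 1 2 finite_subset by blast
  qed
qed

text \<open>Over \<open>supp m\<close> the closed cells are a locally finite closed cover. Outside
  it \<open>h m\<close> is \<open>a\<close>, and a neighbourhood of \<open>a\<close> contains the
  values over all but finitely many cells; removing these closed cells from the cube leaves a
  neighbourhood that works.\<close>

lemma skeleton_homotopy_continuous:
  assumes h: "skeleton_homotopy (Suc n) h"
  shows "continuous_map cyl A (h m)"
proof -
  \<comment> \<open>A cell has at most \<open>n\<close> directions, so the skeleton below dimension
    \<open>Suc n\<close> is everything.\<close>
  have dim: "cdim c < Suc n" for c
    using card_mono[of "{..<n}" "cell_dirs n c"] by (auto simp: cell_dirs_def less_Suc_eq_le)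
  have hc: "continuous_map (subtopology cyl (closed_cell n c \<times> {0..1})) A (h m)" if "c \<in> cells m" for c
    using h that dim unfolding skeleton_homotopy_def by blast
  have ha: "h m (t, s) = a" if "t \<in> topspace (cube n)" "t \<notin> supp m" "s \<in> {0..1}" for t s
    using h that unfolding skeleton_homotopy_def supp_def by blast
  let ?O = "supp m \<times> {0..1::real}"
  have haw: "h m w = a" if w: "w \<in> topspace cyl" "w \<notin> ?O" for w
  proof -
    obtain t s where "w = (t, s)" by (cases w)
    then show ?thesis using ha[of t s] w by simp
  qed
  have opO: "openin cyl ?O"
    using C.openE[of m] openin_topspace[of "top_of_set {0..1::real}"] by (simp add: openin_prod_Times_iff)
  have inner: "continuous_map (subtopology cyl ?O) A (h m)"
  proof (rule pasting_lemma_locally_finite[where I = "cells m" and T = "\<lambda>c. closed_cell n c \<times> {0..1}" and f = "\<lambda>_. h m"])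
    fix w assume "w \<in> topspace (subtopology cyl ?O)"
    then obtain t s where w: "w = (t, s)" "t \<in> supp m" "s \<in> {0..1}" by auto
    then obtain N where N: "t \<in> C.core m N" using C.ex_core by blast
    have "openin cyl (C.core m N \<times> {0..1})"
      using C.openin_core[of m N] openin_topspace[of "top_of_set {0..1::real}"] by (simp add: openin_prod_Times_iff)
    then have "openin (subtopology cyl ?O) (C.core m N \<times> {0..1})"
      using C.core_subset[of m N] opO by (simp add: openin_open_subtopology Sigma_mono)
    moreover have "finite {c \<in> cells m. closed_cell n c \<times> {0..1} \<inter> C.core m N \<times> {0..1} \<noteq> {}}"
      by (rule finite_subset[OF _ C.finite_cells_meeting_core[of m N]]) (auto simp: cells_def)
    ultimately show "\<exists>V. openin (subtopology cyl ?O) V \<and> w \<in> V \<and>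
        finite {c \<in> cells m. closed_cell n c \<times> {0..1} \<inter> V \<noteq> {}}"
      using w N by blast
    show "\<exists>c. c \<in> cells m \<and> w \<in> closed_cell n c \<times> {0..1} \<and> h m w = h m w"
      using w cell_of_in_cells[OF w(2)] C.in_closed_cell_of[OF w(2)] by blast
  next
    fix c assume c: "c \<in> cells m"
    have sub: "closed_cell n c \<times> {0..1} \<subseteq> ?O" using cell_subset_supp[OF c] by auto
    show "closedin (subtopology cyl ?O) (closed_cell n c \<times> {0..1})"
      using sub by (intro closedin_subset_topspace) (simp_all add: closedin_prod_Times_iff closedin_closed_cell)
    have "?O \<inter> closed_cell n c \<times> {0..1} = closed_cell n c \<times> {0..1}" using sub by blast
    then show "continuous_map (subtopology (subtopology cyl ?O) (closed_cell n c \<times> {0..1})) A (h m)"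
      using hc[OF c] by (simp add: subtopology_subtopology)
  qed simp
  show ?thesis
    unfolding continuous_map_def
  proof (intro conjI allI impI)
    show "h m \<in> topspace cyl \<rightarrow> topspace A"
    proof
      fix w assume w: "w \<in> topspace cyl"
      show "h m w \<in> topspace A"
      proof (cases "w \<in> ?O")
        case True
        then show ?thesis using continuous_map_funspace[OF inner] w by auto
      next
        case False
        then have "h m w = a" using haw[OF w] by blast
        then show ?thesis using aA by simp
      qed
    qed
    fix U assume U: "openin A U"
    have "openin (subtopology cyl ?O) {w \<in> topspace (subtopology cyl ?O). h m w \<in> U}"
      by (rule openin_continuous_map_preimage[OF inner U])
    then have in1: "openin cyl {w \<in> topspace (subtopology cyl ?O). h m w \<in> U}"
      using opO openin_open_subtopology by blast
    have in2: "\<exists>V. openin cyl V \<and> topspace cyl - ?O \<subseteq> V \<and> V \<subseteq> {w \<in> topspace cyl. h m w \<in> U}" if aU: "a \<in> U"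
    proof -
      define F where "F = {c \<in> cells m. \<not> h m ` (closed_cell n c \<times> {0..1}) \<subseteq> U}"
      have "finite {(m, c). c \<in> cells m \<and> cdim c < Suc n \<and> \<not> h m ` (closed_cell n c \<times> {0..1}) \<subseteq> U}"
        using h U aU unfolding skeleton_homotopy_def by blast
      then have "finite (Pair m -` {(m, c). c \<in> cells m \<and> cdim c < Suc n \<and> \<not> h m ` (closed_cell n c \<times> {0..1}) \<subseteq> U})"
        by (rule finite_vimageI) (auto simp: inj_on_def)
      then have "finite F" by (rule rev_finite_subset) (auto simp: F_def dim)
      then have cl: "closedin (cube n) (\<Union>c\<in>F. closed_cell n c)"
        by (intro closedin_Union) (auto simp: closedin_closed_cell)
      define V where "V = (topspace (cube n) - (\<Union>c\<in>F. closed_cell n c)) \<times> {0..1::real}"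
      have "openin cyl V"
        using openin_diff[OF openin_topspace cl] openin_topspace[of "top_of_set {0..1::real}"]
        by (simp add: V_def openin_prod_Times_iff)
      moreover have "topspace cyl - ?O \<subseteq> V"
        using cell_subset_supp by (auto simp: V_def F_def)
      moreover have "h m w \<in> U" if w: "w \<in> V" for w
      proof -
        obtain t s where ts: "w = (t, s)" "t \<in> topspace (cube n)" "t \<notin> (\<Union>c\<in>F. closed_cell n c)" "s \<in> {0..1}"
          using w by (auto simp: V_def)
        show ?thesis
        proof (cases "t \<in> supp m")
          case True
          then have "C.cell_of m t \<notin> F" using ts(3) C.in_closed_cell_of by blast
          then have "h m ` (closed_cell n (C.cell_of m t) \<times> {0..1}) \<subseteq> U"
            using cell_of_in_cells[OF True] by (simp add: F_def)
          then show ?thesis using ts C.in_closed_cell_of[OF True] by blast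
        next
          case False
          then show ?thesis using ha ts aU by simp
        qed
      qed
      moreover have "V \<subseteq> topspace cyl" by (auto simp: V_def)
      ultimately show ?thesis by blast
    qed
    show "openin cyl {w \<in> topspace cyl. h m w \<in> U}"
    proof (subst openin_subopen, intro ballI)
      fix w assume w: "w \<in> {w \<in> topspace cyl. h m w \<in> U}"
      show "\<exists>T. openin cyl T \<and> w \<in> T \<and> T \<subseteq> {w \<in> topspace cyl. h m w \<in> U}"
      proof (cases "w \<in> ?O")
        case True
        then show ?thesis using in1 w by (intro exI[of _ "{w \<in> topspace (subtopology cyl ?O). h m w \<in> U}"]) auto
      next
        case False
        then have "a \<in> U" using w haw[of w] by auto
        then show ?thesis using in2 w False by blast
      qed
    qed
  qed
qed

lemma skeleton_homotopy_converges:
  assumes h: "skeleton_homotopy (Suc n) h"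
  shows "maps_converge cyl A h a"
  unfolding maps_converge_iff_finite
proof (intro allI impI)
  fix U assume U: "openin A U \<and> a \<in> U"
  let ?F = "{(m, c). c \<in> cells m \<and> cdim c < Suc n \<and> \<not> h m ` (closed_cell n c \<times> {0..1}) \<subseteq> U}"
  have dim: "cdim c < Suc n" for c
    using card_mono[of "{..<n}" "cell_dirs n c"] by (auto simp: cell_dirs_def less_Suc_eq_le)
  have "finite ?F" using h U unfolding skeleton_homotopy_def by blast
  then have "finite (fst ` ?F)" by simp
  moreover have "{m. \<not> h m ` topspace cyl \<subseteq> U} \<subseteq> fst ` ?F"
  proof
    fix m assume "m \<in> {m. \<not> h m ` topspace cyl \<subseteq> U}"
    then obtain t s where ts: "t \<in> topspace (cube n)" "s \<in> {0..1}" "h m (t, s) \<notin> U"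
      by (auto simp: image_subset_iff)
    have t: "t \<in> supp m"
    proof (rule ccontr)
      assume "t \<notin> supp m"
      then have "h m (t, s) = a" using h ts(1,2) unfolding skeleton_homotopy_def supp_def by blast
      then show False using ts(3) U by simp
    qed
    then have "(m, C.cell_of m t) \<in> ?F"
      using cell_of_in_cells[OF t] dim C.in_closed_cell_of[OF t] ts(2,3) by blast
    then show "m \<in> fst ` ?F" by (rule rev_image_eqI) simp
  qed
  ultimately show "finite {m. \<not> h m ` topspace cyl \<subseteq> U}" by (rule rev_finite_subset)
qed

lemma ex_skeleton_homotopy:
  assumes "\<And>k. k < l \<Longrightarrow> seq_contractible k A a"
  shows "\<exists>h. skeleton_homotopy l h"
  using assms
proof (induction l)
  case 0
  then show ?case using skeleton_homotopy_zero by blast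
next
  case (Suc l)
  then show ?case using skeleton_homotopy_Suc by (meson less_Suc_eq)
qed

end

text \<open>Cells have dimensions 0 to \<open>n\<close>, and extending over those of dimension
  \<open>k\<close> uses contractibility of \<open>k\<close>-spheres, which accounts for the range
  \<open>k \<le> n\<close>.\<close>

lemma rel_contracting_cube:
  assumes "t1_space A" "a \<in> topspace A" and SC: "\<And>k. k \<le> n \<Longrightarrow> seq_contractible k A a"
  shows "rel_contracting (cube n) B A a"
  unfolding rel_contracting_def
proof (intro allI impI)
  fix g assume g: "(\<forall>m. continuous_map (cube n) A (g m) \<and> (\<forall>z\<in>B. g m z = a)) \<and> maps_converge (cube n) A g a"
  interpret null_sequence n A a g
    using assms g by unfold_locales auto
  obtain h where h: "skeleton_homotopy (Suc n) h"
    using ex_skeleton_homotopy[of "Suc n"] SC by (auto simp: less_Suc_eq_le)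
  have vals: "\<forall>m. \<forall>t\<in>topspace (cube n). h m (t, 0) = g m t \<and> h m (t, 1) = a \<and>
      (g m t = a \<longrightarrow> (\<forall>s\<in>{0..1}. h m (t, s) = a))"
    using h unfolding skeleton_homotopy_def by (elim conjE)
  show "\<exists>h. (\<forall>m. continuous_map (prod_topology (cube n) (top_of_set {0..1::real})) A (h m) \<and>
             (\<forall>z\<in>topspace (cube n). h m (z, 0) = g m z \<and> h m (z, 1) = a \<and>
                (g m z = a \<longrightarrow> (\<forall>s\<in>{0..1}. h m (z, s) = a)))) \<and>
          maps_converge (prod_topology (cube n) (top_of_set {0..1::real})) A h a"
    by (intro exI[of _ h] conjI allI skeleton_homotopy_continuous[OF h]
        skeleton_homotopy_converges[OF h] spec[OF vals])
qed

section \<open>The sphere as a quotient of the cube\<close>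

text \<open>With \<open>v = 2 t - 1\<close> and \<open>w = \<Prod>i. 1 - (v i)\<^sup>2\<close>, the map sends \<open>t\<close> to the inverse stereographic
  projection of \<open>v / w\<close>, which extends to the boundary of the cube, where \<open>w = 0\<close>.\<close>

definition cube_bump :: "nat \<Rightarrow> (nat \<Rightarrow> real) \<Rightarrow> real" where
  "cube_bump k t = (\<Prod>i<k. 1 - (2 * t i - 1)\<^sup>2)"

definition cube_sq :: "nat \<Rightarrow> (nat \<Rightarrow> real) \<Rightarrow> real" where
  "cube_sq k t = (\<Sum>i<k. (2 * t i - 1)\<^sup>2)"

definition cube_to_sphere :: "nat \<Rightarrow> (nat \<Rightarrow> real) \<Rightarrow> nat \<Rightarrow> real" where
  "cube_to_sphere k t = (\<lambda>j\<in>{..k}. if j = 0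
     then (cube_sq k t - (cube_bump k t)\<^sup>2) / (cube_sq k t + (cube_bump k t)\<^sup>2)
     else 2 * (2 * t (j - 1) - 1) * cube_bump k t / (cube_sq k t + (cube_bump k t)\<^sup>2))"

text \<open>\<open>cube_sq\<close> vanishes only where all \<open>2 * t i - 1\<close> do, and there
  \<open>cube_bump\<close> is 1.\<close>

lemma cube_denom_pos: "cube_sq k t + (cube_bump k t)\<^sup>2 > 0"
proof (cases "\<forall>i<k. 2 * t i - 1 = 0")
  case True
  then have "cube_sq k t = 0" "cube_bump k t = 1" by (auto simp: cube_sq_def cube_bump_def)
  then show ?thesis by simp
next
  case False
  then obtain i where i: "i < k" "2 * t i - 1 \<noteq> 0" by blast
  have "(2 * t i - 1)\<^sup>2 \<le> cube_sq k t"
    unfolding cube_sq_def using i by (intro member_le_sum) auto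
  moreover have "(2 * t i - 1)\<^sup>2 > 0" using i by simp
  ultimately have "cube_sq k t > 0" by linarith
  then show ?thesis by (simp add: add_pos_nonneg)
qed

lemma cube_to_sphere_in: "cube_to_sphere k t \<in> topspace (sphere_top k)"
proof -
  define V w D where "V = cube_sq k t" and "w = cube_bump k t" and "D = V + w\<^sup>2"
  have D: "D > 0" using cube_denom_pos by (simp add: D_def V_def w_def)
  have coord: "cube_to_sphere k t (Suc i) = 2 * (2 * t i - 1) * w / D" if "i < k" for i
    using that by (simp add: cube_to_sphere_def V_def w_def D_def)
  have sq: "(2 * v * w / D)\<^sup>2 = v\<^sup>2 * (4 * w\<^sup>2 / D\<^sup>2)" for v
    by (simp add: power_divide power_mult_distrib)
  have "(\<Sum>j\<le>k. (cube_to_sphere k t j)\<^sup>2) =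
      (cube_to_sphere k t 0)\<^sup>2 + (\<Sum>i<k. (cube_to_sphere k t (Suc i))\<^sup>2)"
    by (rule sum.atMost_shift)
  also have "(\<Sum>i<k. (cube_to_sphere k t (Suc i))\<^sup>2) = (\<Sum>i<k. (2 * t i - 1)\<^sup>2 * (4 * w\<^sup>2 / D\<^sup>2))"
    by (rule sum.cong) (simp_all only: lessThan_iff coord sq)
  also have "\<dots> = V * (4 * w\<^sup>2 / D\<^sup>2)"
    unfolding V_def cube_sq_def by (rule sum_distrib_right[symmetric])
  also have "(cube_to_sphere k t 0)\<^sup>2 = (V - w\<^sup>2)\<^sup>2 / D\<^sup>2"
    by (simp add: cube_to_sphere_def V_def w_def D_def power_divide)
  \<comment> \<open>This is \<open>(V - w^2)^2 + 4 V w^2 = (V + w^2)^2\<close>, the identity behind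
    inverse stereographic projection.\<close>
  also have "(V - w\<^sup>2)\<^sup>2 / D\<^sup>2 + V * (4 * w\<^sup>2 / D\<^sup>2) = D\<^sup>2 / D\<^sup>2"
    unfolding D_def by (simp add: power2_eq_square algebra_simps flip: add_divide_distrib)
  also have "\<dots> = 1" using D by simp
  finally show ?thesis by (simp add: topspace_sphere_top cube_to_sphere_def)
qed

lemma continuous_map_cube_to_sphere: "continuous_map (cube k) (sphere_top k) (cube_to_sphere k)"
proof -
  have V: "continuous_map (cube k) euclideanreal (cube_sq k)"
    unfolding cube_sq_def by (intro continuous_intros continuous_map_cube_coord) auto
  have w: "continuous_map (cube k) euclideanreal (cube_bump k)"
    unfolding cube_bump_def by (intro continuous_intros continuous_map_cube_coord) auto
  have D: "cube_sq k t + (cube_bump k t)\<^sup>2 \<noteq> 0" for t using cube_denom_pos[of k t] by simp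
  have "continuous_map (cube k) euclideanreal (\<lambda>t. cube_to_sphere k t j)" if j: "j \<le> k" for j
  proof (cases "j = 0")
    case True
    then show ?thesis
      unfolding cube_to_sphere_def using D
      by (simp, intro continuous_map_real_divide continuous_map_diff continuous_map_add continuous_map_real_pow V w) auto
  next
    case False
    then have "j - 1 < k" using j by simp
    then show ?thesis
      using False j D unfolding cube_to_sphere_def
      by (simp, intro continuous_map_real_divide continuous_map_real_mult continuous_map_diff continuous_map_add
          continuous_map_real_pow V w continuous_map_cube_coord) auto
  qed
  then have "continuous_map (cube k) (product_topology (\<lambda>_. euclideanreal) {..k}) (cube_to_sphere k)"
    by (auto simp: continuous_map_componentwise cube_to_sphere_def)
  then show ?thesis
    using cube_to_sphere_in unfolding sphere_top_def by (auto simp: continuous_map_in_subtopology)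
qed

lemma sphere_top_eq_base:
  assumes p: "p \<in> topspace (sphere_top k)" and p0: "p 0 = 1"
  shows "p = sphere_base k"
proof -
  have "(\<Sum>i\<le>k. (p i)\<^sup>2) = (p 0)\<^sup>2 + (\<Sum>i<k. (p (Suc i))\<^sup>2)" by (rule sum.atMost_shift)
  then have "(\<Sum>i<k. (p (Suc i))\<^sup>2) = 0" using p p0 by (simp add: topspace_sphere_top)
  then have "p (Suc i) = 0" if "i < k" for i
    using that by (subst (asm) sum_nonneg_eq_0_iff) auto
  then have "p i = 0" if "i \<le> k" "i \<noteq> 0" for i
    using that by (metis Suc_le_lessD not0_implies_Suc)
  then show ?thesis
    using p p0 by (auto simp: topspace_sphere_top PiE_iff extensional_def sphere_base_def fun_eq_iff)
qed

lemma cube_to_sphere_bump: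
  assumes "cube_to_sphere k t \<noteq> sphere_base k"
  shows "cube_bump k t \<noteq> 0"
proof
  assume "cube_bump k t = 0"
  then have "cube_to_sphere k t 0 = 1"
    using cube_denom_pos[of k t] by (simp add: cube_to_sphere_def)
  then show False using sphere_top_eq_base[OF cube_to_sphere_in] assms by blast
qed

lemma cube_factor_nonneg:
  assumes "t \<in> topspace (cube k)" "i < k"
  shows "0 \<le> 1 - (2 * t i - 1)\<^sup>2"
proof -
  have "0 \<le> t i" "t i \<le> 1" using assms by (auto simp: topspace_cube PiE_iff)
  then have "\<bar>2 * t i - 1\<bar> \<le> 1" by linarith
  then show ?thesis by (simp add: abs_square_le_1)
qed

text \<open>The left side is stereographic projection from the basepoint, so it returns
  \<open>v / w\<close>.\<close>

lemma cube_to_sphere_ratio: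
  assumes "i < k" "cube_bump k t \<noteq> 0"
  shows "cube_to_sphere k t (Suc i) / (1 - cube_to_sphere k t 0) = (2 * t i - 1) / cube_bump k t"
proof -
  define V w where "V = cube_sq k t" and "w = cube_bump k t"
  have D: "V + w\<^sup>2 > 0" using cube_denom_pos by (simp add: V_def w_def)
  have c: "cube_to_sphere k t (Suc i) = 2 * (2 * t i - 1) * w / (V + w\<^sup>2)"
    using assms(1) by (simp add: cube_to_sphere_def V_def w_def)
  have c0: "1 - cube_to_sphere k t 0 = 2 * w\<^sup>2 / (V + w\<^sup>2)"
    using D by (simp add: cube_to_sphere_def field_simps flip: V_def w_def)
  have "w \<noteq> 0" using assms(2) by (simp add: w_def)
  then have "2 * v * w / d / (2 * w\<^sup>2 / d) = v / w" if "d > 0" for v d :: real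
    using that by (simp add: power2_eq_square)
  then show ?thesis unfolding c c0 w_def[symmetric] using D by blast
qed

text \<open>The projection determines \<open>v / w\<close>. At the point with the larger bump
  \<open>w\<close> each \<open>\<bar>v i\<bar>\<close> is at least as large, hence each factor
  \<open>1 - (v i)^2\<close> is no larger, and so its bump is no larger either. Thus the bumps
  agree, and with them the points.\<close>

lemma cube_to_sphere_inj:
  assumes t: "t \<in> topspace (cube k)" and t': "t' \<in> topspace (cube k)"
    and eq: "cube_to_sphere k t = cube_to_sphere k t'" and ne: "cube_to_sphere k t \<noteq> sphere_base k"
  shows "t = t'"
proof -
  have le: "cube_bump k r' \<le> cube_bump k r"
    if bump: "cube_bump k r \<le> cube_bump k r'" and r: "r \<in> topspace (cube k)" and r': "r' \<in> topspace (cube k)"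
      and req: "cube_to_sphere k r = cube_to_sphere k r'" and rne: "cube_to_sphere k r \<noteq> sphere_base k" for r r'
  proof -
    have "cube_bump k r \<ge> 0"
      unfolding cube_bump_def using cube_factor_nonneg[OF r] by (intro prod_nonneg) auto
    then have pos: "cube_bump k r > 0" using cube_to_sphere_bump[OF rne] by linarith
    then have pos': "cube_bump k r' > 0" using bump by linarith
    have "1 - (2 * r' i - 1)\<^sup>2 \<le> 1 - (2 * r i - 1)\<^sup>2" if i: "i < k" for i
    proof -
      have "(2 * r i - 1) / cube_bump k r = (2 * r' i - 1) / cube_bump k r'"
        using cube_to_sphere_ratio[OF i, of r] cube_to_sphere_ratio[OF i, of r'] pos bump req by simp
      then have "\<bar>(2 * r i - 1) / cube_bump k r\<bar> = \<bar>(2 * r' i - 1) / cube_bump k r'\<bar>"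
        by (rule arg_cong)
      then have "\<bar>2 * r i - 1\<bar> / cube_bump k r = \<bar>2 * r' i - 1\<bar> / cube_bump k r'"
        unfolding abs_divide abs_of_pos[OF pos] abs_of_pos[OF pos'] .
      moreover have "\<bar>2 * r' i - 1\<bar> / cube_bump k r' \<le> \<bar>2 * r' i - 1\<bar> / cube_bump k r"
        using pos bump by (intro divide_left_mono) auto
      ultimately have "\<bar>2 * r i - 1\<bar> / cube_bump k r \<le> \<bar>2 * r' i - 1\<bar> / cube_bump k r"
        by (rule ord_eq_le_trans)
      then have "\<bar>2 * r i - 1\<bar> \<le> \<bar>2 * r' i - 1\<bar>" using pos unfolding divide_le_cancel by blast
      then show ?thesis by (simp add: abs_le_square_iff)
    qed
    then show ?thesis
      unfolding cube_bump_def using cube_factor_nonneg[OF r'] by (intro prod_mono) auto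
  qed
  have "cube_bump k t = cube_bump k t'"
    using le[of t t'] le[of t' t] assms by (metis linorder_linear order_antisym)
  then have "2 * t i - 1 = 2 * t' i - 1" if "i < k" for i
    using cube_to_sphere_ratio[OF that, of t] cube_to_sphere_ratio[OF that, of t']
      cube_to_sphere_bump ne eq by auto
  then show ?thesis
    using t t' unfolding topspace_cube by (intro PiE_ext[of t "{..<k}" "\<lambda>_. {0..1}"]) auto
qed

text \<open>With \<open>u\<close> the stereographic projection of \<open>p\<close>, a preimage has
  \<open>v = s * u\<close> where \<open>s\<close> is its own bump. So \<open>s\<close> must solve
  \<open>s = (\<Prod>i<k. 1 - (s * u i)^2)\<close>, and the intermediate value theorem on the unit
  interval provides a solution.\<close>

lemma cube_to_sphere_surj:
  assumes p: "p \<in> topspace (sphere_top k)" and ne: "p \<noteq> sphere_base k"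
  shows "\<exists>t\<in>topspace (cube k). cube_to_sphere k t = p"
proof -
  define q where "q = (\<Sum>i<k. (p (Suc i))\<^sup>2)"
  have "(\<Sum>i\<le>k. (p i)\<^sup>2) = (p 0)\<^sup>2 + q" unfolding q_def by (rule sum.atMost_shift)
  then have q: "q = 1 - (p 0)\<^sup>2" using p by (simp add: topspace_sphere_top)
  have "q \<ge> 0" by (simp add: q_def sum_nonneg)
  then have "p 0 \<le> 1" using q by (simp add: abs_square_le_1)
  moreover have "p 0 \<noteq> 1" using sphere_top_eq_base[OF p] ne by blast
  ultimately have p0: "1 - p 0 > 0" by simp
  define u where "u i = p (Suc i) / (1 - p 0)" for i
  have usq: "(\<Sum>i<k. (u i)\<^sup>2) = (1 + p 0) / (1 - p 0)"
  proof -
    have "(\<Sum>i<k. (u i)\<^sup>2) = q / (1 - p 0)\<^sup>2"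
      by (simp add: u_def q_def power_divide sum_divide_distrib)
    also have "\<dots> = (1 + p 0) / (1 - p 0)"
      using p0 unfolding q by (simp add: power2_eq_square divide_simps) (simp add: algebra_simps)
    finally show ?thesis .
  qed
  \<comment> \<open>Truncation at 0 keeps the factors between 0 and 1, so that
    \<open>W 1 \<le> 1\<close> gives the sign at the right end. At the solution \<open>s > 0\<close>
    rules out vanishing factors, so the truncation has no effect there.\<close>
  define W where "W s = (\<Prod>i<k. max 0 (1 - (s * u i)\<^sup>2))" for s
  have "\<exists>s. 0 \<le> s \<and> s \<le> 1 \<and> s - W s = 0"
  proof (rule IVT')
    have "W 1 \<le> 1" unfolding W_def by (rule prod_le_1) auto
    then show "0 \<le> 1 - W 1" by simp
    show "continuous_on {0..1} (\<lambda>s. s - W s)" unfolding W_def by (intro continuous_intros)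
  qed (simp_all add: W_def)
  then obtain s where s: "0 \<le> s" "s \<le> 1" "W s = s" by auto
  have "W 0 = 1" by (simp add: W_def)
  then have spos: "s > 0" using s by (metis less_eq_real_def zero_neq_one)
  have fac: "1 - (s * u i)\<^sup>2 > 0" if "i < k" for i
  proof (rule ccontr)
    assume "\<not> 1 - (s * u i)\<^sup>2 > 0"
    then have "max 0 (1 - (s * u i)\<^sup>2) = 0" by simp
    then have "W s = 0" unfolding W_def using that by (intro prod_zero) auto
    then show False using s(3) spos by simp
  qed
  define t where "t = (\<lambda>i\<in>{..<k}. (s * u i + 1) / 2)"
  have v: "2 * t i - 1 = s * u i" if "i < k" for i
    using that by (simp add: t_def field_simps)
  have "\<bar>s * u i\<bar> \<le> 1" if "i < k" for i using fac[OF that] by (simp add: flip: abs_square_le_1)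
  then have tc: "t \<in> topspace (cube k)"
    by (auto simp: topspace_cube t_def abs_le_iff) (smt (verit))+
  have w: "cube_bump k t = s"
  proof -
    have "cube_bump k t = W s"
      unfolding cube_bump_def W_def by (rule prod.cong) (use fac v in \<open>auto simp: max_def less_imp_le\<close>)
    then show ?thesis using s by simp
  qed
  have V: "cube_sq k t = s\<^sup>2 * ((1 + p 0) / (1 - p 0))"
  proof -
    have "cube_sq k t = (\<Sum>i<k. s\<^sup>2 * (u i)\<^sup>2)"
      unfolding cube_sq_def by (rule sum.cong) (auto simp: v power_mult_distrib)
    then show ?thesis by (simp add: usq flip: sum_distrib_left)
  qed
  have D: "cube_sq k t + (cube_bump k t)\<^sup>2 = 2 * s\<^sup>2 / (1 - p 0)"
    unfolding V w using p0 by (simp add: field_simps)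
  have N: "cube_sq k t - (cube_bump k t)\<^sup>2 = 2 * s\<^sup>2 * p 0 / (1 - p 0)"
    unfolding V w using p0 by (simp add: field_simps)
  have "cube_to_sphere k t j = p j" if j: "j \<le> k" for j
  proof (cases j)
    case 0
    then show ?thesis using spos p0 by (simp add: cube_to_sphere_def D N)
  next
    case (Suc i)
    then have i: "i < k" using j by simp
    have "cube_to_sphere k t (Suc i) =
        2 * (2 * t i - 1) * cube_bump k t / (cube_sq k t + (cube_bump k t)\<^sup>2)"
      using i by (simp add: cube_to_sphere_def)
    also have "\<dots> = 2 * (s * u i) * s / (2 * s\<^sup>2 / (1 - p 0))"
      unfolding D unfolding v[OF i] w by (rule refl)
    also have "\<dots> = u i * (1 - p 0)" using spos p0 by (simp add: power2_eq_square)
    also have "\<dots> = p (Suc i)" using p0 by (simp add: u_def)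
    finally show ?thesis using Suc by simp
  qed
  then have "cube_to_sphere k t = p"
    using p by (auto simp: cube_to_sphere_def topspace_sphere_top PiE_iff extensional_def fun_eq_iff)
  then show ?thesis using tc by blast
qed

text \<open>Lift to the cube, contract there, and descend. Over the basepoint the lifted maps equal
  \<open>a\<close> and the homotopy is stationary, so it is constant on that fibre; other points
  have one preimage. Continuity descends because a continuous map from a compact to a Hausdorff
  space is closed.\<close>

lemma rel_contracting_sphere:
  assumes cube: "rel_contracting (cube k) {} A a" and aA: "a \<in> topspace A"
  shows "rel_contracting (sphere_top k) {sphere_base k} A a"
  unfolding rel_contracting_def
proof (intro allI impI)
  let ?S = "sphere_top k" and ?I = "top_of_set {0..1::real}"
  fix g assume g: "(\<forall>m. continuous_map ?S A (g m) \<and> (\<forall>z\<in>{sphere_base k}. g m z = a)) \<and> maps_converge ?S A g a"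
  then have gc: "continuous_map ?S A (g m)" and gb: "g m (sphere_base k) = a" for m by auto
  have "continuous_map (cube k) A (g m \<circ> cube_to_sphere k)" for m
    using continuous_map_cube_to_sphere gc by (rule continuous_map_compose)
  moreover have "maps_converge (cube k) A (\<lambda>m. g m \<circ> cube_to_sphere k) a"
    by (rule maps_converge_mono[OF conjunct2[OF g]]) (use cube_to_sphere_in in auto)
  ultimately have "\<exists>h. (\<forall>m. continuous_map (prod_topology (cube k) ?I) A (h m) \<and>
             (\<forall>z\<in>topspace (cube k). h m (z, 0) = (g m \<circ> cube_to_sphere k) z \<and> h m (z, 1) = a \<and>
                ((g m \<circ> cube_to_sphere k) z = a \<longrightarrow> (\<forall>s\<in>{0..1}. h m (z, s) = a)))) \<and>
          maps_converge (prod_topology (cube k) ?I) A h a"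
    using cube[unfolded rel_contracting_def, rule_format, of "\<lambda>m. g m \<circ> cube_to_sphere k"] by simp
  then obtain h where h: "\<And>m. continuous_map (prod_topology (cube k) ?I) A (h m)"
    and h0: "\<And>m z. z \<in> topspace (cube k) \<Longrightarrow> h m (z, 0) = g m (cube_to_sphere k z)"
    and h1: "\<And>m z. z \<in> topspace (cube k) \<Longrightarrow> h m (z, 1) = a"
    and hrel: "\<And>m z s. \<lbrakk>z \<in> topspace (cube k); g m (cube_to_sphere k z) = a; s \<in> {0..1}\<rbrakk> \<Longrightarrow> h m (z, s) = a"
    and hconv: "maps_converge (prod_topology (cube k) ?I) A h a"
    by (metis comp_apply)
  define lift where "lift p = (SOME t. t \<in> topspace (cube k) \<and> cube_to_sphere k t = p)" for p
  have lift: "lift p \<in> topspace (cube k)" "cube_to_sphere k (lift p) = p"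
    if "p \<in> topspace ?S" "p \<noteq> sphere_base k" for p
    unfolding lift_def using someI_ex[OF cube_to_sphere_surj[OF that, unfolded Bex_def]] by auto
  \<comment> \<open>The value at the basepoint is set separately. For \<open>k = 0\<close> this is
    indispensable: the cube is then a single point, mapped to the other point of the
    0-sphere.\<close>
  define H where "H m = (\<lambda>(p, s). if p = sphere_base k then a else h m (lift p, s))" for m
  have H: "H m (cube_to_sphere k t, s) = h m (t, s)" if t: "t \<in> topspace (cube k)" and s: "s \<in> {0..1}" for m t s
  proof (cases "cube_to_sphere k t = sphere_base k")
    case True
    then show ?thesis using hrel[OF t _ s] gb by (simp add: H_def)
  next
    case False
    note l = lift[OF cube_to_sphere_in False]
    have "lift (cube_to_sphere k t) = t"
      by (rule cube_to_sphere_inj[OF l(1) t l(2)]) (simp add: l(2) False)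
    then show ?thesis using False by (simp add: H_def)
  qed
  have Hbase: "H m (sphere_base k, s) = a" for m s by (simp add: H_def)
  have Hcases: "H m w = a \<and> fst w = sphere_base k \<or>
      (\<exists>t s. t \<in> topspace (cube k) \<and> s \<in> {0..1} \<and> w = (cube_to_sphere k t, s) \<and> H m w = h m (t, s))"
    if w: "w \<in> topspace (prod_topology ?S ?I)" for w m
  proof -
    obtain p s where ps: "w = (p, s)" by (cases w)
    show ?thesis
    proof (cases "p = sphere_base k")
      case True
      then show ?thesis by (simp add: ps H_def)
    next
      case False
      have p: "p \<in> topspace ?S" and s: "s \<in> {0..1}" using w ps by auto
      note l = lift[OF p False]
      have "w = (cube_to_sphere k (lift p), s)" "H m w = h m (lift p, s)"
        using H[OF l(1) s, of m] by (simp_all add: ps l(2))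
      then show ?thesis using l(1) s by blast
    qed
  qed
  let ?Q = "\<lambda>w. (cube_to_sphere k (fst w), snd w :: real)"
  have "continuous_map (prod_topology (cube k) ?I) (prod_topology ?S ?I) ?Q"
    using continuous_map_compose[OF continuous_map_fst continuous_map_cube_to_sphere]
    by (intro continuous_map_pairedI continuous_map_snd) (simp add: o_def)
  then have Q: "closed_map (prod_topology (cube k) ?I) (prod_topology ?S ?I) ?Q"
    by (intro T1_Spaces.continuous_imp_closed_map)
      (simp_all add: compact_space_prod_topology compact_space_cube compact_space_unit_interval
        Hausdorff_space_prod_topology Hausdorff_sphere_top Hausdorff_space_subtopology)
  show "\<exists>h. (\<forall>m. continuous_map (prod_topology ?S ?I) A (h m) \<and>
             (\<forall>z\<in>topspace ?S. h m (z, 0) = g m z \<and> h m (z, 1) = a \<and>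
                (g m z = a \<longrightarrow> (\<forall>s\<in>{0..1}. h m (z, s) = a)))) \<and>
          maps_converge (prod_topology ?S ?I) A h a"
  proof (intro exI[of _ H] conjI allI ballI impI)
    fix m
    show "continuous_map (prod_topology ?S ?I) A (H m)"
      unfolding continuous_map_closedin
    proof (intro conjI allI impI)
      show "H m \<in> topspace (prod_topology ?S ?I) \<rightarrow> topspace A"
      proof
        fix w assume "w \<in> topspace (prod_topology ?S ?I)"
        then consider "H m w = a" | t s where "t \<in> topspace (cube k)" "s \<in> {0..1}" "H m w = h m (t, s)"
          using Hcases by blast
        then show "H m w \<in> topspace A"
          using aA funcset_mem[OF continuous_map_funspace[OF h[of m]]] by cases auto
      qed
      fix C assume C: "closedin A C"
      have "closedin (prod_topology (cube k) ?I) {w \<in> topspace (prod_topology (cube k) ?I). h m w \<in> C}"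
        by (rule closedin_continuous_map_preimage[OF h C])
      then have "closedin (prod_topology ?S ?I) (?Q ` {w \<in> topspace (prod_topology (cube k) ?I). h m w \<in> C})"
        using Q unfolding closed_map_def by blast
      moreover have "closedin (prod_topology ?S ?I) ((if a \<in> C then {sphere_base k} else {}) \<times> {0..1})"
        using closedin_Hausdorff_singleton[OF Hausdorff_sphere_top sphere_base_in[of k]]
          closedin_topspace[of ?I] by (auto simp: closedin_prod_Times_iff)
      moreover have "{w \<in> topspace (prod_topology ?S ?I). H m w \<in> C} =
          ?Q ` {w \<in> topspace (prod_topology (cube k) ?I). h m w \<in> C} \<union>
          (if a \<in> C then {sphere_base k} else {}) \<times> {0..1}" (is "?L = ?R")
      proof (intro set_eqI iffI)
        fix w assume w: "w \<in> ?L"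
        then have "w \<in> topspace (prod_topology ?S ?I)" by blast
        then consider "H m w = a" "fst w = sphere_base k"
          | t s where "t \<in> topspace (cube k)" "s \<in> {0..1}" "w = (cube_to_sphere k t, s)" "H m w = h m (t, s)"
          using Hcases by blast
        then show "w \<in> ?R"
        proof cases
          case 1
          then show ?thesis using w by (auto simp: mem_Times_iff)
        next
          case 2
          then have "(t, s) \<in> {w \<in> topspace (prod_topology (cube k) ?I). h m w \<in> C}" using w by simp
          then show ?thesis using 2(3) by (intro UnI1 rev_image_eqI[of "(t, s)"]) simp_all
        qed
      next
        fix w assume "w \<in> ?R"
        then show "w \<in> ?L"
          using cube_to_sphere_in sphere_base_in[of k] by (auto simp: H Hbase split: if_splits)
      qed
      ultimately show "closedin (prod_topology ?S ?I) ?L" by (simp only: closedin_Un)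
    qed
    fix p assume p: "p \<in> topspace ?S"
    show "H m (p, 0) = g m p" "H m (p, 1) = a"
      using p lift[OF p] h0 h1 gb by (auto simp: H_def)
    show "H m (p, s) = a" if "g m p = a" "s \<in> {0..1}" for s
      using lift[OF p] hrel[of "lift p" m s] that by (auto simp: H_def)
  next
    show "maps_converge (prod_topology ?S ?I) A H a"
      unfolding maps_converge_iff_finite
    proof (intro allI impI)
      fix U assume U: "openin A U \<and> a \<in> U"
      then have "finite {m. \<not> h m ` topspace (prod_topology (cube k) ?I) \<subseteq> U}"
        using hconv unfolding maps_converge_iff_finite by blast
      then show "finite {m. \<not> H m ` topspace (prod_topology ?S ?I) \<subseteq> U}"
      proof (rule rev_finite_subset, intro Collect_mono impI, elim contrapos_nn, intro image_subsetI)
        fix m w assume sub: "h m ` topspace (prod_topology (cube k) ?I) \<subseteq> U"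
          and w: "w \<in> topspace (prod_topology ?S ?I)"
        consider "H m w = a" | t s where "t \<in> topspace (cube k)" "s \<in> {0..1}" "H m w = h m (t, s)"
          using Hcases[OF w] by blast
        then show "H m w \<in> U"
        proof cases
          case 2
          then have "h m (t, s) \<in> U" using sub by (auto simp: image_subset_iff)
          then show ?thesis using 2 by simp
        qed (use U in simp)
      qed
    qed
  qed
qed

section \<open>The two assertions about the adjunction space\<close>

theorem theorem4p11:
  fixes X :: "'a topology" and x :: "nat \<Rightarrow> 'a" and y0 :: 'a
    and A :: "nat \<Rightarrow> 'b topology" and a :: "nat \<Rightarrow> 'b" and n :: nat
  assumes "Hausdorff_space X"
    and "\<And>j. Hausdorff_space (A j)"
    and "y0 \<in> topspace X"
    and "\<And>j. x j \<in> topspace X"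
    and "\<And>j. a j \<in> topspace (A j)"
    and "\<And>j. seq_n_connected_at (A j) (a j) n"
  shows "(\<forall>f :: nat \<Rightarrow> (nat \<Rightarrow> real) \<Rightarrow> 'a + nat \<times> 'b.
            (\<forall>m. f m \<in> Omega n (Adj X x A a) (Inl y0)) \<and>
            maps_converge (cube n) (Adj X x A a) f (Inl y0) \<longrightarrow>
            seq_homotopic (cube n) (Adj X x A a) (Inl y0) f
              (\<lambda>m. Inl \<circ> adj_retraction x \<circ> f m))
       \<and> (seq_n_connected_at X y0 n \<longrightarrow> seq_n_connected_at (Adj X x A a) (Inl y0) n)"
proof -
  let ?Y = "Adj X x A a" and ?I = "top_of_set {0..1::real}"
  have t1: "\<And>j. t1_space (A j)" using assms(2) Hausdorff_imp_t1_space by blast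
  note xX = assms(4) and aA = assms(5) and y0 = assms(3)
  have SC: "seq_contractible k (A j) (a j)" if "k \<le> n" for k j
    using assms(6)[of j] that
    by (intro based_contractible_maps_imp_seq_contractible) (simp add: seq_n_connected_at_iff[OF aA])
  have contr: "rel_contracting (cube k) {} (A j) (a j)" if "k \<le> n" for k j
    using t1 aA SC that by (intro rel_contracting_cube) auto
  have yY: "Inl y0 \<in> topspace ?Y" using y0 by (simp add: topspace_Adj[OF t1 xX aA] adj_all_points_def)
  show ?thesis
  proof (intro conjI allI impI)
    fix f :: "nat \<Rightarrow> (nat \<Rightarrow> real) \<Rightarrow> 'a + nat \<times> 'b"
    assume f: "(\<forall>m. f m \<in> Omega n ?Y (Inl y0)) \<and> maps_converge (cube n) ?Y f (Inl y0)"
    then have fc: "\<And>m. continuous_map (cube n) ?Y (f m)" and fconv: "maps_converge (cube n) ?Y f (Inl y0)"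
      by (auto simp: Omega_def)
    obtain H where H: "\<And>m. continuous_map (prod_topology (cube n) ?I) ?Y (H m)"
      and H0: "\<And>m z. z \<in> topspace (cube n) \<Longrightarrow> H m (z, 0) = f m z"
      and H1: "\<And>m z. z \<in> topspace (cube n) \<Longrightarrow> H m (z, 1) = Inl (adj_retraction x (f m z))"
      and Hconv: "maps_converge (prod_topology (cube n) ?I) ?Y H (Inl y0)"
      by (rule Adj_homotopy_to_retraction[OF t1 xX aA contr[OF order_refl] fc _ y0 fconv])
        (simp, rule that)
    \<comment> \<open>The retracted maps are the ends of \<open>H\<close> at time 1, so they
      converge because \<open>H\<close> does.\<close>
    have "maps_converge (cube n) ?Y (\<lambda>m. Inl \<circ> adj_retraction x \<circ> f m) (Inl y0)"
      by (rule maps_converge_mono[OF Hconv]) (force simp: H1[symmetric])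
    then show "seq_homotopic (cube n) ?Y (Inl y0) f (\<lambda>m. Inl \<circ> adj_retraction x \<circ> f m)"
      unfolding seq_homotopic_def
      by (intro conjI fconv exI[of _ H] allI ballI H Hconv) (simp_all add: H0 H1)
  next
    assume X: "seq_n_connected_at X y0 n"
    have Inl: "continuous_map X ?Y Inl"
    proof (rule continuous_map_into_Adj[OF t1 xX aA])
      show "continuous_map X (A j) (\<lambda>p. adj_coord a j (Inl p))" for j
        using aA by (simp add: adj_coord_def)
    qed (simp_all add: adj_retraction_def adj_all_points_def)
    show "seq_n_connected_at ?Y (Inl y0) n"
      unfolding seq_n_connected_at_iff[OF yY]
    proof (intro allI impI)
      fix k assume k: "k \<le> n"
      let ?W = "shrinking_wedge k" and ?S = "sphere_top k"
      show "based_contractible_maps ?W None ?Y (Inl y0)"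
        unfolding based_contractible_maps_def
      proof
        fix f assume "f \<in> based_maps ?W None ?Y (Inl y0)"
        then have f: "continuous_map ?W ?Y f" and f0: "f None = Inl y0" by (auto simp: based_maps_def)
        define F where "F m p = f (wedge_incl k m p)" for m p
        have Fc: "continuous_map ?S ?Y (F m)" for m
          using continuous_map_compose[OF continuous_map_wedge_incl f, of m] by (simp add: F_def[abs_def] o_def)
        have Fconv: "maps_converge ?S ?Y F (Inl y0)"
          unfolding F_def using maps_converge_wedge_incl[OF f f0] .
        have Fb: "F m p = Inl y0" if "p \<in> {sphere_base k}" for m p using that f0 by (simp add: F_def)
        obtain H where H: "\<And>m. continuous_map (prod_topology ?S ?I) ?Y (H m)"
          and H0: "\<And>m p. p \<in> topspace ?S \<Longrightarrow> H m (p, 0) = F m p"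
          and H1: "\<And>m p. p \<in> topspace ?S \<Longrightarrow> H m (p, 1) = Inl (adj_retraction x (F m p))"
          and Hrel: "\<And>m p s q. F m p = Inl q \<Longrightarrow> H m (p, s) = Inl q"
          and Hconv: "maps_converge (prod_topology ?S ?I) ?Y H (Inl y0)"
          by (rule Adj_homotopy_to_retraction[OF t1 xX aA rel_contracting_sphere[OF contr[OF k] aA] Fc _ y0 Fconv])
            (rule Fb, assumption, rule that)
        \<comment> \<open>By stationarity on \<open>X\<close> the homotopies fix the basepoint of
          every sphere, so together they form a based homotopy on the wedge.\<close>
        have "homotopic_with (\<lambda>h. h None = Inl y0) ?W ?Y f (Inl \<circ> (adj_retraction x \<circ> f))"
          by (rule homotopic_with_shrinking_wedge[OF H _ _ _ Hconv])
            (simp_all add: H0 H1 F_def Hrel f0)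
        moreover have "adj_retraction x \<circ> f \<in> based_maps ?W None X y0"
          using continuous_map_compose[OF f continuous_map_adj_retraction[OF t1 xX aA]] f0
          by (simp add: based_maps_def adj_retraction_def)
        \<comment> \<open>The retracted map lives in \<open>X\<close>, where connectivity contracts
          it; the inclusion \<open>Inl\<close> then carries this contraction into the adjunction
          space.\<close>
        then have "homotopic_with (\<lambda>h. h None = y0) ?W X (adj_retraction x \<circ> f) (\<lambda>_. y0)"
          using X k by (simp add: seq_n_connected_at_iff[OF y0] based_contractible_maps_def)
        then have "homotopic_with (\<lambda>h. h None = Inl y0) ?W ?Y (Inl \<circ> (adj_retraction x \<circ> f)) (Inl \<circ> (\<lambda>_. y0))"
          by (rule homotopic_with_compose_continuous_map_left[OF _ Inl]) simp
        ultimately show "homotopic_with (\<lambda>h. h None = Inl y0) ?W ?Y f (\<lambda>_. Inl y0)"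
          using homotopic_with_trans by (fastforce simp: o_def)
      qed
    qed
  qed
qed

end
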